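(* Let $(X,d)$ be a metric space. Then the following are equivalent. (i) $(X,d)$ is biLipschitz equivalent to a snowflake. (ii) No ultralimit of $(X,d)$ contains a non-trivial (i.e. non-constant) rectifiable curve. (iii) Every ultralimit of $(X,d)$ is purely $1$-unrectifiable. (iv) Every ultralimit of $(X,d)$ has no non-trivial metric $1$-currents with inner-regular mass; that is, $\mathbf{M}_1^{\rm reg}(X_\omega)=\{0\}$ for every ultralimit $(X_\omega,d_\omega,x_\omega)$ of $(X,d)$.
   Context: **Snowflakes.** A metric space $(X,d)$ is an $\alpha$-snowflake, $\alpha\in(0,1)$, if there is a metric space $(Y,\rho)$ with $(X,d)=(Y,\rho^\alpha)$; it is a snowflake if it is an $\alpha$-snowflake for some $\alpha\in(0,1)$. A map $f\colon(X,d)\to(Y,d')$ is biLipschitz if there is $C\ge1$ with $C^{-1}d(x,x')\le d'(f(x),f(x'))\le C\,d(x,x')$ for all $x,x'\in X$. Two metric spaces are biLipschitz equivalent if there is a surjective biLipschitz map from one onto the other. **Rectifiable curves.** A curve is a continuous map $\gamma\colon[0,1]\to X$; its length is $\ell(\gamma)=\sup\sum_{i=0}^{N-1}d(\gamma(t_i),\gamma(t_{i+1}))$ over all partitions $0=t_0<\dots<t_N=1$, $N\in\mathbb{N}$. It is rectifiable if $\ell(\gamma)<\infty$. **Ultralimits.** A non-principal ultrafilter $\omega$ on $\mathbb{N}$ is a non-trivial finitely additive measure on all subsets of $\mathbb{N}$ with values in $\{0,1\}$ that vanishes on finite sets. For a bounded real sequence $(a_n)$, $\omega\text{-}\lim a_n$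 is the unique $a\in\mathbb{R}$ with $\omega(\{n:|a_n-a|<\varepsilon\})=1$ for all $\varepsilon>0$; unbounded sequences may have $\omega$-limit $\pm\infty$. Given pointed metric spaces $(X_n,d_n,x_n)$, a sequence $(y_n)$ with $y_n\in X_n$ is $\omega$-admissible if $\omega\text{-}\lim d_n(x_n,y_n)<\infty$. The $\omega$-limit $(X_\omega,d_\omega,x_\omega)$ of $(X_n,d_n,x_n)$ is the set of $\omega$-admissible sequences modulo the relation $\omega\text{-}\lim d_n(y_n,z_n)=0$, with metric $d_\omega([y_n],[z_n])=\omega\text{-}\lim d_n(y_n,z_n)$ and base point $x_\omega=[x_n]$. An $\omega$-limit of a metric space $(X,d)$ is the $\omega$-limit of a sequence $(X,r_nd,x_n)$, where $x_n\in X$ and $r_n>0$ are arbitrary sequences. An ultralimit of $(X,d)$ is an $\omega$-limit of $(X,d)$ for some non-principal ultrafilter $\omega$. **Rectifiability.** A metric space is $1$-rectifiable if it can be covered, up to an $\mathcal{H}^1$-null set, by countably many Lipschitz images of Borel subsets of $\mathbb{R}$. A subset $E$ of a metric space $(X,d)$ is $1$-rectifiable if $(E,d)$ is. A metric space is purely $1$-unrectifiable if it contains no $1$-rectifiable subset $E$ with $\mathcal{H}^1(E)>0$. **Metric currents.** For a metric space $X$, let $\mathrm{Lip}(X)$ be the real-valued Lipschitz functions, $\mathrm{Lip}_b(X)$ the bounded ones, and $\mathrm{LIP}(\pi)$ the Lipschitz constant of $\pi$. A metric $1$-current is a multilinear (i.e. bilinear) functional $T\colon \mathrm{Lip}_b(X)\times\mathrm{Lip}(X)\to\mathbb{R}$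 such that: (Locality) $T(f,\pi)=0$ if $\pi$ is constant on a neighbourhood of $\{f\ne0\}$; (Continuity) if $f\in\mathrm{Lip}_b(X)$, $\pi_n,\pi\in\mathrm{Lip}(X)$, $\sup_n\mathrm{LIP}(\pi_n)<\infty$ and $\pi_n\to\pi$ pointwise, then $T(f,\pi_n)\to T(f,\pi)$; (Finite mass) there is a finite nonnegative Borel measure $\mu$ on $X$ with $|T(f,\pi)|\le\mathrm{LIP}(\pi)\int|f|\,d\mu$ for all $(f,\pi)$. The minimal such $\mu$ is the mass measure $\|T\|$. $\mathbf{M}_1(X)$ denotes the space of metric $1$-currents on $X$ and $\mathbf{M}_1^{\rm reg}(X)$ the set of those $T\in\mathbf{M}_1(X)$ for which $\|T\|$ is inner regular by compact sets. *)

theory Defs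
  imports "HOL-Analysis.Analysis"
begin

section \<open>Snowflakes and biLipschitz equivalence\<close>

definition is_snowflake_of :: "real \<Rightarrow> 'a metric \<Rightarrow> bool"
  where "is_snowflake_of \<alpha> X \<longleftrightarrow> 0 < \<alpha> \<and> \<alpha> < 1 \<and>
    (\<exists>Y :: 'a metric. mspace Y = mspace X \<and>
      (\<forall>x\<in>mspace X. \<forall>y\<in>mspace X. mdist X x y = mdist Y x y powr \<alpha>))"

definition snowflake :: "'a metric \<Rightarrow> bool"
  where "snowflake X \<longleftrightarrow> (\<exists>\<alpha>. is_snowflake_of \<alpha> X)"

definition biLipschitz_map :: "'a metric \<Rightarrow> 'b metric \<Rightarrow> ('a \<Rightarrow> 'b) \<Rightarrow> bool"
  where "biLipschitz_map X Y f \<longleftrightarrow> f \<in> mspace X \<rightarrow> mspace Y \<and>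
    (\<exists>C\<ge>1. \<forall>x\<in>mspace X. \<forall>x'\<in>mspace X.
       inverse C * mdist X x x' \<le> mdist Y (f x) (f x') \<and>
       mdist Y (f x) (f x') \<le> C * mdist X x x')"

definition biLipschitz_equivalent :: "'a metric \<Rightarrow> 'b metric \<Rightarrow> bool"
  where "biLipschitz_equivalent X Y \<longleftrightarrow>
    (\<exists>f. biLipschitz_map X Y f \<and> f ` mspace X = mspace Y) \<or>
    (\<exists>g. biLipschitz_map Y X g \<and> g ` mspace Y = mspace X)"

lemma biLipschitz_map_inj_on:
  assumes "biLipschitz_map X Y f" shows "inj_on f (mspace X)"
proof (rule inj_onI)
  fix x y assume xy: "x \<in> mspace X" "y \<in> mspace X" "f x = f y"
  obtain C where C: "C \<ge> 1" "inverse C * mdist X x y \<le> mdist Y (f x) (f y)"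
    using assms xy unfolding biLipschitz_map_def by blast
  have "f x \<in> mspace Y" using assms xy by (auto simp: biLipschitz_map_def)
  then have "mdist Y (f x) (f y) = 0" using xy by simp
  then have "inverse C * mdist X x y \<le> 0" using C by simp
  then have "mdist X x y \<le> 0"
    using C(1) by (simp add: mult_le_0_iff)
  then show "x = y" using xy by (metis mdist_nonneg mdist_zero order_antisym)
qed

text \<open>Being biLipschitz equivalent to a snowflake does not depend on the type over which
  the snowflake ranges: the snowflake can be transported to the underlying set of \<open>X\<close>.\<close>

lemma biLipschitz_to_snowflake_transport:
  fixes X :: "'a metric" and S :: "'b metric"
  assumes S: "snowflake S" and XS: "biLipschitz_equivalent X S"
  shows "\<exists>S' :: 'a metric. snowflake S' \<and> biLipschitz_equivalent X S'"
proof -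
  have "\<exists>h C. bij_betw h (mspace X) (mspace S) \<and> C \<ge> 1 \<and> (\<forall>x\<in>mspace X. \<forall>x'\<in>mspace X.
       inverse C * mdist X x x' \<le> mdist S (h x) (h x') \<and> mdist S (h x) (h x') \<le> C * mdist X x x')"
    using XS unfolding biLipschitz_equivalent_def
  proof (elim disjE exE conjE)
    fix f assume f: "biLipschitz_map X S f" "f ` mspace X = mspace S"
    then show ?thesis
      using biLipschitz_map_inj_on[OF f(1)] unfolding biLipschitz_map_def bij_betw_def by blast
  next
    fix g assume g: "biLipschitz_map S X g" "g ` mspace S = mspace X"
    define h where "h = inv_into (mspace S) g"
    have b: "bij_betw g (mspace S) (mspace X)"
      using g biLipschitz_map_inj_on[OF g(1)] by (simp add: bij_betw_def)
    then have h: "bij_betw h (mspace X) (mspace S)"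
      unfolding h_def by (rule bij_betw_inv_into)
    obtain C where C: "C \<ge> 1" "\<And>s s'. s \<in> mspace S \<Longrightarrow> s' \<in> mspace S \<Longrightarrow>
       inverse C * mdist S s s' \<le> mdist X (g s) (g s') \<and> mdist X (g s) (g s') \<le> C * mdist S s s'"
      using g unfolding biLipschitz_map_def by blast
    have "inverse C * mdist X x x' \<le> mdist S (h x) (h x') \<and> mdist S (h x) (h x') \<le> C * mdist X x x'"
      if "x \<in> mspace X" "x' \<in> mspace X" for x x'
    proof -
      have "h x \<in> mspace S" "h x' \<in> mspace S" "g (h x) = x" "g (h x') = x'"
        using that h b unfolding h_def
        by (auto simp: bij_betw_apply bij_betw_inv_into_right)
      with C(2)[of "h x" "h x'"] C(1) show ?thesis by (simp add: field_simps)
    qed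
    with h C(1) show ?thesis by blast
  qed
  then obtain h C where h: "bij_betw h (mspace X) (mspace S)" and C: "C \<ge> 1"
    "\<And>x x'. x \<in> mspace X \<Longrightarrow> x' \<in> mspace X \<Longrightarrow>
       inverse C * mdist X x x' \<le> mdist S (h x) (h x') \<and> mdist S (h x) (h x') \<le> C * mdist X x x'"
    by blast
  have hS: "h x \<in> mspace S" if "x \<in> mspace X" for x using h that by (auto simp: bij_betw_def)
  have hi: "h x = h y \<longleftrightarrow> x = y" if "x \<in> mspace X" "y \<in> mspace X" for x y
    using h that by (auto simp: bij_betw_def inj_on_def)
  define pb where "pb Z = metric (mspace X, \<lambda>x y. mdist Z (h x) (h y))" for Z :: "'b metric"
  have pb: "mspace (pb Z) = mspace X" "mdist (pb Z) = (\<lambda>x y. mdist Z (h x) (h y))"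
    if "mspace Z = mspace S" for Z
  proof -
    interpret Metric_space "mspace X" "\<lambda>x y. mdist Z (h x) (h y)"
    proof
      fix x y z assume xy: "x \<in> mspace X" "y \<in> mspace X"
      show "mdist Z (h x) (h y) = 0 \<longleftrightarrow> x = y" using xy hS hi that by simp
      assume "z \<in> mspace X"
      with xy show "mdist Z (h x) (h z) \<le> mdist Z (h x) (h y) + mdist Z (h y) (h z)"
        using hS that by (intro mdist_triangle) auto
    qed (auto simp: mdist_commute)
    show "mspace (pb Z) = mspace X" "mdist (pb Z) = (\<lambda>x y. mdist Z (h x) (h y))"
      by (auto simp: pb_def)
  qed
  obtain \<alpha> Y where Y: "0 < \<alpha>" "\<alpha> < 1" "mspace Y = mspace S"
    "\<forall>x\<in>mspace S. \<forall>y\<in>mspace S. mdist S x y = mdist Y x y powr \<alpha>"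
    using S unfolding snowflake_def is_snowflake_of_def by blast
  have "is_snowflake_of \<alpha> (pb S)"
    unfolding is_snowflake_of_def using Y hS pb by (intro conjI exI[of _ "pb Y"]) auto
  moreover have "biLipschitz_map X (pb S) id"
    unfolding biLipschitz_map_def using C pb[OF refl] by auto
  ultimately show ?thesis
    unfolding snowflake_def biLipschitz_equivalent_def using pb(1)[OF refl] by (metis image_id id_apply)
qed


section \<open>Rectifiable curves\<close>

definition curve_length :: "'a metric \<Rightarrow> (real \<Rightarrow> 'a) \<Rightarrow> ennreal"
  where "curve_length X \<gamma> =
    (SUP (N, t) \<in> {(N :: nat, t :: nat \<Rightarrow> real). t 0 = 0 \<and> t N = 1 \<and> (\<forall>i<N. t i < t (Suc i))}.
       \<Sum>i<N. ennreal (mdist X (\<gamma> (t i)) (\<gamma> (t (Suc i)))))"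

definition rectifiable_curve :: "'a metric \<Rightarrow> (real \<Rightarrow> 'a) \<Rightarrow> bool"
  where "rectifiable_curve X \<gamma> \<longleftrightarrow> pathin (mtopology_of X) \<gamma> \<and> curve_length X \<gamma> < \<infinity>"

definition nonconstant_curve :: "(real \<Rightarrow> 'a) \<Rightarrow> bool"
  where "nonconstant_curve \<gamma> \<longleftrightarrow> (\<exists>s\<in>{0..1}. \<exists>t\<in>{0..1}. \<gamma> s \<noteq> \<gamma> t)"


section \<open>Ultralimits\<close>

definition nonprincipal_ultrafilter :: "(nat set \<Rightarrow> real) \<Rightarrow> bool"
  where "nonprincipal_ultrafilter \<omega> \<longleftrightarrow>
    (\<forall>A. \<omega> A \<in> {0, 1}) \<and> \<omega> UNIV = 1 \<and>
    (\<forall>A B. A \<inter> B = {} \<longrightarrow> \<omega> (A \<union> B) = \<omega> A + \<omega> B) \<and>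
    (\<forall>A. finite A \<longrightarrow> \<omega> A = 0)"

text \<open>Only finite limits are represented; a sequence of nonnegative reals has
  \<open>\<omega>\<close>-limit \<open>< \<infinity>\<close> iff it has some real \<open>\<omega>\<close>-limit.\<close>

definition has_omega_lim :: "(nat set \<Rightarrow> real) \<Rightarrow> (nat \<Rightarrow> real) \<Rightarrow> real \<Rightarrow> bool"
  where "has_omega_lim \<omega> a l \<longleftrightarrow> (\<forall>\<epsilon>>0. \<omega> {n. \<bar>a n - l\<bar> < \<epsilon>} = 1)"

definition omega_admissible ::
    "(nat set \<Rightarrow> real) \<Rightarrow> (nat \<Rightarrow> 'a metric) \<Rightarrow> (nat \<Rightarrow> 'a) \<Rightarrow> (nat \<Rightarrow> 'a) set"
  where "omega_admissible \<omega> X x =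
    {y. (\<forall>n. y n \<in> mspace (X n)) \<and> (\<exists>l. has_omega_lim \<omega> (\<lambda>n. mdist (X n) (x n) (y n)) l)}"

definition omega_rel ::
    "(nat set \<Rightarrow> real) \<Rightarrow> (nat \<Rightarrow> 'a metric) \<Rightarrow> (nat \<Rightarrow> 'a) \<Rightarrow> (nat \<Rightarrow> 'a) rel"
  where "omega_rel \<omega> X x =
    {(y, z). y \<in> omega_admissible \<omega> X x \<and> z \<in> omega_admissible \<omega> X x \<and>
       has_omega_lim \<omega> (\<lambda>n. mdist (X n) (y n) (z n)) 0}"

definition omega_space ::
    "(nat set \<Rightarrow> real) \<Rightarrow> (nat \<Rightarrow> 'a metric) \<Rightarrow> (nat \<Rightarrow> 'a) \<Rightarrow> (nat \<Rightarrow> 'a) set set"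
  where "omega_space \<omega> X x = omega_admissible \<omega> X x // omega_rel \<omega> X x"

text \<open>The value outside the carrier is set to \<open>0\<close> because \<^locale>\<open>Metric_space\<close> requires
  the distance function to be nonnegative and symmetric on the whole type.\<close>

definition omega_dist ::
    "(nat set \<Rightarrow> real) \<Rightarrow> (nat \<Rightarrow> 'a metric) \<Rightarrow> (nat \<Rightarrow> 'a) \<Rightarrow>
     (nat \<Rightarrow> 'a) set \<Rightarrow> (nat \<Rightarrow> 'a) set \<Rightarrow> real"
  where "omega_dist \<omega> X x A B =
    (if A \<in> omega_space \<omega> X x \<and> B \<in> omega_space \<omega> X x
     then THE l. \<exists>y\<in>A. \<exists>z\<in>B. has_omega_lim \<omega> (\<lambda>n. mdist (X n) (y n) (z n)) l
     else 0)"

definition omega_limit ::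
    "(nat set \<Rightarrow> real) \<Rightarrow> (nat \<Rightarrow> 'a metric) \<Rightarrow> (nat \<Rightarrow> 'a) \<Rightarrow> (nat \<Rightarrow> 'a) set metric"
  where "omega_limit \<omega> X x = metric (omega_space \<omega> X x, omega_dist \<omega> X x)"

definition rescaled :: "real \<Rightarrow> 'a metric \<Rightarrow> 'a metric"
  where "rescaled r X = metric (mspace X, \<lambda>x y. r * mdist X x y)"

definition is_ultralimit :: "'a metric \<Rightarrow> (nat \<Rightarrow> 'a) set metric \<Rightarrow> (nat \<Rightarrow> 'a) set \<Rightarrow> bool"
  where "is_ultralimit X Z z \<longleftrightarrow>
    (\<exists>\<omega> r x. nonprincipal_ultrafilter \<omega> \<and> (\<forall>n. 0 < r n) \<and> (\<forall>n. x n \<in> mspace X) \<and>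
       Z = omega_limit \<omega> (\<lambda>n. rescaled (r n) X) x \<and>
       z = omega_rel \<omega> (\<lambda>n. rescaled (r n) X) x `` {x})"

lemma rescaled_metric:
  assumes "r > 0"
  shows mspace_rescaled: "mspace (rescaled r X) = mspace X"
    and mdist_rescaled: "mdist (rescaled r X) = (\<lambda>x y. r * mdist X x y)"
proof -
  interpret Metric_space "mspace X" "\<lambda>x y. r * mdist X x y"
  proof
    fix x y z assume "x \<in> mspace X" "y \<in> mspace X" "z \<in> mspace X"
    then show "r * mdist X x z \<le> r * mdist X x y + r * mdist X y z"
      using assms by (simp flip: distrib_left add: mdist_triangle)
  qed (use assms in \<open>auto simp: mdist_commute\<close>)
  show "mspace (rescaled r X) = mspace X" "mdist (rescaled r X) = (\<lambda>x y. r * mdist X x y)"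
    by (simp_all add: rescaled_def)
qed

text \<open>The \<open>\<omega>\<close>-limit is well defined: \<open>\<omega>\<close> is the same as a filter all of whose
  bounded real sequences converge.\<close>

lemma omega_filter:
  assumes "nonprincipal_ultrafilter \<omega>"
  obtains F :: "nat filter" where "F \<noteq> bot"
    and "\<And>P. eventually P F \<longleftrightarrow> \<omega> {n. P n} = 1"
    and "\<And>P. eventually P F \<or> eventually (\<lambda>n. \<not> P n) F"
    and "\<And>a l. has_omega_lim \<omega> a l \<longleftrightarrow> (a \<longlongrightarrow> l) F"
proof -
  note \<omega> = assms[unfolded nonprincipal_ultrafilter_def]
  have v: "\<omega> A = 0 \<or> \<omega> A = 1" for A
    using \<omega> by blast
  have U: "\<omega> UNIV = 1" and e: "\<omega> {} = 0"
    using \<omega> by blast+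
  have add: "\<omega> (A \<union> B) = \<omega> A + \<omega> B" if "A \<inter> B = {}" for A B
    using \<omega> that by blast
  have mono: "\<omega> B = 1" if "A \<subseteq> B" "\<omega> A = 1" for A B
  proof -
    have "A \<union> (B - A) = B" using that by blast
    then have "\<omega> B = \<omega> A + \<omega> (B - A)" using add[of A "B - A"] by (metis Diff_disjoint)
    then show ?thesis using v[of "B - A"] v[of B] that(2) by linarith
  qed
  have compl: "\<omega> A = 1 \<or> \<omega> (- A) = 1" for A
  proof -
    have "\<omega> A + \<omega> (- A) = 1" using add[of A "- A"] U by (metis Compl_disjoint Compl_partition)
    then show ?thesis using v[of A] by linarith
  qed
  have int: "\<omega> (A \<inter> B) = 1" if "\<omega> A = 1" "\<omega> B = 1" for A B
  proof -
    have "\<omega> A = \<omega> (A \<inter> B) + \<omega> (A - B)"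
    proof -
      have "A \<inter> B \<union> (A - B) = A" "A \<inter> B \<inter> (A - B) = {}" by blast+
      then show ?thesis using add[of "A \<inter> B" "A - B"] by metis
    qed
    moreover have "\<omega> (B \<union> (A - B)) = \<omega> B + \<omega> (A - B)" by (rule add) auto
    ultimately show ?thesis using v[of "A - B"] v[of "B \<union> (A - B)"] that by linarith
  qed
  define F where "F = Abs_filter (\<lambda>P. \<omega> {n. P n} = 1)"
  have "is_filter (\<lambda>P. \<omega> {n. P n} = 1)"
  proof
    show "\<omega> {n. True} = 1" using U by simp
  next
    fix P Q assume "\<omega> {n. P n} = 1" "\<omega> {n. Q n} = 1"
    from int[OF this] show "\<omega> {n. P n \<and> Q n} = 1" unfolding Collect_conj_eq .
  next
    fix P Q assume "\<forall>n. P n \<longrightarrow> Q n" "\<omega> {n. P n} = 1"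
    then show "\<omega> {n. Q n} = 1" using mono[of "{n. P n}" "{n. Q n}"] by blast
  qed
  then have ev: "eventually P F \<longleftrightarrow> \<omega> {n. P n} = 1" for P
    unfolding F_def by (rule eventually_Abs_filter)
  show thesis
  proof (rule that)
    show "F \<noteq> bot" using e by (auto simp: trivial_limit_def ev)
    show "eventually P F \<longleftrightarrow> \<omega> {n. P n} = 1" for P by (rule ev)
    show "eventually P F \<or> eventually (\<lambda>n. \<not> P n) F" for P
      using compl[of "{n. P n}"] unfolding ev Collect_neg_eq .
    show "has_omega_lim \<omega> a l \<longleftrightarrow> (a \<longlongrightarrow> l) F" for a l
      by (simp add: has_omega_lim_def tendsto_iff ev dist_real_def)
  qed
qed

lemma omega_limit_metric:
  fixes X :: "nat \<Rightarrow> 'a metric"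
  assumes \<omega>: "nonprincipal_ultrafilter \<omega>" and x: "\<And>n. x n \<in> mspace (X n)"
  shows omega_rel_equiv: "equiv (omega_admissible \<omega> X x) (omega_rel \<omega> X x)"
    and Metric_space_omega: "Metric_space (omega_space \<omega> X x) (omega_dist \<omega> X x)"
    and has_omega_lim_omega_dist:
      "\<And>y z. y \<in> omega_admissible \<omega> X x \<Longrightarrow> z \<in> omega_admissible \<omega> X x \<Longrightarrow>
        has_omega_lim \<omega> (\<lambda>n. mdist (X n) (y n) (z n))
          (omega_dist \<omega> X x (omega_rel \<omega> X x `` {y}) (omega_rel \<omega> X x `` {z}))"
proof -
  obtain F where F: "F \<noteq> bot"
    and ultra: "\<And>P. eventually P F \<or> eventually (\<lambda>n. \<not> P n) F"
    and lim: "\<And>a l. has_omega_lim \<omega> a l \<longleftrightarrow> (a \<longlongrightarrow> l) F"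
    using omega_filter[OF \<omega>] by metis
  let ?A = "omega_admissible \<omega> X x" and ?R = "omega_rel \<omega> X x"
  let ?d = "\<lambda>y z n. mdist (X n) (y n) (z n)"
  have A: "y n \<in> mspace (X n)" if "y \<in> ?A" for y n
    using that by (simp add: omega_admissible_def)
  have tri: "?d y w n \<le> ?d y z n + ?d z w n" if "y \<in> ?A" "z \<in> ?A" "w \<in> ?A" for y z w n
    using A that by (simp add: mdist_triangle)
  have ex: "\<exists>l. (?d y z \<longlongrightarrow> l) F" if yz: "y \<in> ?A" "z \<in> ?A" for y z
  proof -
    obtain l m where l: "(?d x y \<longlongrightarrow> l) F" and m: "(?d x z \<longlongrightarrow> m) F"
      using yz by (auto simp: omega_admissible_def lim)
    have "eventually (\<lambda>n. ?d x y n < l + 1) F" "eventually (\<lambda>n. ?d x z n < m + 1) F"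
      using order_tendstoD(2)[OF l, of "l + 1"] order_tendstoD(2)[OF m, of "m + 1"] by auto
    then have "eventually (\<lambda>n. ?d y z n \<in> {0..l + m + 2}) F"
    proof eventually_elim
      case (elim n)
      have "?d y z n \<le> ?d y x n + ?d x z n"
        using A[OF yz(1)] A[OF yz(2)] x by (simp add: mdist_triangle)
      with elim show ?case by (simp add: mdist_commute)
    qed
    then have "eventually (\<lambda>v. v \<in> {0..l + m + 2}) (filtermap (?d y z) F)"
      by (simp add: eventually_filtermap)
    moreover have "filtermap (?d y z) F \<noteq> bot" using F by (simp add: filtermap_bot_iff)
    ultimately obtain v where v: "inf (nhds v) (filtermap (?d y z) F) \<noteq> bot"
      using compact_Icc[of 0 "l + m + 2"] unfolding compact_filter by blast
    have "eventually (\<lambda>n. ?d y z n \<in> S) F" if "open S" "v \<in> S" for S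
    proof (rule ccontr)
      assume "\<not> ?thesis"
      then have "eventually (\<lambda>n. ?d y z n \<notin> S) F" using ultra by blast
      then have "eventually (\<lambda>u. u \<notin> S) (filtermap (?d y z) F)" by (simp add: eventually_filtermap)
      moreover have "eventually (\<lambda>u. u \<in> S) (nhds v)" using that by (rule eventually_nhds_in_open)
      ultimately have "eventually (\<lambda>u. False) (inf (nhds v) (filtermap (?d y z) F))"
        unfolding eventually_inf by blast
      with v show False by (simp add: trivial_limit_def)
    qed
    then show ?thesis by (auto simp: tendsto_def)
  qed
  have R: "(y, z) \<in> ?R \<longleftrightarrow> y \<in> ?A \<and> z \<in> ?A \<and> (?d y z \<longlongrightarrow> 0) F" for y z
    by (auto simp: omega_rel_def lim)
  show equiv: "equiv ?A ?R"
  proof (rule equivI)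
    show "?R \<subseteq> ?A \<times> ?A" by (auto simp: R)
    have "(\<lambda>n. mdist (X n) (y n) (y n)) = (\<lambda>n. 0)" if "y \<in> ?A" for y
      using A[OF that] by auto
    then show "refl_on ?A ?R" by (auto simp: refl_on_def R)
    show "sym ?R" by (auto simp: sym_def R mdist_commute)
    show "trans ?R"
    proof (rule transI)
      fix y z w assume yzw: "(y, z) \<in> ?R" "(z, w) \<in> ?R"
      then have "((\<lambda>n. ?d y z n + ?d z w n) \<longlongrightarrow> 0) F"
        using tendsto_add[of "?d y z" 0 F "?d z w" 0] by (auto simp: R)
      then have "(?d y w \<longlongrightarrow> 0) F"
        by (rule tendsto_sandwich[OF _ _ tendsto_const, rotated 2])
          (use yzw tri in \<open>auto simp: R intro!: always_eventually\<close>)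
      with yzw show "(y, w) \<in> ?R" by (auto simp: R)
    qed
  qed
  have indep: "(?d y' z' \<longlongrightarrow> l) F"
    if "(y, y') \<in> ?R" "(z, z') \<in> ?R" "(?d y z \<longlongrightarrow> l) F" for y y' z z' l
  proof -
    have yz: "y \<in> ?A" "y' \<in> ?A" "z \<in> ?A" "z' \<in> ?A" using that by (auto simp: R)
    have "((\<lambda>n. ?d y y' n + ?d z z' n) \<longlongrightarrow> 0) F"
      using that tendsto_add[of "?d y y'" 0 F "?d z z'" 0] by (auto simp: R)
    then have "((\<lambda>n. ?d y' z' n - ?d y z n) \<longlongrightarrow> 0) F"
    proof (rule Lim_null_comparison[rotated], intro always_eventually allI)
      fix n
      show "norm (?d y' z' n - ?d y z n) \<le> ?d y y' n + ?d z z' n"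
        using tri[of y' y z' n] tri[of y z z' n] tri[of y y' z n] tri[of y' z' z n] yz
        by (simp add: mdist_commute abs_le_iff)
    qed
    from tendsto_add[OF this that(3)] show ?thesis by simp
  qed
  have dist: "(?d y z \<longlongrightarrow> omega_dist \<omega> X x (?R `` {y}) (?R `` {z})) F"
    if yz: "y \<in> ?A" "z \<in> ?A" for y z
  proof -
    obtain l where l: "(?d y z \<longlongrightarrow> l) F" using ex[OF yz] by blast
    have "(THE l. \<exists>y'\<in>?R `` {y}. \<exists>z'\<in>?R `` {z}. has_omega_lim \<omega> (?d y' z') l) = l"
    proof (rule the_equality)
      show "\<exists>y'\<in>?R `` {y}. \<exists>z'\<in>?R `` {z}. has_omega_lim \<omega> (?d y' z') l"
        using equiv_class_self[OF equiv] yz l by (auto simp: lim)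
      fix m assume "\<exists>y'\<in>?R `` {y}. \<exists>z'\<in>?R `` {z}. has_omega_lim \<omega> (?d y' z') m"
      then obtain y' z' where "(y, y') \<in> ?R" "(z, z') \<in> ?R" "(?d y' z' \<longlongrightarrow> m) F"
        by (auto simp: lim)
      then show "m = l" using indep[of y y' z z' l] l tendsto_unique[OF F] by blast
    qed
    with l yz show ?thesis by (simp add: omega_dist_def omega_space_def quotientI)
  qed
  then show "\<And>y z. y \<in> ?A \<Longrightarrow> z \<in> ?A \<Longrightarrow> has_omega_lim \<omega> (?d y z)
          (omega_dist \<omega> X x (?R `` {y}) (?R `` {z}))"
    by (simp add: lim)
  have rep: "\<exists>y\<in>?A. S = ?R `` {y}" if "S \<in> omega_space \<omega> X x" for S
    using that by (auto simp: omega_space_def elim: quotientE)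
  show "Metric_space (omega_space \<omega> X x) (omega_dist \<omega> X x)"
  proof
    fix S T
    show "0 \<le> omega_dist \<omega> X x S T"
    proof (cases "S \<in> omega_space \<omega> X x \<and> T \<in> omega_space \<omega> X x")
      case True
      then obtain y z where "y \<in> ?A" "S = ?R `` {y}" "z \<in> ?A" "T = ?R `` {z}" using rep by meson
      then have "(?d y z \<longlongrightarrow> omega_dist \<omega> X x S T) F" using dist[of y z] by simp
      then show ?thesis by (rule tendsto_lowerbound[OF _ _ F]) simp
    qed (auto simp: omega_dist_def)
    show "omega_dist \<omega> X x S T = omega_dist \<omega> X x T S"
    proof (cases "S \<in> omega_space \<omega> X x \<and> T \<in> omega_space \<omega> X x")
      case True
      then obtain y z where "y \<in> ?A" "S = ?R `` {y}" "z \<in> ?A" "T = ?R `` {z}" using rep by meson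
      then have "(?d y z \<longlongrightarrow> omega_dist \<omega> X x S T) F" "(?d z y \<longlongrightarrow> omega_dist \<omega> X x T S) F"
        using dist[of y z] dist[of z y] by simp_all
      moreover have "?d z y = ?d y z" by (simp add: mdist_commute)
      ultimately show ?thesis using tendsto_unique[OF F] by metis
    qed (auto simp: omega_dist_def)
  next
    fix S T assume "S \<in> omega_space \<omega> X x" "T \<in> omega_space \<omega> X x"
    then obtain y z where yz: "y \<in> ?A" "S = ?R `` {y}" "z \<in> ?A" "T = ?R `` {z}" using rep by meson
    have d: "(?d y z \<longlongrightarrow> omega_dist \<omega> X x S T) F" using yz dist[of y z] by simp
    have "omega_dist \<omega> X x S T = 0 \<longleftrightarrow> (?d y z \<longlongrightarrow> 0) F"
    proof
      assume "omega_dist \<omega> X x S T = 0"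
      with d show "(?d y z \<longlongrightarrow> 0) F" by simp
    qed (rule tendsto_unique[OF F d])
    also have "\<dots> \<longleftrightarrow> (y, z) \<in> ?R" using yz by (simp add: R)
    also have "\<dots> \<longleftrightarrow> S = T" using yz eq_equiv_class_iff[OF equiv] by blast
    finally show "omega_dist \<omega> X x S T = 0 \<longleftrightarrow> S = T" .
  next
    fix S T V
    assume "S \<in> omega_space \<omega> X x" "T \<in> omega_space \<omega> X x" "V \<in> omega_space \<omega> X x"
    then obtain y z w where yzw: "y \<in> ?A" "S = ?R `` {y}" "z \<in> ?A" "T = ?R `` {z}"
      "w \<in> ?A" "V = ?R `` {w}" using rep by meson
    have "((\<lambda>n. ?d y z n + ?d z w n) \<longlongrightarrow> omega_dist \<omega> X x S T + omega_dist \<omega> X x T V) F"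
      using dist[of y z] dist[of z w] yzw by (intro tendsto_add) simp_all
    moreover have "(?d y w \<longlongrightarrow> omega_dist \<omega> X x S V) F" using dist[of y w] yzw by simp
    ultimately show "omega_dist \<omega> X x S V \<le> omega_dist \<omega> X x S T + omega_dist \<omega> X x T V"
      by (rule tendsto_le[OF F]) (use tri[OF yzw(1) yzw(3) yzw(5)] in simp)
  qed
qed


section \<open>Rectifiable sets\<close>

definition mdiam :: "'a metric \<Rightarrow> 'a set \<Rightarrow> ennreal"
  where "mdiam X A = (SUP x\<in>A. SUP y\<in>A. ennreal (mdist X x y))"

text \<open>An outer measure on all \<open>S \<subseteq> mspace X\<close>, normalized to agree with length on the line.\<close>

definition hausdorff1_pre :: "'a metric \<Rightarrow> real \<Rightarrow> 'a set \<Rightarrow> ennreal"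
  where "hausdorff1_pre X \<delta> S =
    (INF A \<in> {A :: nat \<Rightarrow> 'a set. (\<forall>i. A i \<subseteq> mspace X \<and> mdiam X (A i) \<le> ennreal \<delta>) \<and> S \<subseteq> (\<Union>i. A i)}.
       \<Sum>i. mdiam X (A i))"

definition hausdorff1 :: "'a metric \<Rightarrow> 'a set \<Rightarrow> ennreal"
  where "hausdorff1 X S = (SUP \<delta>\<in>{0<..}. hausdorff1_pre X \<delta> S)"

definition rectifiable1 :: "'a metric \<Rightarrow> bool"
  where "rectifiable1 X \<longleftrightarrow>
    (\<exists>(B :: nat \<Rightarrow> real set) (f :: nat \<Rightarrow> real \<Rightarrow> 'a).
       (\<forall>i. B i \<in> sets borel \<and> Lipschitz_continuous_map (submetric euclidean_metric (B i)) X (f i)) \<and>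
       hausdorff1 X (mspace X - (\<Union>i. f i ` B i)) = 0)"

definition purely_unrectifiable1 :: "'a metric \<Rightarrow> bool"
  where "purely_unrectifiable1 X \<longleftrightarrow>
    \<not> (\<exists>E \<subseteq> mspace X. rectifiable1 (submetric X E) \<and> hausdorff1 X E > 0)"


section \<open>Metric 1-currents\<close>

definition Lip :: "'a metric \<Rightarrow> ('a \<Rightarrow> real) set"
  where "Lip X = {f. Lipschitz_continuous_map X euclidean_metric f}"

definition Lip_b :: "'a metric \<Rightarrow> ('a \<Rightarrow> real) set"
  where "Lip_b X = {f \<in> Lip X. bounded (f ` mspace X)}"

definition LIP :: "'a metric \<Rightarrow> ('a \<Rightarrow> real) \<Rightarrow> real"
  where "LIP X \<pi> = Inf {L. 0 \<le> L \<and> (\<forall>x\<in>mspace X. \<forall>y\<in>mspace X. \<bar>\<pi> x - \<pi> y\<bar> \<le> L * mdist X x y)}"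

definition borel_measure_on :: "'a metric \<Rightarrow> 'a measure \<Rightarrow> bool"
  where "borel_measure_on X \<mu> \<longleftrightarrow>
    space \<mu> = mspace X \<and> sets \<mu> = sigma_sets (mspace X) {U. openin (mtopology_of X) U}"

definition mass_bound ::
    "'a metric \<Rightarrow> (('a \<Rightarrow> real) \<Rightarrow> ('a \<Rightarrow> real) \<Rightarrow> real) \<Rightarrow> 'a measure \<Rightarrow> bool"
  where "mass_bound X T \<mu> \<longleftrightarrow> borel_measure_on X \<mu> \<and> finite_measure \<mu> \<and>
    (\<forall>f\<in>Lip_b X. \<forall>\<pi>\<in>Lip X. \<bar>T f \<pi>\<bar> \<le> LIP X \<pi> * (\<integral>x. \<bar>f x\<bar> \<partial>\<mu>))"

text \<open>Elements of \<^term>\<open>Lip X\<close> are functions on the whole type, of which only the values on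
  \<^term>\<open>mspace X\<close> are constrained. Bilinearity and finite mass force \<open>T f \<pi>\<close> to depend only on
  these values (see below), so \<open>T\<close> is a functional on functions on the metric space.\<close>

definition metric_currents1 :: "'a metric \<Rightarrow> (('a \<Rightarrow> real) \<Rightarrow> ('a \<Rightarrow> real) \<Rightarrow> real) set"
  where "metric_currents1 X = {T.
    (\<forall>f\<in>Lip_b X. \<forall>g\<in>Lip_b X. \<forall>\<pi>\<in>Lip X. \<forall>a b.
       T (\<lambda>x. a * f x + b * g x) \<pi> = a * T f \<pi> + b * T g \<pi>) \<and>
    (\<forall>f\<in>Lip_b X. \<forall>\<pi>\<in>Lip X. \<forall>\<rho>\<in>Lip X. \<forall>a b.
       T f (\<lambda>x. a * \<pi> x + b * \<rho> x) = a * T f \<pi> + b * T f \<rho>) \<and>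
    (\<forall>f\<in>Lip_b X. \<forall>\<pi>\<in>Lip X.
       (\<exists>U c. openin (mtopology_of X) U \<and> {x \<in> mspace X. f x \<noteq> 0} \<subseteq> U \<and> (\<forall>x\<in>U. \<pi> x = c))
         \<longrightarrow> T f \<pi> = 0) \<and>
    (\<forall>f\<in>Lip_b X. \<forall>\<pi>\<in>Lip X. \<forall>\<pi>\<^sub>n :: nat \<Rightarrow> 'a \<Rightarrow> real.
       (\<forall>n. \<pi>\<^sub>n n \<in> Lip X) \<and> bdd_above (range (\<lambda>n. LIP X (\<pi>\<^sub>n n))) \<and>
       (\<forall>x\<in>mspace X. (\<lambda>n. \<pi>\<^sub>n n x) \<longlonglongrightarrow> \<pi> x)
         \<longrightarrow> (\<lambda>n. T f (\<pi>\<^sub>n n)) \<longlonglongrightarrow> T f \<pi>) \<and>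
    (\<exists>\<mu>. mass_bound X T \<mu>)}"

definition is_mass_measure ::
    "'a metric \<Rightarrow> (('a \<Rightarrow> real) \<Rightarrow> ('a \<Rightarrow> real) \<Rightarrow> real) \<Rightarrow> 'a measure \<Rightarrow> bool"
  where "is_mass_measure X T \<mu> \<longleftrightarrow> mass_bound X T \<mu> \<and>
    (\<forall>\<nu>. mass_bound X T \<nu> \<longrightarrow> (\<forall>A\<in>sets \<mu>. emeasure \<mu> A \<le> emeasure \<nu> A))"

definition inner_regular_compact :: "'a metric \<Rightarrow> 'a measure \<Rightarrow> bool"
  where "inner_regular_compact X \<mu> \<longleftrightarrow>
    (\<forall>B\<in>sets \<mu>. emeasure \<mu> B = (SUP K\<in>{K. compactin (mtopology_of X) K \<and> K \<subseteq> B}. emeasure \<mu> K))"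

text \<open>The mass measure, being the least measure satisfying the mass bound, is unique.\<close>

definition metric_currents1_reg :: "'a metric \<Rightarrow> (('a \<Rightarrow> real) \<Rightarrow> ('a \<Rightarrow> real) \<Rightarrow> real) set"
  where "metric_currents1_reg X =
    {T \<in> metric_currents1 X. \<exists>\<mu>. is_mass_measure X T \<mu> \<and> inner_regular_compact X \<mu>}"

text \<open>Equality with the zero functional on \<open>Lip_b X \<times> Lip X\<close>; values of \<open>T\<close> at other
  arguments are irrelevant.\<close>

definition zero_current :: "'a metric \<Rightarrow> (('a \<Rightarrow> real) \<Rightarrow> ('a \<Rightarrow> real) \<Rightarrow> real) \<Rightarrow> bool"
  where "zero_current X T \<longleftrightarrow> (\<forall>f\<in>Lip_b X. \<forall>\<pi>\<in>Lip X. T f \<pi> = 0)"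

lemma LIP_zero: "(\<And>x. x \<in> mspace X \<Longrightarrow> \<pi> x = 0) \<Longrightarrow> LIP X \<pi> = 0"
  unfolding LIP_def by (rule cInf_eq_minimum) auto

lemma metric_current1_cong:
  assumes T: "T \<in> metric_currents1 X" and f: "f \<in> Lip_b X" "g \<in> Lip_b X"
    and \<pi>: "\<pi> \<in> Lip X" "\<rho> \<in> Lip X"
    and eq: "\<And>x. x \<in> mspace X \<Longrightarrow> f x = g x" "\<And>x. x \<in> mspace X \<Longrightarrow> \<pi> x = \<rho> x"
  shows "T f \<pi> = T g \<rho>"
proof -
  obtain \<mu> where "mass_bound X T \<mu>" using T by (auto simp: metric_currents1_def)
  then have space: "space \<mu> = mspace X"
    and bd: "\<And>f \<pi>. f \<in> Lip_b X \<Longrightarrow> \<pi> \<in> Lip X \<Longrightarrow> \<bar>T f \<pi>\<bar> \<le> LIP X \<pi> * (\<integral>x. \<bar>f x\<bar> \<partial>\<mu>)"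
    by (auto simp: mass_bound_def borel_measure_on_def)
  note L = T[unfolded metric_currents1_def mem_Collect_eq]
  note lin1 = L[THEN conjunct1, rule_format, OF f \<pi>(1), of 1 "-1"]
    and lin2 = L[THEN conjunct2, THEN conjunct1, rule_format, OF f(2) \<pi>, of 1 "-1"]
  have zero: "h \<in> Lip X" if "\<And>x. x \<in> mspace X \<Longrightarrow> h x = 0" for h
    using that by (auto simp: Lip_def Lipschitz_continuous_map_def intro!: exI[of _ 0])
  have zf: "(\<lambda>x. 1 * f x + (- 1) * g x) \<in> Lip_b X"
    using zero eq(1) by (auto simp: Lip_b_def bounded_iff)
  have z\<pi>: "(\<lambda>x. 1 * \<pi> x + (- 1) * \<rho> x) \<in> Lip X"
    using zero eq(2) by auto
  have "(\<integral>x. \<bar>1 * f x + (- 1) * g x\<bar> \<partial>\<mu>) = (\<integral>x. 0 \<partial>\<mu>)"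
    by (rule Bochner_Integration.integral_cong) (auto simp: space eq(1))
  then have "T f \<pi> = T g \<pi>" using bd[OF zf \<pi>(1)] lin1 by simp
  moreover have "LIP X (\<lambda>x. 1 * \<pi> x + (- 1) * \<rho> x) = 0"
    by (rule LIP_zero) (simp add: eq(2))
  then have "T g \<pi> = T g \<rho>" using bd[OF f(2) z\<pi>] lin2 by simp
  ultimately show ?thesis by simp
qed

end

theory Submission
  imports Defs
begin

text \<open>
The four conditions are compared through a single inequality. For \<open>p > 1\<close> and \<open>c > 0\<close>,
\<open>chain_ineq X p c\<close> says that every finite chain satisfies
\<open>c * d(x\<^sub>0,x\<^sub>N)\<^sup>p \<le> \<Sum> d(x\<^sub>i,x\<^sub>i\<^sub>+\<^sub>1)\<^sup>p\<close>. A space admits such constants iff it is biLipschitz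
equivalent to a snowflake: for \<open>d = \<rho>\<^sup>\<alpha>\<close> and \<open>p = 1/\<alpha>\<close> this is the triangle inequality of \<open>\<rho>\<close>
(\<open>snowflake_imp_chain_ineq\<close>), and conversely the infimum of \<open>\<Sum> d\<^sup>p\<close> over all chains joining two
points is a metric comparable to \<open>d\<^sup>p\<close> (\<open>chain_ineq_imp_snowflake\<close>). Being homogeneous in \<open>d\<close> and
closed under limits, the inequality passes to all ultralimits with the same constants
(\<open>chain_ineq_ultralimit\<close>).

Suppose the inequality holds in \<open>Z\<close>. A chain of bounded length with small steps has small
\<open>\<Sum> d\<^sup>p\<close>, because \<open>\<Sum> d\<^sup>p \<le> (max d)\<^sup>p\<^sup>-\<^sup>1 * \<Sum> d\<close>; hence its ends are close together. So rectifiable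
curves in \<open>Z\<close> are constant. A Lipschitz map on a Borel set \<open>B\<close> of reals moves little across
intervals in which \<open>B\<close> leaves only small gaps, and so its image is \<open>\<H>\<^sup>1\<close>-null
(\<open>chain_ineq_imp_purely_unrectifiable\<close>). Finally every Lipschitz function is a limit of functions with
bounded Lipschitz constants that oscillate only like \<open>d\<^sup>p\<close>, hence have arbitrarily small Lipschitz
constants on small balls; by locality and finite mass a current with regular mass cannot see
them, and by continuity it vanishes (\<open>chain_ineq_imp_currents_zero\<close>).

Suppose the inequality fails in \<open>X\<close> for all \<open>p\<close> and \<open>c\<close>. Then for every \<open>\<delta>\<close> there is a chain with
end-to-end distance \<open>D > 0\<close>, steps at most \<open>\<delta> * D\<close> and length less than \<open>(1 + \<delta>) * D\<close>. Indeed, if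
for some \<open>\<delta>\<close> every chain with such short steps had length at least \<open>(1 + \<delta>) * D\<close>, grouping the steps
of an arbitrary chain into steps of size about \<open>\<delta> * D\<close> would gain a factor greater than \<open>1\<close>, which for
\<open>p\<close> close to \<open>1\<close> pays for an induction over the number of steps (\<open>stretched_imp_chain_ineq\<close>).
Rescaled by \<open>1/D\<close>, the nearly straight chains converge in an ultralimit to an isometric copy of
\<open>[0,1]\<close> (\<open>straight_chains_imp_segment\<close>). A segment, rather than just some rectifiable curve, violates
the other three conditions at once: it is a rectifiable curve, its Hausdorff measure is
positive, and the current \<open>(f, \<pi>) \<mapsto> \<integral> f d\<pi>\<close> along it has the length measure of the segment as its
mass measure, which is seen by testing with the distance from an endpoint
(\<open>nonzero_regular_current\<close>). Hence \<open>X\<close> either satisfies all four conditions or none of them.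
\<close>


section \<open>Chains and snowflakes\<close>

lemma mdist_self [simp]: "x \<in> mspace X \<Longrightarrow> mdist X x x = 0"
  by simp

definition chain_cost :: "'a metric \<Rightarrow> real \<Rightarrow> (nat \<Rightarrow> 'a) \<Rightarrow> nat \<Rightarrow> real"
  where "chain_cost X p x N = (\<Sum>i<N. mdist X (x i) (x (Suc i)) powr p)"

text \<open>Chains are initial segments of total sequences in the space; a finite chain can always be continued
  by repeating its last point.\<close>

definition chain_ineq :: "'a metric \<Rightarrow> real \<Rightarrow> real \<Rightarrow> bool"
  where "chain_ineq X p c \<longleftrightarrow>
    (\<forall>x N. (\<forall>i. x i \<in> mspace X) \<longrightarrow> c * mdist X (x 0) (x N) powr p \<le> chain_cost X p x N)"

lemma chain_cost_nonneg: "0 \<le> chain_cost X p x N"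
  by (simp add: chain_cost_def sum_nonneg)

lemma chain_cost_append:
  assumes "u N = v 0"
  shows "chain_cost X p (\<lambda>i. if i \<le> N then u i else v (i - N)) (N + M) = chain_cost X p u N + chain_cost X p v M"
proof (induction M)
  case 0
  show ?case by (auto simp: chain_cost_def intro!: sum.cong)
next
  case (Suc M)
  have "(if N + M \<le> N then u (N + M) else v (N + M - N)) = v M"
    using assms by auto
  then show ?case using Suc by (simp add: chain_cost_def)
qed

lemma chain_cost_rev: "chain_cost X p (\<lambda>i. u (N - i)) N = chain_cost X p u N"
proof -
  have "chain_cost X p (\<lambda>i. u (N - i)) N =
      (\<Sum>i<N. (\<lambda>i. mdist X (u i) (u (Suc i)) powr p) (N - Suc i))"
    unfolding chain_cost_def by (intro sum.cong) (auto simp: mdist_commute Suc_diff_Suc)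
  also have "\<dots> = chain_cost X p u N"
    unfolding chain_cost_def by (rule sum.nat_diff_reindex)
  finally show ?thesis .
qed

text \<open>By monotonicity of \<open>s \<mapsto> t\<^sup>s\<close> for \<open>t\<close> in \<open>[0,1]\<close>, each summand keeps at least its linear share of the power of
  the sum. This makes \<open>\<rho>\<^sup>\<alpha>\<close> a metric.\<close>

lemma powr_subadd:
  fixes a b :: real
  assumes "0 \<le> a" "0 \<le> b" "0 < s" "s \<le> 1"
  shows "(a + b) powr s \<le> a powr s + b powr s"
proof (cases "a + b = 0")
  case True
  then show ?thesis using assms by simp
next
  case False
  then have pos: "0 < a + b" using assms by linarith
  have *: "x / (a + b) * (a + b) powr s \<le> x powr s" if "0 \<le> x" "x \<le> a + b" for x
  proof -
    have "(x / (a + b)) powr 1 \<le> (x / (a + b)) powr s"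
      by (rule powr_mono') (use assms that pos in auto)
    then have "x / (a + b) \<le> (x / (a + b)) powr s" using that pos by simp
    also have "\<dots> = x powr s / (a + b) powr s" using that pos by (simp add: powr_divide)
    finally show ?thesis using pos by (simp add: pos_le_divide_eq)
  qed
  have "(a + b) powr s = (a / (a + b) + b / (a + b)) * (a + b) powr s"
    using pos by (simp add: add_divide_distrib[symmetric])
  also have "\<dots> = a / (a + b) * (a + b) powr s + b / (a + b) * (a + b) powr s"
    by (rule distrib_right)
  also have "\<dots> \<le> a powr s + b powr s" by (intro add_mono *) (use assms in auto)
  finally show ?thesis .
qed

text \<open>The largest pseudometric below \<open>d\<^sup>p\<close>. The chain inequality is what keeps it from degenerating.\<close>

definition chain_dist :: "'a metric \<Rightarrow> real \<Rightarrow> 'a \<Rightarrow> 'a \<Rightarrow> real"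
  where "chain_dist X p x y =
    (INF (u, N) \<in> {(u, N). (\<forall>i. u i \<in> mspace X) \<and> u 0 = x \<and> u N = y}. chain_cost X p u N)"

lemma chain_dist_le:
  assumes "\<And>i. u i \<in> mspace X"
  shows "chain_dist X p (u 0) (u N) \<le> chain_cost X p u N"
  unfolding chain_dist_def
  by (rule cINF_lower2[where x = "(u, N)"])
     (use assms chain_cost_nonneg in \<open>auto intro!: bdd_belowI[where m = 0]\<close>)

lemma chain_dist_greatest:
  assumes "x \<in> mspace X" "y \<in> mspace X"
    and "\<And>u N. (\<And>i. u i \<in> mspace X) \<Longrightarrow> u 0 = x \<Longrightarrow> u N = y \<Longrightarrow> m \<le> chain_cost X p u N"
  shows "m \<le> chain_dist X p x y"
proof -
  let ?A = "{(u, N::nat). (\<forall>i. u i \<in> mspace X) \<and> u 0 = x \<and> u N = y}"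
  have "(\<lambda>i. if i = 0 then x else y, 1) \<in> ?A" using assms(1,2) by simp
  then have "?A \<noteq> {}" by (metis empty_iff)
  then show ?thesis unfolding chain_dist_def
  proof (rule cINF_greatest)
    fix q assume "q \<in> ?A"
    then obtain u N where q: "q = (u, N)" and u: "\<forall>i. u i \<in> mspace X" "u 0 = x" "u N = y" by blast
    have "m \<le> chain_cost X p u N"
      by (rule assms(3)) (simp_all add: u)
    then show "m \<le> (case q of (u, N) \<Rightarrow> chain_cost X p u N)" using q by simp
  qed
qed

lemma chain_dist_le_powr:
  assumes "x \<in> mspace X" "y \<in> mspace X"
  shows "chain_dist X p x y \<le> mdist X x y powr p"
  using chain_dist_le[of "\<lambda>i. if i = 0 then x else y" X p 1] assms by (simp add: chain_cost_def)

lemma chain_dist_nonneg: "x \<in> mspace X \<Longrightarrow> y \<in> mspace X \<Longrightarrow> 0 \<le> chain_dist X p x y"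
  by (rule chain_dist_greatest) (auto simp: chain_cost_nonneg)

lemma chain_dist_commute:
  fixes X :: "'a metric"
  assumes "x \<in> mspace X" "y \<in> mspace X"
  shows "chain_dist X p x y = chain_dist X p y x"
proof -
  have "chain_dist X p x y \<le> chain_dist X p y x" if "x \<in> mspace X" "y \<in> mspace X" for x y
    using that
  proof (intro chain_dist_greatest)
    fix u :: "nat \<Rightarrow> 'a" and N assume u: "\<And>i. u i \<in> mspace X" "u 0 = y" "u N = x"
    then show "chain_dist X p x y \<le> chain_cost X p u N"
      using chain_dist_le[of "\<lambda>i. u (N - i)" X p N] by (simp add: chain_cost_rev)
  qed
  then show ?thesis using assms by (intro order_antisym) blast+
qed

text \<open>Concatenating chains adds their costs.\<close>

lemma chain_dist_triangle:
  fixes X :: "'a metric"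
  assumes x: "x \<in> mspace X" and y: "y \<in> mspace X" and z: "z \<in> mspace X"
  shows "chain_dist X p x z \<le> chain_dist X p x y + chain_dist X p y z"
proof -
  have "chain_dist X p x z - chain_dist X p y z \<le> chain_dist X p x y"
  proof (rule chain_dist_greatest[OF x y])
    fix u :: "nat \<Rightarrow> 'a" and N assume u: "\<And>i. u i \<in> mspace X" "u 0 = x" "u N = y"
    have "chain_dist X p x z - chain_cost X p u N \<le> chain_dist X p y z"
    proof (rule chain_dist_greatest[OF y z])
      fix v :: "nat \<Rightarrow> 'a" and M assume v: "\<And>i. v i \<in> mspace X" "v 0 = y" "v M = z"
      have "(if N + M \<le> N then u (N + M) else v (N + M - N)) = z" using u v by auto
      then have "chain_dist X p x z \<le> chain_cost X p (\<lambda>i. if i \<le> N then u i else v (i - N)) (N + M)"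
        using chain_dist_le[of "\<lambda>i. if i \<le> N then u i else v (i - N)" X p "N + M"] u v by simp
      then show "chain_dist X p x z - chain_cost X p u N \<le> chain_cost X p v M"
        using u v by (simp add: chain_cost_append)
    qed
    then show "chain_dist X p x z - chain_dist X p y z \<le> chain_cost X p u N" by linarith
  qed
  then show ?thesis by linarith
qed

lemma chain_ineq_imp_chain_dist_ge:
  assumes "chain_ineq X p c" "x \<in> mspace X" "y \<in> mspace X"
  shows "c * mdist X x y powr p \<le> chain_dist X p x y"
  by (rule chain_dist_greatest) (use assms in \<open>auto simp: chain_ineq_def\<close>)

text \<open>Turns either direction of a biLipschitz bijection into a map that starts at \<open>X\<close>.\<close>

lemma biLipschitz_equivalentE:
  assumes "biLipschitz_equivalent X S"
  obtains h C where "C \<ge> 1" "h \<in> mspace X \<rightarrow> mspace S"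
    "\<And>x x'. x \<in> mspace X \<Longrightarrow> x' \<in> mspace X \<Longrightarrow> mdist X x x' \<le> C * mdist S (h x) (h x')"
    "\<And>x x'. x \<in> mspace X \<Longrightarrow> x' \<in> mspace X \<Longrightarrow> mdist S (h x) (h x') \<le> C * mdist X x x'"
proof -
  have inv: "a \<le> C * b" if "inverse C * a \<le> b" "C \<ge> 1" for a b C :: real
    using that by (simp add: field_simps)
  show thesis using assms unfolding biLipschitz_equivalent_def
  proof (elim disjE exE conjE)
    fix f assume "biLipschitz_map X S f"
    then show thesis unfolding biLipschitz_map_def using that inv by blast
  next
    fix g assume g: "biLipschitz_map S X g" "g ` mspace S = mspace X"
    then obtain C where C: "C \<ge> 1" "\<And>s s'. s \<in> mspace S \<Longrightarrow> s' \<in> mspace S \<Longrightarrow>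
       inverse C * mdist S s s' \<le> mdist X (g s) (g s') \<and> mdist X (g s) (g s') \<le> C * mdist S s s'"
      unfolding biLipschitz_map_def by blast
    define h where "h = inv_into (mspace S) g"
    have h: "h x \<in> mspace S" "g (h x) = x" if "x \<in> mspace X" for x
      unfolding h_def using that g(2) by (auto simp: inv_into_into f_inv_into_f)
    show thesis
    proof (rule that[OF C(1), of h])
      fix x x' assume "x \<in> mspace X" "x' \<in> mspace X"
      then show "mdist X x x' \<le> C * mdist S (h x) (h x')" "mdist S (h x) (h x') \<le> C * mdist X x x'"
        using C(2)[of "h x" "h x'"] h inv[OF _ C(1)] by auto
    qed (use h in auto)
  qed
qed

text \<open>With \<open>p = 1/\<alpha>\<close> the power \<open>d\<^sup>p\<close> of the snowflake metric is a genuine metric \<open>\<rho>\<close>, whose triangle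
  inequality is the chain inequality with constant \<open>1\<close>; the biLipschitz constant \<open>C\<close> enters twice, each
  time to the power \<open>p\<close>.\<close>

lemma snowflake_imp_chain_ineq:
  fixes X :: "'a metric"
  assumes "snowflake S" "biLipschitz_equivalent X S"
  obtains p c where "1 < p" "0 < c" "chain_ineq X p c"
proof -
  obtain \<alpha> Y where \<alpha>: "0 < \<alpha>" "\<alpha> < 1" and Y: "mspace Y = mspace S"
    and dS: "\<And>x y. x \<in> mspace S \<Longrightarrow> y \<in> mspace S \<Longrightarrow> mdist S x y = mdist Y x y powr \<alpha>"
    using assms(1) unfolding snowflake_def is_snowflake_of_def by blast
  obtain h C where C: "C \<ge> 1" and h: "h \<in> mspace X \<rightarrow> mspace S"
    and le: "\<And>x x'. x \<in> mspace X \<Longrightarrow> x' \<in> mspace X \<Longrightarrow> mdist X x x' \<le> C * mdist S (h x) (h x')"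
    and ge: "\<And>x x'. x \<in> mspace X \<Longrightarrow> x' \<in> mspace X \<Longrightarrow> mdist S (h x) (h x') \<le> C * mdist X x x'"
    using biLipschitz_equivalentE[OF assms(2)] by metis
  define p where "p = 1 / \<alpha>"
  define B where "B = C powr p"
  have p: "1 < p" "0 < p" using \<alpha> by (simp_all add: p_def)
  have B: "0 < B" using C by (simp add: B_def)
  have dY: "mdist Y (h x) (h x') = mdist S (h x) (h x') powr p" if "x \<in> mspace X" "x' \<in> mspace X" for x x'
    using dS[of "h x" "h x'"] h that \<alpha> by (auto simp: p_def powr_powr Pi_iff)
  have u: "mdist X x x' powr p \<le> B * mdist Y (h x) (h x')" if "x \<in> mspace X" "x' \<in> mspace X" for x x'
  proof -
    have "mdist X x x' powr p \<le> (C * mdist S (h x) (h x')) powr p"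
      by (rule powr_mono2) (use le[OF that] p in auto)
    then show ?thesis using C by (simp add: dY[OF that] B_def powr_mult)
  qed
  have l: "mdist Y (h x) (h x') \<le> B * mdist X x x' powr p" if "x \<in> mspace X" "x' \<in> mspace X" for x x'
  proof -
    have "mdist S (h x) (h x') powr p \<le> (C * mdist X x x') powr p"
      by (rule powr_mono2) (use ge[OF that] p in auto)
    then show ?thesis using C by (simp add: dY[OF that] B_def powr_mult)
  qed
  have "chain_ineq X p (1 / (B * B))" unfolding chain_ineq_def
  proof (intro allI impI)
    fix x :: "nat \<Rightarrow> 'a" and N assume x: "\<forall>i. x i \<in> mspace X"
    then have hx: "h (x i) \<in> mspace Y" for i using h Y by auto
    have "mdist Y (h (x 0)) (h (x N)) \<le> (\<Sum>i<N. mdist Y (h (x i)) (h (x (Suc i))))"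
    proof (induction N)
      case (Suc N)
      then show ?case using mdist_triangle[OF hx[of 0] hx[of N] hx[of "Suc N"]] by simp
    qed (use hx[of 0] in simp)
    also have "\<dots> \<le> (\<Sum>i<N. B * mdist X (x i) (x (Suc i)) powr p)"
      by (intro sum_mono l) (use x in auto)
    also have "\<dots> = B * chain_cost X p x N" by (simp add: chain_cost_def sum_distrib_left)
    finally have "mdist Y (h (x 0)) (h (x N)) \<le> B * chain_cost X p x N" .
    then have "mdist X (x 0) (x N) powr p \<le> B * (B * chain_cost X p x N)"
      using u[of "x 0" "x N"] x B by (meson mult_left_mono order.trans less_imp_le)
    then show "1 / (B * B) * mdist X (x 0) (x N) powr p \<le> chain_cost X p x N"
      using B by (simp add: field_simps)
  qed
  then show thesis using that[of p "1 / (B * B)"] p B by simp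
qed

text \<open>The snowflake is the chain metric \<open>\<rho>\<close> raised to \<open>\<alpha> = 1/p\<close>. It lives on the points of \<open>X\<close>, and since
  \<open>c * d\<^sup>p \<le> \<rho> \<le> d\<^sup>p\<close> the identity is biLipschitz.\<close>

lemma chain_ineq_imp_snowflake:
  fixes X :: "'a metric"
  assumes p: "1 < p" and c: "0 < c" and X: "chain_ineq X p c"
  shows "\<exists>S :: 'a metric. snowflake S \<and> biLipschitz_equivalent X S"
proof -
  define \<alpha> where "\<alpha> = 1 / p"
  have \<alpha>: "0 < \<alpha>" "\<alpha> < 1" using p by (simp_all add: \<alpha>_def)
  define \<rho> where "\<rho> x y = (if x \<in> mspace X \<and> y \<in> mspace X then chain_dist X p x y else 0)" for x y
  note ge = chain_ineq_imp_chain_dist_ge[OF X]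
  have zero: "\<rho> x y = 0 \<longleftrightarrow> x = y" if "x \<in> mspace X" "y \<in> mspace X" for x y
  proof
    assume "\<rho> x y = 0"
    then have "c * mdist X x y powr p \<le> 0" using ge[of x y] that by (simp add: \<rho>_def)
    then have "mdist X x y = 0" using c by (simp add: mult_le_0_iff)
    then show "x = y" using that by simp
  next
    assume "x = y"
    have "chain_dist X p x x = 0"
      using chain_dist_le_powr[of x X x p] chain_dist_nonneg[of x X x p] that p by simp
    with \<open>x = y\<close> show "\<rho> x y = 0" by (simp add: \<rho>_def)
  qed
  have nonneg: "0 \<le> \<rho> x y" and comm: "\<rho> x y = \<rho> y x" for x y
    using chain_dist_nonneg chain_dist_commute by (auto simp: \<rho>_def)
  have tri: "\<rho> x z \<le> \<rho> x y + \<rho> y z" if "x \<in> mspace X" "y \<in> mspace X" "z \<in> mspace X" for x y z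
    using chain_dist_triangle[of x X y z p] that by (simp add: \<rho>_def)
  interpret Y: Metric_space "mspace X" \<rho>
    by unfold_locales (use zero nonneg comm tri in auto)
  interpret S: Metric_space "mspace X" "\<lambda>x y. \<rho> x y powr \<alpha>"
  proof
    fix x y z assume xyz: "x \<in> mspace X" "y \<in> mspace X" "z \<in> mspace X"
    have "\<rho> x z powr \<alpha> \<le> (\<rho> x y + \<rho> y z) powr \<alpha>"
      using tri[OF xyz] \<alpha> by (intro powr_mono2) (auto simp: nonneg)
    also have "\<dots> \<le> \<rho> x y powr \<alpha> + \<rho> y z powr \<alpha>"
      using \<alpha> by (intro powr_subadd) (auto simp: nonneg)
    finally show "\<rho> x z powr \<alpha> \<le> \<rho> x y powr \<alpha> + \<rho> y z powr \<alpha>" .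
  qed (use zero comm in auto)
  define S where "S = metric (mspace X, \<lambda>x y. \<rho> x y powr \<alpha>)"
  have S: "mspace S = mspace X" "mdist S = (\<lambda>x y. \<rho> x y powr \<alpha>)"
    by (simp_all add: S_def)
  have "is_snowflake_of \<alpha> S"
    unfolding is_snowflake_of_def using \<alpha> S
    by (intro conjI exI[of _ "metric (mspace X, \<rho>)"]) auto
  then have "snowflake S" by (auto simp: snowflake_def)
  define C where "C = max 1 (inverse (c powr \<alpha>))"
  have C: "C \<ge> 1" "inverse C \<le> c powr \<alpha>"
  proof -
    show "C \<ge> 1" by (simp add: C_def)
    have "inverse C \<le> inverse (inverse (c powr \<alpha>))"
      by (rule le_imp_inverse_le) (use c in \<open>auto simp: C_def\<close>)
    then show "inverse C \<le> c powr \<alpha>" by simp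
  qed
  have "biLipschitz_map X S id"
    unfolding biLipschitz_map_def
  proof (intro conjI exI[of _ C] ballI)
    fix x y assume xy: "x \<in> mspace X" "y \<in> mspace X"
    have d: "(mdist X x y powr p) powr \<alpha> = mdist X x y"
      using p by (simp add: powr_powr \<alpha>_def)
    have "inverse C * mdist X x y \<le> c powr \<alpha> * mdist X x y"
      using C by (simp add: mult_right_mono)
    also have "\<dots> = (c * mdist X x y powr p) powr \<alpha>"
      using c d by (simp add: powr_mult)
    also have "\<dots> \<le> \<rho> x y powr \<alpha>"
      by (rule powr_mono2) (use ge[OF xy] \<alpha> c xy in \<open>auto simp: \<rho>_def\<close>)
    finally show "inverse C * mdist X x y \<le> mdist S (id x) (id y)" by (simp add: S)
    have "\<rho> x y powr \<alpha> \<le> (mdist X x y powr p) powr \<alpha>"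
      by (rule powr_mono2) (use chain_dist_le_powr[OF xy, of p] \<alpha> xy nonneg[of x y] in \<open>auto simp: \<rho>_def\<close>)
    also have "\<dots> \<le> C * mdist X x y" using d mult_right_mono[OF C(1), of "mdist X x y"] by simp
    finally show "mdist S (id x) (id y) \<le> C * mdist X x y" by (simp add: S)
  qed (use S C in auto)
  then have "biLipschitz_equivalent X S"
    unfolding biLipschitz_equivalent_def using S by (intro disjI1 exI[of _ id]) auto
  then show ?thesis using \<open>snowflake S\<close> by blast
qed

section \<open>Coarse-graining of chains\<close>

text \<open>From the current point, jump to the first later point at distance more than \<open>r\<close>. The point just before
  it is still within \<open>r\<close>, so the jump exceeds \<open>r\<close> by at most one step \<open>s\<close> of the chain. The jumps stop
  when the rest of the chain stays within \<open>r\<close>.\<close>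

lemma greedy_subchain:
  fixes X :: "'a metric" and x :: "nat \<Rightarrow> 'a"
  assumes x: "\<And>i. x i \<in> mspace X" and ij: "i \<le> j" and r: "0 \<le> r"
    and step: "\<And>k. i \<le> k \<Longrightarrow> k < j \<Longrightarrow> mdist X (x k) (x (Suc k)) \<le> s"
  shows "\<exists>n k. k 0 = i \<and> k n \<le> j \<and> mdist X (x (k n)) (x j) \<le> r \<and>
    (\<forall>l<n. k l < k (Suc l) \<and> r < mdist X (x (k l)) (x (k (Suc l))) \<and>
       mdist X (x (k l)) (x (k (Suc l))) \<le> r + s)"
  using ij step
proof (induction "j - i" arbitrary: i rule: less_induct)
  case less
  show ?case
  proof (cases "\<exists>m>i. m \<le> j \<and> r < mdist X (x i) (x m)")
    case True
    define m where "m = (LEAST m. i < m \<and> m \<le> j \<and> r < mdist X (x i) (x m))"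
    have m: "i < m" "m \<le> j" "r < mdist X (x i) (x m)"
      using LeastI_ex[OF True[unfolded Bex_def]] unfolding m_def by auto
    obtain m' where m': "m = Suc m'" using m(1) by (cases m) auto
    have "mdist X (x i) (x m') \<le> r"
    proof (cases "m' = i")
      case False
      then have "\<not> (i < m' \<and> m' \<le> j \<and> r < mdist X (x i) (x m'))"
        using not_less_Least[of m' "\<lambda>m. i < m \<and> m \<le> j \<and> r < mdist X (x i) (x m)"]
        unfolding m_def[symmetric] m' by simp
      then show ?thesis using False m m' by auto
    qed (use x r in simp)
    then have le: "mdist X (x i) (x m) \<le> r + s"
      using mdist_triangle[OF x x x, of i m m'] less.prems(2)[of m'] m m' by auto
    have "\<exists>n k. k 0 = m \<and> k n \<le> j \<and> mdist X (x (k n)) (x j) \<le> r \<and>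
      (\<forall>l<n. k l < k (Suc l) \<and> r < mdist X (x (k l)) (x (k (Suc l))) \<and>
         mdist X (x (k l)) (x (k (Suc l))) \<le> r + s)"
      by (rule less.hyps) (use m less.prems in auto)
    then obtain n k where k: "k 0 = m" "k n \<le> j" "mdist X (x (k n)) (x j) \<le> r"
      "\<And>l. l < n \<Longrightarrow> k l < k (Suc l) \<and> r < mdist X (x (k l)) (x (k (Suc l))) \<and>
         mdist X (x (k l)) (x (k (Suc l))) \<le> r + s" by blast
    have "case_nat i k l < case_nat i k (Suc l) \<and>
        r < mdist X (x (case_nat i k l)) (x (case_nat i k (Suc l))) \<and>
        mdist X (x (case_nat i k l)) (x (case_nat i k (Suc l))) \<le> r + s" if "l < Suc n" for l
      using that k m le by (cases l) auto
    then show ?thesis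
      by (intro exI[of _ "Suc n"] exI[of _ "case_nat i k"]) (use k in simp)
  next
    case False
    have "mdist X (x i) (x j) \<le> r"
    proof (cases "i = j")
      case True
      then show ?thesis using x r by simp
    next
      case ne: False
      then have "i < j" using less.prems by simp
      then show ?thesis using False by force
    qed
    then show ?thesis using less.prems by (intro exI[of _ 0] exI[of _ "\<lambda>_. i"]) auto
  qed
qed

lemma sum_over_subchain:
  fixes g :: "nat \<Rightarrow> real" and k :: "nat \<Rightarrow> nat"
  assumes "\<And>l. l < n \<Longrightarrow> k l \<le> k (Suc l)"
  shows "k 0 \<le> k n \<and> (\<Sum>l<n. \<Sum>i\<in>{k l..<k (Suc l)}. g i) = (\<Sum>i\<in>{k 0..<k n}. g i)"
  using assms
proof (induction n)
  case (Suc n)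
  then have "k 0 \<le> k n" "k n \<le> k (Suc n)"
    "(\<Sum>l<n. \<Sum>i\<in>{k l..<k (Suc l)}. g i) = (\<Sum>i\<in>{k 0..<k n}. g i)" by auto
  then show ?case by (auto simp: sum.atLeastLessThan_concat)
qed simp

text \<open>Induction on the number of steps. Either one step is longer than \<open>\<delta>/4 * D\<close>, and it alone pays for
  \<open>c * D\<^sup>p\<close> because \<open>c = (\<delta>/4)\<^sup>p\<close>; or the chain is grouped greedily into jumps \<open>e\<^sub>l\<close> between \<open>\<delta>/2 * D\<close> and
  \<open>3\<delta>/4 * D\<close>. The hypothesis, applied to the chain of jumps, gives \<open>\<Sum> e\<^sub>l \<ge> (1 + \<delta>/2) * D\<close>, whence
  \<open>\<Sum> e\<^sub>l\<^sup>p \<ge> (\<delta>/2 * D)\<^sup>p\<^sup>-\<^sup>1 * (1 + \<delta>/2) * D\<close>. The exponent \<open>p\<close> is chosen so that the right-hand side is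
  exactly \<open>D\<^sup>p\<close>, and the induction hypothesis applies to each jump.\<close>

lemma stretched_imp_chain_ineq:
  fixes X :: "'a metric"
  assumes \<delta>: "0 < \<delta>" "\<delta> \<le> 1"
    and stretched: "\<And>x N. (\<And>i. x i \<in> mspace X) \<Longrightarrow>
      (\<And>i. i < N \<Longrightarrow> mdist X (x i) (x (Suc i)) \<le> \<delta> * mdist X (x 0) (x N)) \<Longrightarrow>
      (1 + \<delta>) * mdist X (x 0) (x N) \<le> (\<Sum>i<N. mdist X (x i) (x (Suc i)))"
  obtains p c where "1 < p" "0 < c" "chain_ineq X p c"
proof -
  define q where "q = ln (1 + \<delta> / 2) / ln (2 / \<delta>)"
  define p where "p = 1 + q"
  define c where "c = (\<delta> / 4) powr p"
  have ln: "0 < ln (2 / \<delta>)" "0 < ln (1 + \<delta> / 2)" using \<delta> by (auto intro!: ln_gt_zero)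
  have q: "0 < q" using ln by (simp add: q_def)
  have p: "1 < p" using q by (simp add: p_def)
  have c: "0 < c" using \<delta> by (simp add: c_def)
  have dq: "(\<delta> / 2) powr q = 1 / (1 + \<delta> / 2)"
  proof -
    have "ln (\<delta> / 2) = - ln (2 / \<delta>)" using \<delta> by (simp add: ln_div)
    then have "q * ln (\<delta> / 2) = - ln (1 + \<delta> / 2)" using ln by (simp add: q_def)
    then have "(\<delta> / 2) powr q = exp (- ln (1 + \<delta> / 2))" using \<delta> by (simp add: powr_def)
    also have "\<dots> = 1 / (1 + \<delta> / 2)" using \<delta> by (simp add: exp_minus inverse_eq_divide)
    finally show ?thesis .
  qed
  have main: "c * mdist X (x i) (x j) powr p \<le> (\<Sum>k\<in>{i..<j}. mdist X (x k) (x (Suc k)) powr p)"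
    if x: "\<And>i. x i \<in> mspace X" and "i \<le> j" for x :: "nat \<Rightarrow> 'a" and i j
    using \<open>i \<le> j\<close>
  proof (induction "j - i" arbitrary: i j rule: less_induct)
    case less
    define D where "D = mdist X (x i) (x j)"
    let ?g = "\<lambda>k. mdist X (x k) (x (Suc k)) powr p"
    show ?case
    proof (cases "D = 0")
      case True
      then show ?thesis by (simp add: D_def sum_nonneg)
    next
      case False
      then have D: "0 < D" by (simp add: D_def order_less_le)
      show ?thesis
      proof (cases "\<exists>k. i \<le> k \<and> k < j \<and> \<delta> / 4 * D < mdist X (x k) (x (Suc k))")
        case True
        then obtain k where k: "k \<in> {i..<j}" "\<delta> / 4 * D < mdist X (x k) (x (Suc k))" by auto
        have "c * D powr p = (\<delta> / 4 * D) powr p"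
          unfolding c_def by (rule powr_mult[symmetric])
        also have "\<dots> \<le> ?g k" by (rule powr_mono2) (use k \<delta> D p in auto)
        also have "\<dots> \<le> (\<Sum>k\<in>{i..<j}. ?g k)"
          by (rule member_le_sum) (use k in auto)
        finally show ?thesis by (simp add: D_def)
      next
        case False
        then have step: "mdist X (x k) (x (Suc k)) \<le> \<delta> / 4 * D" if "i \<le> k" "k < j" for k
          using that by force
        define r where "r = \<delta> / 2 * D"
        have r: "0 < r" using \<delta> D by (simp add: r_def)
        have "\<exists>n k. k 0 = i \<and> k n \<le> j \<and> mdist X (x (k n)) (x j) \<le> r \<and>
          (\<forall>l<n. k l < k (Suc l) \<and> r < mdist X (x (k l)) (x (k (Suc l))) \<and>
            mdist X (x (k l)) (x (k (Suc l))) \<le> r + \<delta> / 4 * D)"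
          by (rule greedy_subchain) (use x less.prems step r in auto)
        then obtain n k where k: "k 0 = i" "k n \<le> j" and last: "mdist X (x (k n)) (x j) \<le> r"
          and kl: "\<And>l. l < n \<Longrightarrow> k l < k (Suc l)"
          and e: "\<And>l. l < n \<Longrightarrow> r < mdist X (x (k l)) (x (k (Suc l)))"
            "\<And>l. l < n \<Longrightarrow> mdist X (x (k l)) (x (k (Suc l))) \<le> r + \<delta> / 4 * D"
          by blast
        let ?e = "\<lambda>l. mdist X (x (k l)) (x (k (Suc l)))"
        have eD: "?e l \<le> 3 / 4 * \<delta> * D" if "l < n" for l
          using e(2)[OF that] by (simp add: r_def algebra_simps)
        have "\<delta> * D \<le> 1 * D" using \<delta> D by (intro mult_right_mono) auto
        then have e_less: "?e l < D" if "l < n" for l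
          using eD[OF that] D by linarith
        have long: "(1 + \<delta> / 2) * D \<le> (\<Sum>l<n. ?e l)"
        proof -
          define y where "y l = (if l \<le> n then x (k l) else x j)" for l
          have y: "mdist X (y 0) (y (Suc n)) = D" by (simp add: y_def k D_def)
          have yl: "mdist X (y l) (y (Suc l)) = ?e l" if "l < n" for l
            using that by (simp add: y_def)
          have yn: "mdist X (y n) (y (Suc n)) \<le> r" using last by (simp add: y_def)
          have "(1 + \<delta>) * mdist X (y 0) (y (Suc n)) \<le> (\<Sum>l<Suc n. mdist X (y l) (y (Suc l)))"
          proof (rule stretched)
            show "y i \<in> mspace X" for i by (simp add: y_def x)
            fix l assume "l < Suc n"
            then consider "l < n" | "l = n" by linarith
            then show "mdist X (y l) (y (Suc l)) \<le> \<delta> * mdist X (y 0) (y (Suc n))"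
            proof cases
              case 1
              then show ?thesis unfolding y yl[OF 1] using eD[OF 1] \<delta> D mult_pos_pos[of \<delta> D] by linarith
            next
              case 2
              then show ?thesis using yn mult_pos_pos[OF \<delta>(1) D] unfolding y r_def 2 by linarith
            qed
          qed
          also have "\<dots> \<le> (\<Sum>l<n. ?e l) + r" using yn yl by simp
          finally have "(1 + \<delta>) * D \<le> (\<Sum>l<n. ?e l) + r" by (simp add: y)
          then show ?thesis by (simp add: r_def algebra_simps)
        qed
        have mono: "k a \<le> k b" if "a \<le> b" "b \<le> n" for a b
          using that(1,2)
        proof (induction b)
          case (Suc b)
          then show ?case using kl[of b] by (cases "a = Suc b") auto
        qed simp
        have IH: "c * ?e l powr p \<le> (\<Sum>m\<in>{k l..<k (Suc l)}. ?g m)" if l: "l < n" for l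
        proof (rule less.hyps)
          have "i \<le> k l" "k (Suc l) \<le> j" "k l \<le> k (Suc l)"
            using mono[of 0 l] mono[of "Suc l" n] mono[of l "Suc l"] k l by auto
          moreover have "\<not> (k l = i \<and> k (Suc l) = j)"
            using e_less[OF l] by (auto simp: D_def)
          ultimately show "k (Suc l) - k l < j - i" "k l \<le> k (Suc l)" by auto
        qed
        have rq: "r powr q = D powr q / (1 + \<delta> / 2)"
          unfolding r_def powr_mult by (simp add: dq)
        have "D powr p = D powr q * D" using D by (simp add: p_def powr_add)
        also have "\<dots> = r powr q * ((1 + \<delta> / 2) * D)" using \<delta> by (simp add: rq)
        also have "\<dots> \<le> r powr q * (\<Sum>l<n. ?e l)" by (intro mult_left_mono long) auto
        also have "\<dots> = (\<Sum>l<n. ?e l * r powr q)" by (simp add: sum_distrib_left mult.commute)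
        also have "\<dots> \<le> (\<Sum>l<n. ?e l powr p)"
        proof (rule sum_mono)
          fix l assume "l \<in> {..<n}"
          then have l: "r < ?e l" using e by simp
          then have "r powr q \<le> ?e l powr q" using r q by (intro powr_mono2) auto
          then have "?e l * r powr q \<le> ?e l * ?e l powr q" by (intro mult_left_mono) auto
          also have "\<dots> = ?e l powr p" using l r by (simp add: p_def powr_add)
          finally show "?e l * r powr q \<le> ?e l powr p" .
        qed
        finally have "c * D powr p \<le> c * (\<Sum>l<n. ?e l powr p)" using c by (intro mult_left_mono) auto
        also have "\<dots> \<le> (\<Sum>l<n. \<Sum>m\<in>{k l..<k (Suc l)}. ?g m)"
          unfolding sum_distrib_left by (rule sum_mono) (use IH in auto)
        also have "\<dots> = (\<Sum>m\<in>{i..<k n}. ?g m)"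
          using sum_over_subchain[of n k ?g] kl k by (simp add: less_imp_le)
        also have "\<dots> \<le> (\<Sum>m\<in>{i..<j}. ?g m)"
          by (rule sum_mono2) (use k in auto)
        finally show ?thesis by (simp add: D_def)
      qed
    qed
  qed
  have "chain_ineq X p c"
    unfolding chain_ineq_def chain_cost_def using main[of _ 0] by (simp add: atLeast0LessThan)
  with p c show thesis by (rule that)
qed

section \<open>Ultralimits\<close>

text \<open>A maximal family of sets all of whose finite intersections are infinite is a non-principal ultrafilter.\<close>

lemma exists_nonprincipal_ultrafilter: "\<exists>\<omega>. nonprincipal_ultrafilter \<omega>"
proof -
  define good :: "nat set set \<Rightarrow> bool" where
    "good U \<longleftrightarrow> (\<forall>B\<subseteq>U. finite B \<longrightarrow> infinite (\<Inter>B))" for U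
  have "\<exists>M\<in>{U. good U}. \<forall>U\<in>{U. good U}. M \<subseteq> U \<longrightarrow> U = M"
  proof (rule subset_Zorn_nonempty)
    have "good {}" by (auto simp: good_def)
    then show "{U. good U} \<noteq> {}" by blast
    fix \<C> assume C: "\<C> \<noteq> {}" "subset.chain {U. good U} \<C>"
    have "good (\<Union>\<C>)" unfolding good_def
    proof (intro allI impI)
      fix B assume "B \<subseteq> \<Union>\<C>" "finite B"
      then obtain U where "U \<in> \<C>" "B \<subseteq> U"
        using finite_subset_Union_chain[OF _ _ C] by metis
      then show "infinite (\<Inter>B)" using C \<open>finite B\<close> by (auto simp: subset_chain_def good_def)
    qed
    then show "\<Union>\<C> \<in> {U. good U}" by simp
  qed
  then obtain M where M: "good M" and max: "\<And>U. good U \<Longrightarrow> M \<subseteq> U \<Longrightarrow> U = M" by auto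
  have inf: "infinite (\<Inter>B)" if "B \<subseteq> M" "finite B" for B
    using M that by (simp add: good_def)
  have witness: "\<exists>B\<subseteq>M. finite B \<and> finite (A \<inter> \<Inter>B)" if "A \<notin> M" for A
  proof -
    have "\<not> good (insert A M)" using max[of "insert A M"] that by blast
    then obtain B where B: "B \<subseteq> insert A M" "finite B" "finite (\<Inter>B)" by (auto simp: good_def)
    have "A \<inter> \<Inter>(B - {A}) \<subseteq> \<Inter>B" by auto
    then have "finite (A \<inter> \<Inter>(B - {A}))" using B(3) by (rule finite_subset)
    then show ?thesis using B by (intro exI[of _ "B - {A}"]) auto
  qed
  have compl: "- A \<in> M" if A: "A \<notin> M" for A
  proof (rule ccontr)
    assume "- A \<notin> M"
    then obtain B' where B': "B' \<subseteq> M" "finite B'" "finite (- A \<inter> \<Inter>B')" using witness by blast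
    obtain B where B: "B \<subseteq> M" "finite B" "finite (A \<inter> \<Inter>B)" using witness[OF A] by blast
    have "\<Inter>(B \<union> B') \<subseteq> (A \<inter> \<Inter>B) \<union> (- A \<inter> \<Inter>B')" by auto
    then have "finite (\<Inter>(B \<union> B'))" using B(3) B'(3) by (meson finite_UnI finite_subset)
    then show False using inf[of "B \<union> B'"] B B' by simp
  qed
  have inter: "A \<inter> B \<noteq> {}" if "A \<in> M" "B \<in> M" for A B
    using inf[of "{A, B}"] that by auto
  have un: "A \<union> B \<in> M \<longleftrightarrow> A \<in> M \<or> B \<in> M" for A B
  proof
    assume AB: "A \<union> B \<in> M"
    show "A \<in> M \<or> B \<in> M"
    proof (rule ccontr)
      assume "\<not> (A \<in> M \<or> B \<in> M)"
      then have "- A \<in> M" "- B \<in> M" using compl by blast+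
      then have "infinite (\<Inter>{A \<union> B, - A, - B})" using AB by (intro inf) auto
      moreover have "\<Inter>{A \<union> B, - A, - B} = {}" by auto
      ultimately show False by (metis finite.emptyI)
    qed
  next
    assume "A \<in> M \<or> B \<in> M"
    moreover have "False" if "A \<union> B \<notin> M"
      using compl[OF that] inter[of A "- (A \<union> B)"] inter[of B "- (A \<union> B)"] calculation by auto
    ultimately show "A \<union> B \<in> M" by blast
  qed
  have fin: "A \<notin> M" if "finite A" for A
    using inf[of "{A}"] that by auto
  then have "UNIV \<in> M" using compl[of "{}"] by simp
  have "nonprincipal_ultrafilter (\<lambda>A. if A \<in> M then 1 else 0)"
    unfolding nonprincipal_ultrafilter_def
  proof (intro conjI allI impI)
    fix A B :: "nat set" assume "A \<inter> B = {}"
    then have "\<not> (A \<in> M \<and> B \<in> M)" using inter by blast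
    then show "(if A \<union> B \<in> M then 1 else 0) = (if A \<in> M then 1 else 0) + (if B \<in> M then 1 else (0::real))"
      by (simp add: un)
  qed (simp_all add: fin \<open>UNIV \<in> M\<close>)
  then show ?thesis by blast
qed

lemma tendsto_imp_has_omega_lim:
  assumes "nonprincipal_ultrafilter \<omega>" "a \<longlonglongrightarrow> l"
  shows "has_omega_lim \<omega> a l"
  unfolding has_omega_lim_def
proof (intro allI impI)
  fix \<epsilon> :: real assume "0 < \<epsilon>"
  let ?A = "{n. \<bar>a n - l\<bar> < \<epsilon>}"
  have "eventually (\<lambda>n. \<bar>a n - l\<bar> < \<epsilon>) sequentially"
    using assms(2) \<open>0 < \<epsilon>\<close> by (auto simp: tendsto_iff dist_real_def)
  then have "finite (- ?A)"
    by (simp add: cofinite_eq_sequentially[symmetric] eventually_cofinite Collect_neg_eq)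
  then have "\<omega> (- ?A) = 0"
    using assms(1) by (simp add: nonprincipal_ultrafilter_def)
  moreover have "\<omega> (?A \<union> - ?A) = \<omega> ?A + \<omega> (- ?A)" and "\<omega> UNIV = 1"
    using assms(1) unfolding nonprincipal_ultrafilter_def by (blast intro: Compl_disjoint)+
  ultimately show "\<omega> ?A = 1" by simp
qed

lemma omega_limit_simps:
  assumes "nonprincipal_ultrafilter \<omega>" "\<And>n. x n \<in> mspace (X n)"
  shows mspace_omega_limit: "mspace (omega_limit \<omega> X x) = omega_space \<omega> X x"
    and mdist_omega_limit: "mdist (omega_limit \<omega> X x) = omega_dist \<omega> X x"
  using Metric_space.mspace_metric[OF Metric_space_omega[OF assms]]
    Metric_space.mdist_metric[OF Metric_space_omega[OF assms]]
  by (simp_all add: omega_limit_def)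

text \<open>Represent a chain in the ultralimit by chains in the rescaled copies of \<open>X\<close>, multiply the chain inequality
  there by \<open>r\<^sub>n\<^sup>p\<close> and pass to the limit along the ultrafilter.\<close>

lemma chain_ineq_ultralimit:
  fixes X :: "'a metric"
  assumes X: "chain_ineq X p c" and p: "0 < p" and Z: "is_ultralimit X Z z"
  shows "chain_ineq Z p c"
  unfolding chain_ineq_def chain_cost_def
proof (intro allI impI)
  fix u :: "nat \<Rightarrow> (nat \<Rightarrow> 'a) set" and N assume u: "\<forall>i. u i \<in> mspace Z"
  obtain \<omega> r x where \<omega>: "nonprincipal_ultrafilter \<omega>" and r: "\<And>n. 0 < r n"
    and x: "\<And>n. x n \<in> mspace X" and Zeq: "Z = omega_limit \<omega> (\<lambda>n. rescaled (r n) X) x"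
    using Z unfolding is_ultralimit_def by blast
  define W where "W n = rescaled (r n) X" for n
  have W: "mspace (W n) = mspace X" "mdist (W n) = (\<lambda>x y. r n * mdist X x y)" for n
    using r by (simp_all add: W_def mspace_rescaled mdist_rescaled)
  have xW: "x n \<in> mspace (W n)" for n using x by (simp add: W)
  note simps = omega_limit_simps[OF \<omega>, of x W, OF xW]
  have ZW: "Z = omega_limit \<omega> W x" by (simp add: Zeq W_def[abs_def])
  have "\<forall>i. \<exists>y. y \<in> omega_admissible \<omega> W x \<and> u i = omega_rel \<omega> W x `` {y}"
  proof
    fix i
    have "u i \<in> omega_admissible \<omega> W x // omega_rel \<omega> W x"
      using u by (auto simp: ZW simps omega_space_def)
    then show "\<exists>y. y \<in> omega_admissible \<omega> W x \<and> u i = omega_rel \<omega> W x `` {y}"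
      by (auto elim: quotientE)
  qed
  then obtain y where y: "\<And>i. y i \<in> omega_admissible \<omega> W x" "\<And>i. u i = omega_rel \<omega> W x `` {y i}"
    by metis
  have yX: "y i n \<in> mspace X" for i n using y(1)[of i] by (auto simp: omega_admissible_def W)
  obtain F where F: "F \<noteq> bot" and lim: "\<And>a l. has_omega_lim \<omega> a l \<longleftrightarrow> (a \<longlongrightarrow> l) F"
    using omega_filter[OF \<omega>] by metis
  have d: "((\<lambda>n. r n * mdist X (y i n) (y j n)) \<longlongrightarrow> mdist Z (u i) (u j)) F" for i j
    using has_omega_lim_omega_dist[OF \<omega>, of x W, OF xW y(1)[of i] y(1)[of j]]
    by (simp add: lim W ZW simps y(2))
  have dp: "((\<lambda>n. (r n * mdist X (y i n) (y j n)) powr p) \<longlongrightarrow> mdist Z (u i) (u j) powr p) F" for i j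
    by (rule tendsto_powr'[OF d tendsto_const])
       (use p r in \<open>auto intro!: always_eventually simp: less_imp_le\<close>)
  show "c * mdist Z (u 0) (u N) powr p \<le> (\<Sum>i<N. mdist Z (u i) (u (Suc i)) powr p)"
  proof (rule tendsto_le[OF F tendsto_sum[OF dp] tendsto_mult_left[OF dp]], intro always_eventually allI)
    fix n
    have "c * mdist X (y 0 n) (y N n) powr p \<le> (\<Sum>i<N. mdist X (y i n) (y (Suc i) n) powr p)"
      using X yX unfolding chain_ineq_def chain_cost_def by (elim allE[of _ "\<lambda>i. y i n"]) auto
    then have "r n powr p * (c * mdist X (y 0 n) (y N n) powr p)
        \<le> r n powr p * (\<Sum>i<N. mdist X (y i n) (y (Suc i) n) powr p)"
      by (rule mult_left_mono) simp
    then show "c * (r n * mdist X (y 0 n) (y N n)) powr p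
        \<le> (\<Sum>i<N. (r n * mdist X (y i n) (y (Suc i) n)) powr p)"
      using r[of n] by (simp add: powr_mult sum_distrib_left mult_ac)
  qed
qed

locale isometric_segment =
  fixes Z :: "'b metric" and \<gamma> :: "real \<Rightarrow> 'b"
  assumes in_space: "t \<in> {0..1} \<Longrightarrow> \<gamma> t \<in> mspace Z"
    and iso: "s \<in> {0..1} \<Longrightarrow> t \<in> {0..1} \<Longrightarrow> mdist Z (\<gamma> s) (\<gamma> t) = \<bar>s - t\<bar>"

text \<open>Let \<open>L n i\<close> be the length of the first \<open>i\<close> steps of the \<open>n\<close>-th chain, measured in units of its end-to-end
  distance, so that the total length is at most \<open>1 + \<delta>\<^sub>n\<close>. Let \<open>I n t\<close> be an index at which this length is
  \<open>t\<close> up to \<open>\<delta>\<^sub>n\<close>. Two such points are at distance at most \<open>\<bar>s - t\<bar> + \<delta>\<^sub>n\<close>, and at least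
  \<open>\<bar>s - t\<bar> - 2\<delta>\<^sub>n\<close> since otherwise the ends could not be at distance \<open>1\<close>. In the limit the points with
  parameter in \<open>[0,1]\<close> form a segment.\<close>

lemma straight_chains_imp_segment:
  fixes X :: "'a metric"
  assumes straight: "\<And>\<delta>. 0 < \<delta> \<Longrightarrow> \<delta> \<le> 1 \<Longrightarrow> \<exists>x N. (\<forall>i. x i \<in> mspace X) \<and>
      (\<forall>i<N. mdist X (x i) (x (Suc i)) \<le> \<delta> * mdist X (x 0) (x N)) \<and>
      (\<Sum>i<N. mdist X (x i) (x (Suc i))) < (1 + \<delta>) * mdist X (x 0) (x N)"
  obtains Z z \<gamma> where "is_ultralimit X Z z" "isometric_segment Z \<gamma>"
proof -
  define \<delta> where "\<delta> n = 1 / (real n + 1)" for n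
  have \<delta>: "0 < \<delta> n" "\<delta> n \<le> 1" for n by (auto simp: \<delta>_def)
  have "\<forall>n. \<exists>x N. (\<forall>i. x i \<in> mspace X) \<and>
      (\<forall>i<N. mdist X (x i) (x (Suc i)) \<le> \<delta> n * mdist X (x 0) (x N)) \<and>
      (\<Sum>i<N. mdist X (x i) (x (Suc i))) < (1 + \<delta> n) * mdist X (x 0) (x N)"
    using straight \<delta> by blast
  from choice[OF this] obtain u where "\<forall>n. \<exists>N. (\<forall>i. u n i \<in> mspace X) \<and>
      (\<forall>i<N. mdist X (u n i) (u n (Suc i)) \<le> \<delta> n * mdist X (u n 0) (u n N)) \<and>
      (\<Sum>i<N. mdist X (u n i) (u n (Suc i))) < (1 + \<delta> n) * mdist X (u n 0) (u n N)" by blast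
  from choice[OF this] obtain N where "\<forall>n. (\<forall>i. u n i \<in> mspace X) \<and>
      (\<forall>i<N n. mdist X (u n i) (u n (Suc i)) \<le> \<delta> n * mdist X (u n 0) (u n (N n))) \<and>
      (\<Sum>i<N n. mdist X (u n i) (u n (Suc i))) < (1 + \<delta> n) * mdist X (u n 0) (u n (N n))" by blast
  then have u: "\<And>n i. u n i \<in> mspace X"
    and step: "\<And>n i. i < N n \<Longrightarrow> mdist X (u n i) (u n (Suc i)) \<le> \<delta> n * mdist X (u n 0) (u n (N n))"
    and len: "\<And>n. (\<Sum>i<N n. mdist X (u n i) (u n (Suc i))) < (1 + \<delta> n) * mdist X (u n 0) (u n (N n))"
    by blast+
  define D where "D n = mdist X (u n 0) (u n (N n))" for n
  have D: "0 < D n" for n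
  proof -
    have "0 \<le> (\<Sum>i<N n. mdist X (u n i) (u n (Suc i)))" by (simp add: sum_nonneg)
    then have "0 < (1 + \<delta> n) * D n" using len[of n] by (simp add: D_def)
    then show ?thesis using \<delta>[of n] by (simp add: zero_less_mult_iff)
  qed
  define d where "d n i j = inverse (D n) * mdist X (u n i) (u n j)" for n i j
  define L where "L n i = (\<Sum>k<i. d n k (Suc k))" for n i
  have d_nonneg: "0 \<le> d n i j" for n i j using D[of n] by (simp add: d_def)
  have d_tri: "d n i k \<le> d n i j + d n j k" for n i j k
    unfolding d_def distrib_left[symmetric]
    by (intro mult_left_mono mdist_triangle u) (use D[of n] in auto)
  have d_step: "d n i (Suc i) \<le> \<delta> n" if "i < N n" for n i
    using step[OF that] D[of n] by (simp add: d_def D_def[symmetric] field_simps)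
  have d_N: "d n 0 (N n) = 1" for n
    using D[of n] by (simp add: d_def flip: D_def)
  have L_N: "L n (N n) < 1 + \<delta> n" for n
  proof -
    have "D n * L n (N n) = (\<Sum>i<N n. mdist X (u n i) (u n (Suc i)))"
      using D[of n] by (simp add: L_def d_def sum_distrib_left mult.assoc[symmetric])
    also have "\<dots> < D n * (1 + \<delta> n)" using len[of n] by (simp add: D_def mult.commute)
    finally show ?thesis using D[of n] by simp
  qed
  have d_L: "d n i (i + k) \<le> L n (i + k) - L n i" for n i k
  proof (induction k)
    case (Suc k)
    then show ?case using d_tri[of n i "Suc (i + k)" "i + k"] by (simp add: L_def)
  qed (use u in \<open>simp add: d_def\<close>)
  have d_le: "d n i j \<le> L n j - L n i" if "i \<le> j" for n i j
    using d_L[of n i "j - i"] that by simp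
  have d_comm: "d n i j = d n j i" for n i j by (simp add: d_def mdist_commute)
  have d_abs: "d n i j \<le> \<bar>L n i - L n j\<bar>" for n i j
    using d_le[of i j n] d_le[of j i n] d_comm[of n i j] by (cases "i \<le> j") auto
  have L0: "L n 0 = 0" for n by (simp add: L_def)
  have I_ex: "\<exists>i. i \<le> N n \<and> t \<le> L n i \<and> L n i \<le> t + \<delta> n" if t: "t \<in> {0..1}" for n t
  proof -
    have ex: "t \<le> L n (N n)" using d_le[of 0 "N n" n] t by (simp add: d_N L0)
    define i where "i = (LEAST i. t \<le> L n i)"
    have i: "t \<le> L n i" "i \<le> N n" using ex unfolding i_def by (auto intro: LeastI Least_le)
    have "L n i \<le> t + \<delta> n"
    proof (cases i)
      case 0
      then show ?thesis using t \<delta>[of n] by (simp add: L0)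
    next
      case (Suc k)
      then have "L n k < t" using not_less_Least[of k "\<lambda>i. t \<le> L n i"] unfolding i_def[symmetric] by simp
      moreover have "L n i = L n k + d n k (Suc k)" by (simp add: L_def Suc)
      ultimately show ?thesis using d_step[of k n] i(2) Suc by simp
    qed
    with i show ?thesis by blast
  qed
  define I where "I n t = (SOME i. i \<le> N n \<and> t \<le> L n i \<and> L n i \<le> t + \<delta> n)" for n t
  have I: "\<And>n t. t \<in> {0..1} \<Longrightarrow> I n t \<le> N n"
    "\<And>n t. t \<in> {0..1} \<Longrightarrow> t \<le> L n (I n t)" "\<And>n t. t \<in> {0..1} \<Longrightarrow> L n (I n t) \<le> t + \<delta> n"
    using someI_ex[OF I_ex] unfolding I_def by blast+
  have close: "\<bar>d n (I n s) (I n t) - (t - s)\<bar> \<le> 2 * \<delta> n" if "s \<in> {0..1}" "t \<in> {0..1}" "s \<le> t" for n s t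
  proof -
    note Is = I[OF that(1), of n] and It = I[OF that(2), of n]
    have "d n (I n s) (I n t) \<le> (t - s) + \<delta> n"
      using d_abs[of n "I n s" "I n t"] Is It that(3) \<delta>[of n] by linarith
    moreover have "1 \<le> d n 0 (I n s) + d n (I n s) (I n t) + d n (I n t) (N n)"
      using d_tri[of n 0 "N n" "I n s"] d_tri[of n "I n s" "N n" "I n t"] by (simp add: d_N)
    moreover have "d n 0 (I n s) \<le> s + \<delta> n" using d_le[of 0 "I n s" n] Is by (simp add: L0)
    moreover have "d n (I n t) (N n) \<le> 1 + \<delta> n - t"
      using d_le[of "I n t" "N n" n] It L_N[of n] by linarith
    ultimately show ?thesis using \<delta>[of n] by linarith
  qed
  have \<delta>0: "\<delta> \<longlonglongrightarrow> 0"
    using LIMSEQ_inverse_real_of_nat by (simp add: \<delta>_def[abs_def] inverse_eq_divide add.commute)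
  have lim: "(\<lambda>n. d n (I n s) (I n t)) \<longlonglongrightarrow> \<bar>s - t\<bar>" if "s \<in> {0..1}" "t \<in> {0..1}" for s t
  proof -
    have *: "(\<lambda>n. d n (I n s) (I n t)) \<longlonglongrightarrow> t - s" if "s \<in> {0..1}" "t \<in> {0..1}" "s \<le> t" for s t
    proof (rule LIM_zero_cancel, rule Lim_null_comparison)
      show "\<forall>\<^sub>F n in sequentially. norm (d n (I n s) (I n t) - (t - s)) \<le> 2 * \<delta> n"
        using close[OF that] by simp
      show "(\<lambda>n. 2 * \<delta> n) \<longlonglongrightarrow> 0" using tendsto_mult_left[OF \<delta>0, of 2] by simp
    qed
    show ?thesis
    proof (cases "s \<le> t")
      case True
      then show ?thesis using *[OF that] by simp
    next
      case False
      then show ?thesis using *[OF that(2,1)] by (simp add: d_comm)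
    qed
  qed
  obtain \<omega> where \<omega>: "nonprincipal_ultrafilter \<omega>" using exists_nonprincipal_ultrafilter by blast
  define r where "r n = inverse (D n)" for n
  define W where "W n = rescaled (r n) X" for n
  \<comment> \<open>With the base point on the segment, the points of the segment are admissible because their distances to it converge.\<close>
  define x where "x n = u n (I n 0)" for n
  have r: "0 < r n" for n using D by (simp add: r_def)
  have W: "mspace (W n) = mspace X" "mdist (W n) = (\<lambda>x y. r n * mdist X x y)" for n
    using r by (simp_all add: W_def mspace_rescaled mdist_rescaled)
  have xW: "x n \<in> mspace (W n)" for n using u by (simp add: W x_def)
  note simps = omega_limit_simps[OF \<omega>, of x W, OF xW]
  define Z where "Z = omega_limit \<omega> W x"
  define g where "g t n = u n (I n t)" for t n
  define \<gamma> where "\<gamma> t = omega_rel \<omega> W x `` {g t}" for t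
  have Z: "is_ultralimit X Z (omega_rel \<omega> W x `` {x})"
    unfolding is_ultralimit_def Z_def W_def using \<omega> r u
    by (intro exI[of _ \<omega>] exI[of _ r] exI[of _ x]) (auto simp: x_def)
  have dist: "has_omega_lim \<omega> (\<lambda>n. mdist (W n) (g s n) (g t n)) \<bar>s - t\<bar>"
    if "s \<in> {0..1}" "t \<in> {0..1}" for s t
    using tendsto_imp_has_omega_lim[OF \<omega> lim[OF that]] by (simp add: W g_def d_def r_def)
  have adm: "g t \<in> omega_admissible \<omega> W x" if "t \<in> {0..1}" for t
    using dist[of 0 t] that u unfolding omega_admissible_def by (auto simp: W g_def x_def)
  show thesis
  proof (rule that[OF Z], unfold_locales)
    show "\<gamma> t \<in> mspace Z" if "t \<in> {0..1}" for t
      using adm[OF that] by (auto simp: Z_def simps \<gamma>_def omega_space_def quotientI)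
    show "mdist Z (\<gamma> s) (\<gamma> t) = \<bar>s - t\<bar>" if st: "s \<in> {0..1}" "t \<in> {0..1}" for s t
    proof -
      obtain F where F: "F \<noteq> bot" and lim: "\<And>a l. has_omega_lim \<omega> a l \<longleftrightarrow> (a \<longlongrightarrow> l) F"
        using omega_filter[OF \<omega>] by metis
      have "has_omega_lim \<omega> (\<lambda>n. mdist (W n) (g s n) (g t n)) (mdist Z (\<gamma> s) (\<gamma> t))"
        using has_omega_lim_omega_dist[OF \<omega>, of x W, OF xW adm[OF st(1)] adm[OF st(2)]]
        by (simp add: Z_def simps \<gamma>_def)
      then show ?thesis using dist[OF st] tendsto_unique[OF F] unfolding lim by blast
    qed
  qed
qed

section \<open>Rectifiable curves\<close>

text \<open>Only the points of the chain up to \<open>N\<close> are assumed to lie in the space, as is natural for curves.\<close>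

lemma chain_ineq_subchain:
  assumes X: "chain_ineq X p c" and x: "\<And>k. k \<le> N \<Longrightarrow> x k \<in> mspace X" and ij: "i \<le> N" "j \<le> N"
  shows "c * mdist X (x i) (x j) powr p \<le> chain_cost X p x N"
proof -
  have *: "c * mdist X (x i) (x j) powr p \<le> chain_cost X p x N" if "i \<le> j" "j \<le> N" for i j
  proof -
    define y where "y k = x (min (i + k) N)" for k
    have "\<forall>k. y k \<in> mspace X" using x by (auto simp: y_def)
    then have "c * mdist X (y 0) (y (j - i)) powr p \<le> chain_cost X p y (j - i)"
      using X unfolding chain_ineq_def by blast
    also have "chain_cost X p y (j - i) = (\<Sum>k<j - i. mdist X (x (i + k)) (x (Suc (i + k))) powr p)"
      unfolding chain_cost_def y_def using that by (intro sum.cong) (auto simp: min_def)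
    also have "\<dots> = (\<Sum>k\<in>(+) i ` {..<j - i}. mdist X (x k) (x (Suc k)) powr p)"
      by (subst sum.reindex) auto
    also have "\<dots> \<le> chain_cost X p x N"
      unfolding chain_cost_def by (rule sum_mono2) (use that in auto)
    finally show ?thesis using that by (simp add: y_def min_def)
  qed
  show ?thesis
  proof (cases "i \<le> j")
    case False
    then show ?thesis using *[of j i] ij by (simp add: mdist_commute)
  qed (use * ij in auto)
qed

text \<open>The distance \<open>mdist Z (\<gamma> s) (\<gamma> t)\<close> is a real function on the compact square and vanishes on the diagonal, so
  uniform continuity of real functions suffices.\<close>

lemma pathin_uniformly_continuous:
  assumes \<gamma>: "pathin (mtopology_of Z) \<gamma>" and \<epsilon>: "0 < \<epsilon>"
  shows "\<exists>\<delta>>0. \<forall>s\<in>{0..1}. \<forall>t\<in>{0..1}. \<bar>s - t\<bar> < \<delta> \<longrightarrow> mdist Z (\<gamma> s) (\<gamma> t) < \<epsilon>"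
proof -
  have \<gamma>c: "continuous_map (top_of_set {0..1}) (mtopology_of Z) \<gamma>"
    using \<gamma> by (simp add: pathin_def)
  have in_Z: "\<gamma> t \<in> mspace Z" if "t \<in> {0..1}" for t
    using continuous_map_image_subset_topspace[OF \<gamma>c] that by auto
  let ?Q = "{0..1::real} \<times> {0..1::real}"
  have 1: "continuous_map (top_of_set ?Q) (mtopology_of Z) (\<gamma> \<circ> fst)"
    by (rule continuous_map_compose[OF _ \<gamma>c])
       (auto simp: continuous_map_in_subtopology intro!: continuous_intros)
  have 2: "continuous_map (top_of_set ?Q) (mtopology_of Z) (\<gamma> \<circ> snd)"
    by (rule continuous_map_compose[OF _ \<gamma>c])
       (auto simp: continuous_map_in_subtopology intro!: continuous_intros)
  have "continuous_on ?Q (\<lambda>q. mdist Z (\<gamma> (fst q)) (\<gamma> (snd q)))"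
    using continuous_map_mdist[OF 1 2] by (simp add: comp_def)
  then have "uniformly_continuous_on ?Q (\<lambda>q. mdist Z (\<gamma> (fst q)) (\<gamma> (snd q)))"
    by (intro compact_uniformly_continuous) (auto intro: compact_Times)
  then obtain \<delta> where \<delta>: "0 < \<delta>" and u: "\<And>q q'. q \<in> ?Q \<Longrightarrow> q' \<in> ?Q \<Longrightarrow> dist q' q < \<delta> \<Longrightarrow>
      dist (mdist Z (\<gamma> (fst q')) (\<gamma> (snd q'))) (mdist Z (\<gamma> (fst q)) (\<gamma> (snd q))) < \<epsilon>"
    unfolding uniformly_continuous_on_def using \<epsilon> by metis
  show ?thesis
  proof (intro exI[of _ \<delta>] conjI ballI impI \<delta>)
    fix s t :: real assume st: "s \<in> {0..1}" "t \<in> {0..1}" "\<bar>s - t\<bar> < \<delta>"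
    then have "dist (s, t) (t, t) < \<delta>" by (simp add: dist_Pair_Pair dist_real_def)
    then show "mdist Z (\<gamma> s) (\<gamma> t) < \<epsilon>"
      using u[of "(t, t)" "(s, t)"] st in_Z by (simp add: dist_real_def)
  qed
qed

text \<open>If two points of the curve are at distance \<open>D > 0\<close>, sample the curve on a grid so fine that all steps are
  shorter than \<open>\<epsilon>\<close> and grid points come close to both. The chain inequality bounds a multiple of
  \<open>(D/2)\<^sup>p\<close> by \<open>\<epsilon>\<^sup>p\<^sup>-\<^sup>1\<close> times the length of the curve, which is impossible for small \<open>\<epsilon>\<close>.\<close>

lemma chain_ineq_imp_rectifiable_curve_constant:
  assumes p: "1 < p" and c: "0 < c" and Z: "chain_ineq Z p c" and \<gamma>: "rectifiable_curve Z \<gamma>"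
  shows "\<not> nonconstant_curve \<gamma>"
proof
  assume "nonconstant_curve \<gamma>"
  then obtain s t where st: "s \<in> {0..1}" "t \<in> {0..1}" "\<gamma> s \<noteq> \<gamma> t" by (auto simp: nonconstant_curve_def)
  have path: "pathin (mtopology_of Z) \<gamma>" and fin: "curve_length Z \<gamma> < \<infinity>"
    using \<gamma> by (auto simp: rectifiable_curve_def)
  have in_Z: "\<gamma> t \<in> mspace Z" if "t \<in> {0..1}" for t
    using continuous_map_image_subset_topspace[OF path[unfolded pathin_def]] that by auto
  define L where "L = enn2real (curve_length Z \<gamma>)"
  have len: "(\<Sum>i<N. mdist Z (\<gamma> (real i / real N)) (\<gamma> (real (Suc i) / real N))) \<le> L" if "0 < N" for N :: nat
  proof -
    let ?t = "\<lambda>i. real i / real N"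
    have "(\<Sum>i<N. ennreal (mdist Z (\<gamma> (?t i)) (\<gamma> (?t (Suc i))))) \<le> curve_length Z \<gamma>"
      unfolding curve_length_def
      by (rule SUP_upper2[where i = "(N, ?t)"]) (use that in \<open>auto simp: divide_strict_right_mono\<close>)
    then have "ennreal (\<Sum>i<N. mdist Z (\<gamma> (?t i)) (\<gamma> (?t (Suc i)))) \<le> ennreal L"
      using fin by (simp add: L_def)
    then show ?thesis by (simp add: L_def)
  qed
  define D where "D = mdist Z (\<gamma> s) (\<gamma> t)"
  have D: "0 < D" using st in_Z by (simp add: D_def order_less_le)
  define K where "K = c * (D / 2) powr p"
  have K: "0 < K" using c D by (simp add: K_def)
  have L: "0 \<le> L" by (simp add: L_def)
  \<comment> \<open>The second entry makes \<open>\<epsilon>\<^sup>p\<^sup>-\<^sup>1 * L < K\<close>; the first keeps the grid points near \<open>\<gamma> s\<close> and \<open>\<gamma> t\<close> at distance \<open>D/2\<close>.\<close>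
  define \<epsilon> where "\<epsilon> = min (D / 4) ((K / (L + 1)) powr (1 / (p - 1)))"
  have \<epsilon>: "0 < \<epsilon>" "\<epsilon> \<le> D / 4" using D K L by (auto simp: \<epsilon>_def)
  have "\<epsilon> powr (p - 1) \<le> ((K / (L + 1)) powr (1 / (p - 1))) powr (p - 1)"
    by (rule powr_mono2) (use \<epsilon> p in \<open>auto simp: \<epsilon>_def\<close>)
  also have "\<dots> = K / (L + 1)" using p K L by (simp add: powr_powr)
  finally have \<epsilon>K: "\<epsilon> powr (p - 1) * L < K"
  proof -
    assume "\<epsilon> powr (p - 1) \<le> K / (L + 1)"
    then have "\<epsilon> powr (p - 1) * L \<le> K / (L + 1) * L" using L by (rule mult_right_mono)
    also have "\<dots> < K" using K L by (simp add: field_simps)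
    finally show ?thesis .
  qed
  obtain \<delta> where \<delta>: "0 < \<delta>"
    "\<And>s t. s \<in> {0..1} \<Longrightarrow> t \<in> {0..1} \<Longrightarrow> \<bar>s - t\<bar> < \<delta> \<Longrightarrow> mdist Z (\<gamma> s) (\<gamma> t) < \<epsilon>"
    using pathin_uniformly_continuous[OF path \<epsilon>(1)] by blast
  obtain N :: nat where N: "1 / real (Suc N) < \<delta>"
    using \<delta>(1) nat_approx_posE by blast
  define M where "M = Suc N"
  have M: "0 < M" "1 / real M < \<delta>" using N by (simp_all add: M_def)
  let ?x = "\<lambda>i. \<gamma> (real i / real M)"
  have unit: "real i / real M \<in> {0..1}" if "i \<le> M" for i using that M by simp
  have grid: "\<exists>i\<le>M. mdist Z (\<gamma> r) (?x i) < \<epsilon>" if r: "r \<in> {0..1}" for r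
  proof -
    define i where "i = nat \<lfloor>r * real M\<rfloor>"
    have i: "real i \<le> r * real M" "r * real M < real i + 1"
      using r unfolding i_def by (auto simp: of_nat_nat)
    have "r * real M \<le> 1 * real M" using r by (intro mult_right_mono) auto
    then have "i \<le> M" using i(1) by simp
    have "r < real i / real M + 1 / real M" "real i / real M \<le> r"
      using i M by (simp_all add: field_simps)
    then have "\<bar>r - real i / real M\<bar> < \<delta>" using M(2) by linarith
    then show ?thesis using \<delta>(2)[OF r unit[OF \<open>i \<le> M\<close>]] \<open>i \<le> M\<close> by blast
  qed
  obtain i j where i: "i \<le> M" "mdist Z (\<gamma> s) (?x i) < \<epsilon>" and j: "j \<le> M" "mdist Z (\<gamma> t) (?x j) < \<epsilon>"
    using grid st by meson
  have "D \<le> mdist Z (\<gamma> s) (?x i) + mdist Z (?x i) (?x j) + mdist Z (?x j) (\<gamma> t)"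
    using mdist_triangle[of "\<gamma> s" Z "?x i" "\<gamma> t"] mdist_triangle[of "?x i" Z "?x j" "\<gamma> t"]
      in_Z st unit i j by (simp add: D_def)
  then have far: "D / 2 \<le> mdist Z (?x i) (?x j)"
    using i j \<epsilon> mdist_commute[of Z "\<gamma> t" "?x j"] by linarith
  have "K \<le> c * mdist Z (?x i) (?x j) powr p"
    unfolding K_def using c D p far by (intro mult_left_mono powr_mono2) auto
  also have "\<dots> \<le> chain_cost Z p ?x M"
    by (rule chain_ineq_subchain[OF Z]) (use in_Z unit i j in auto)
  also have "\<dots> \<le> (\<Sum>k<M. \<epsilon> powr (p - 1) * mdist Z (?x k) (?x (Suc k)))"
    unfolding chain_cost_def
  proof (rule sum_mono)
    fix k assume k: "k \<in> {..<M}"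
    let ?d = "mdist Z (?x k) (?x (Suc k))"
    have "\<bar>real k / real M - real (Suc k) / real M\<bar> = 1 / real M"
      using M by (simp add: field_simps)
    then have d: "?d < \<epsilon>" by (intro \<delta>(2)) (use k M unit[of k] unit[of "Suc k"] in auto)
    have "?d powr p = ?d powr (p - 1) * ?d"
      using powr_add[of ?d "p - 1" 1] by simp
    also have "\<dots> \<le> \<epsilon> powr (p - 1) * ?d"
      using d p by (intro mult_right_mono powr_mono2) auto
    finally show "?d powr p \<le> \<epsilon> powr (p - 1) * ?d" .
  qed
  also have "\<dots> \<le> \<epsilon> powr (p - 1) * L"
    unfolding sum_distrib_left[symmetric] using len[OF M(1)] by (intro mult_left_mono) auto
  finally show False using \<epsilon>K by linarith
qed

context isometric_segment
begin

lemma continuous_map_segment: "continuous_map (top_of_set {0..1}) (mtopology_of Z) \<gamma>"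
proof -
  have "Lipschitz_continuous_map (submetric euclidean_metric {0..1}) Z \<gamma>"
    unfolding Lipschitz_continuous_map_def
    by (intro conjI exI[of _ 1]) (auto simp: dist_real_def iso in_space)
  then show ?thesis
    using Lipschitz_continuous_imp_continuous_map[of "submetric euclidean_metric {0..1}" Z \<gamma>]
    by (simp add: mtopology_of_submetric)
qed

lemma segment_imp_curve:
  shows "rectifiable_curve Z \<gamma>" "nonconstant_curve \<gamma>"
proof -
  have "pathin (mtopology_of Z) \<gamma>"
    unfolding pathin_def by (rule continuous_map_segment)
  moreover have "curve_length Z \<gamma> \<le> 1"
    unfolding curve_length_def
  proof (rule SUP_least, clarify)
    fix N :: nat and t :: "nat \<Rightarrow> real" assume t: "t 0 = 0" "t N = 1" "\<forall>i<N. t i < t (Suc i)"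
    have mono: "i \<le> j \<Longrightarrow> j \<le> N \<Longrightarrow> t i \<le> t j" for i j
    proof (induction j)
      case (Suc j)
      then show ?case using t(3)[rule_format, of j] by (cases "i = Suc j") auto
    qed simp
    have unit: "t i \<in> {0..1}" if "i \<le> N" for i
      using mono[of 0 i] mono[of i N] t that by auto
    have "mdist Z (\<gamma> (t i)) (\<gamma> (t (Suc i))) = t (Suc i) - t i" if "i < N" for i
      using iso[OF unit unit, of i "Suc i"] t(3) that by (simp add: less_imp_le)
    then have "(\<Sum>i<N. ennreal (mdist Z (\<gamma> (t i)) (\<gamma> (t (Suc i))))) = (\<Sum>i<N. ennreal (t (Suc i) - t i))"
      by simp
    also have "\<dots> = ennreal (\<Sum>i<N. t (Suc i) - t i)"
      using t(3) by (intro sum_ennreal) (simp add: less_imp_le)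
    also have "\<dots> = 1" using t by (simp add: sum_lessThan_telescope)
    finally show "(\<Sum>i<N. ennreal (mdist Z (\<gamma> (t i)) (\<gamma> (t (Suc i))))) \<le> 1" by simp
  qed
  ultimately show "rectifiable_curve Z \<gamma>"
    unfolding rectifiable_curve_def using order.strict_trans1[OF _ ennreal_one_less_top] by auto
  show "nonconstant_curve \<gamma>"
    unfolding nonconstant_curve_def using iso[of 0 1] in_space[of 0] by (intro bexI[of _ 0] bexI[of _ 1]) auto
qed

end

section \<open>Rectifiable sets\<close>

text \<open>For null sets the restriction on the diameters is automatic: no diameter exceeds the sum of all of them.\<close>

lemma hausdorff1_null_iff:
  "hausdorff1 X S = 0 \<longleftrightarrow>
    (\<forall>\<epsilon>>0. \<exists>A::nat \<Rightarrow> 'a set. (\<forall>i. A i \<subseteq> mspace X) \<and> S \<subseteq> (\<Union>i. A i) \<and> (\<Sum>i. mdiam X (A i)) \<le> ennreal \<epsilon>)"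
  (is "_ \<longleftrightarrow> ?R")
proof
  assume 0: "hausdorff1 X S = 0"
  show ?R
  proof (intro allI impI)
    fix \<epsilon> :: real assume "0 < \<epsilon>"
    have "hausdorff1_pre X 1 S \<le> hausdorff1 X S"
      unfolding hausdorff1_def by (rule SUP_upper) simp
    then have "hausdorff1_pre X 1 S < ennreal \<epsilon>" using 0 \<open>0 < \<epsilon>\<close> by simp
    then show "\<exists>A::nat \<Rightarrow> 'a set. (\<forall>i. A i \<subseteq> mspace X) \<and> S \<subseteq> (\<Union>i. A i) \<and> (\<Sum>i. mdiam X (A i)) \<le> ennreal \<epsilon>"
      unfolding hausdorff1_pre_def by (auto simp: INF_less_iff intro: less_imp_le)
  qed
next
  assume R: ?R
  have "hausdorff1_pre X \<delta> S \<le> 0" if "0 < \<delta>" for \<delta>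
  proof (rule ennreal_le_epsilon)
    fix \<epsilon> :: real assume "0 < \<epsilon>"
    then obtain A :: "nat \<Rightarrow> 'a set" where A: "\<And>i. A i \<subseteq> mspace X" "S \<subseteq> (\<Union>i. A i)"
      "(\<Sum>i. mdiam X (A i)) \<le> ennreal (min \<epsilon> \<delta>)"
      using R \<open>0 < \<delta>\<close> by (metis min_less_iff_conj)
    have "mdiam X (A i) \<le> (\<Sum>i. mdiam X (A i))" for i
      using sum_le_suminf[of "\<lambda>i. mdiam X (A i)" "{i}"] by simp
    then have "mdiam X (A i) \<le> ennreal \<delta>" for i
      using A(3) by (meson ennreal_leI min.cobounded2 order.trans)
    then have "hausdorff1_pre X \<delta> S \<le> (\<Sum>i. mdiam X (A i))"
      unfolding hausdorff1_pre_def using A by (intro INF_lower) auto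
    also have "\<dots> \<le> ennreal \<epsilon>"
      using A(3) by (meson ennreal_leI min.cobounded1 order.trans)
    finally show "hausdorff1_pre X \<delta> S \<le> 0 + ennreal \<epsilon>" by simp
  qed
  then have "hausdorff1 X S \<le> 0" unfolding hausdorff1_def by (intro SUP_least) simp
  then show "hausdorff1 X S = 0" by simp
qed

lemma hausdorff1_null_mono:
  "hausdorff1 X S = 0 \<Longrightarrow> T \<subseteq> S \<Longrightarrow> hausdorff1 X T = 0"
  unfolding hausdorff1_null_iff by (meson order.trans)

lemma hausdorff1_null_submetric:
  assumes "hausdorff1 (submetric X E) S = 0"
  shows "hausdorff1 X S = 0"
proof -
  have "mdiam (submetric X E) A = mdiam X A" for A by (simp add: mdiam_def)
  then show ?thesis using assms unfolding hausdorff1_null_iff by (simp add: le_infI1) (meson Int_lower2 order.trans)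
qed

lemma hausdorff1_null_UN:
  fixes S :: "nat \<Rightarrow> 'a set"
  assumes "\<And>n. hausdorff1 X (S n) = 0"
  shows "hausdorff1 X (\<Union>n. S n) = 0"
  unfolding hausdorff1_null_iff
proof (intro allI impI)
  fix \<epsilon> :: real assume \<epsilon>: "0 < \<epsilon>"
  have "\<forall>n. \<exists>A::nat \<Rightarrow> 'a set. (\<forall>i. A i \<subseteq> mspace X) \<and> S n \<subseteq> (\<Union>i. A i) \<and>
      (\<Sum>i. mdiam X (A i)) \<le> ennreal (\<epsilon> * (1/2) ^ Suc n)"
  proof
    fix n
    have "0 < \<epsilon> * (1/2) ^ Suc n" using \<epsilon> by simp
    then show "\<exists>A::nat \<Rightarrow> 'a set. (\<forall>i. A i \<subseteq> mspace X) \<and> S n \<subseteq> (\<Union>i. A i) \<and>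
      (\<Sum>i. mdiam X (A i)) \<le> ennreal (\<epsilon> * (1/2) ^ Suc n)"
      using assms[of n] unfolding hausdorff1_null_iff by blast
  qed
  from choice[OF this] obtain A :: "nat \<Rightarrow> nat \<Rightarrow> 'a set"
    where "\<forall>n. (\<forall>i. A n i \<subseteq> mspace X) \<and> S n \<subseteq> (\<Union>i. A n i) \<and>
      (\<Sum>i. mdiam X (A n i)) \<le> ennreal (\<epsilon> * (1/2) ^ Suc n)" by blast
  then have A: "\<And>n i. A n i \<subseteq> mspace X" "\<And>n. S n \<subseteq> (\<Union>i. A n i)"
    "\<And>n. (\<Sum>i. mdiam X (A n i)) \<le> ennreal (\<epsilon> * (1/2) ^ Suc n)" by blast+
  define B where "B k = A (fst (prod_decode k)) (snd (prod_decode k))" for k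
  have "(\<Sum>k. mdiam X (B k)) = (\<Sum>n. \<Sum>i. mdiam X (A n i))"
    using suminf_ennreal_2dimen[where f = "\<lambda>q. mdiam X (A (fst q) (snd q))" and g = "\<lambda>n. \<Sum>i. mdiam X (A n i)"]
    by (simp add: B_def)
  also have "\<dots> \<le> (\<Sum>n. ennreal (\<epsilon> * (1/2) ^ Suc n))"
    by (intro suminf_le A summableI)
  also have "\<dots> = ennreal \<epsilon>"
  proof (rule suminf_ennreal_eq)
    show "(\<lambda>n. \<epsilon> * (1/2) ^ Suc n) sums \<epsilon>"
      using sums_mult[OF power_half_series, of \<epsilon>] by simp
  qed (use \<epsilon> in simp)
  finally have sum: "(\<Sum>k. mdiam X (B k)) \<le> ennreal \<epsilon>" .
  have "A n i = B (prod_encode (n, i))" for n i by (simp add: B_def)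
  then have "(\<Union>i. A n i) \<subseteq> (\<Union>k. B k)" for n by (metis UN_subset_iff UNIV_I UN_upper)
  then have "(\<Union>n. S n) \<subseteq> (\<Union>k. B k)" using A(2) by (meson UN_least order.trans)
  with sum show "\<exists>A::nat \<Rightarrow> 'a set. (\<forall>i. A i \<subseteq> mspace X) \<and> (\<Union>n. S n) \<subseteq> (\<Union>i. A i) \<and>
      (\<Sum>i. mdiam X (A i)) \<le> ennreal \<epsilon>"
  proof (intro exI[of _ B] conjI allI)
    show "B i \<subseteq> mspace X" for i unfolding B_def by (rule A(1))
  qed assumption+
qed

text \<open>The connected components, enumerated with empty sets in the unused places.\<close>

lemma open_real_disjoint_intervals:
  fixes U :: "real set"
  assumes "open U"
  obtains A :: "nat \<Rightarrow> real set" where "disjoint_family A" "(\<Union>i. A i) = U"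
    "\<And>i. open (A i)" "\<And>i. connected (A i)"
proof -
  let ?D = "components U"
  have op: "open K" if "K \<in> ?D" for K using open_components[OF assms that] .
  have disj: "K \<inter> K' = {}" if "K \<in> ?D" "K' \<in> ?D" "K \<noteq> K'" for K K'
    using pairwise_disjoint_components[of U] that by (auto simp: pairwise_def)
  have "countable ?D"
    by (rule countable_disjoint_open_subsets) (use op disj in \<open>auto simp: disjnt_def pairwise_def\<close>)
  define A where "A i = (if i \<in> to_nat_on ?D ` ?D then from_nat_into ?D i else {})" for i
  have A: "A i = {} \<or> A i \<in> ?D" for i
    using \<open>countable ?D\<close> by (auto simp: A_def)
  have idx: "i = to_nat_on ?D (A i) \<and> A i \<in> ?D" if "x \<in> A i" for x i
    using that \<open>countable ?D\<close> by (auto simp: A_def split: if_splits)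
  have "i = j" if "x \<in> A i" "x \<in> A j" for x i j
  proof -
    have "A i = A j" using disj[of "A i" "A j"] idx[OF that(1)] idx[OF that(2)] that by blast
    then show ?thesis using idx[OF that(1)] idx[OF that(2)] by metis
  qed
  then have "disjoint_family A" by (auto simp: disjoint_family_on_def)
  moreover have "(\<Union>i. A i) = U"
  proof
    show "(\<Union>i. A i) \<subseteq> U" using idx in_components_subset by blast
    show "U \<subseteq> (\<Union>i. A i)"
    proof
      fix x assume "x \<in> U"
      then obtain K where K: "K \<in> ?D" "x \<in> K" using Union_components[of U] by blast
      then have "A (to_nat_on ?D K) = K" using \<open>countable ?D\<close> by (simp add: A_def)
      then show "x \<in> (\<Union>i. A i)" using K(2) by blast
    qed
  qed
  moreover have "open (A i)" "connected (A i)" for i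
    using A[of i] op in_components_connected by auto
  ultimately show thesis by (rule that)
qed

text \<open>Divide \<open>[s,t]\<close> into \<open>N\<close> intervals of length \<open>h\<close>. If \<open>h\<close> is larger than the measure of the gap
  \<open>[s,t] - B\<close>, each of them meets \<open>B\<close>, and a chain through these points has at most \<open>N + 1 \<le> 2N\<close> steps, whose
  images have size at most \<open>2Lh\<close>; this gives \<open>c * d\<^sup>p \<le> 2N * (2Lh)\<^sup>p\<close>, a constant times \<open>N\<^sup>1\<^sup>-\<^sup>p * (t - s)\<^sup>p\<close>, which
  is negligible for large \<open>N\<close>. Otherwise \<open>t - s\<close> is at most \<open>N\<close> times the gap, and the Lipschitz bound
  suffices.\<close>

lemma chain_ineq_gap_estimate:
  fixes f :: "real \<Rightarrow> 'a"
  assumes p: "1 < p" and c: "0 < c" and Z: "chain_ineq Z p c"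
    and B: "B \<in> sets lebesgue" and f: "\<And>s. s \<in> B \<Longrightarrow> f s \<in> mspace Z" and L: "0 < L"
    and lip: "\<And>s t. s \<in> B \<Longrightarrow> t \<in> B \<Longrightarrow> mdist Z (f s) (f t) \<le> L * \<bar>s - t\<bar>"
    and \<epsilon>: "0 < \<epsilon>"
  obtains C where "0 < C" "\<And>s t. s \<in> B \<Longrightarrow> t \<in> B \<Longrightarrow> s \<le> t \<Longrightarrow>
    mdist Z (f s) (f t) \<le> \<epsilon> * (t - s) + C * measure lebesgue ({s..t} - B)"
proof -
  \<comment> \<open>\<open>N\<close> is chosen with \<open>N\<^sup>p\<^sup>-\<^sup>1 \<ge> M\<close>, which makes the chain estimate at most \<open>c * (\<epsilon> * (t - s))\<^sup>p\<close>.\<close>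
  define M where "M = 2 * (2 * L) powr p / (c * \<epsilon> powr p)"
  obtain N0 :: nat where N0: "M powr (1 / (p - 1)) < real N0" using reals_Archimedean2 by blast
  define N where "N = Suc N0"
  have N: "0 < N" "M powr (1 / (p - 1)) \<le> real N" using N0 by (simp_all add: N_def)
  have M: "0 < M" using c \<epsilon> L by (simp add: M_def)
  have "M = (M powr (1 / (p - 1))) powr (p - 1)" using M p by (simp add: powr_powr)
  also have "\<dots> \<le> real N powr (p - 1)" by (rule powr_mono2) (use N p in auto)
  finally have "M * (c * \<epsilon> powr p) \<le> real N powr (p - 1) * (c * \<epsilon> powr p)"
    using c \<epsilon> by (intro mult_right_mono) auto
  then have NM: "2 * (2 * L) powr p \<le> real N powr (p - 1) * (c * \<epsilon> powr p)"
    using c \<epsilon> by (simp add: M_def)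
  show thesis
  proof (rule that[of "L * real N"])
    show "0 < L * real N" using L N by simp
    fix s t assume st: "s \<in> B" "t \<in> B" "s \<le> t"
    define g where "g = measure lebesgue ({s..t} - B)"
    have g: "0 \<le> g" by (simp add: g_def)
    define h where "h = (t - s) / real N"
    have h: "0 \<le> h" "s + real N * h = t" using st N by (simp_all add: h_def)
    have "mdist Z (f s) (f t) \<le> \<epsilon> * (t - s) + L * real N * g"
    proof (cases "h \<le> g")
      case True
      have "mdist Z (f s) (f t) \<le> L * (t - s)" using lip[OF st(1,2)] st(3) by simp
      also have "\<dots> = L * real N * h" using h(2) by (simp add: mult.assoc[symmetric] flip: h(2))
      also have "\<dots> \<le> L * real N * g" using True L by (intro mult_left_mono) auto
      finally show ?thesis using \<epsilon> st by (smt (verit) mult_nonneg_nonneg)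
    next
      case False
      have "\<exists>u\<in>B. s + real k * h \<le> u \<and> u \<le> s + real (Suc k) * h" if "k < N" for k
      proof (rule ccontr)
        assume *: "\<not> (\<exists>u\<in>B. s + real k * h \<le> u \<and> u \<le> s + real (Suc k) * h)"
        let ?J = "{s + real k * h..s + real (Suc k) * h}"
        have "real (Suc k) * h \<le> real N * h" using that h by (intro mult_right_mono) auto
        moreover have "0 \<le> real k * h" using h by simp
        ultimately have "?J \<subseteq> {s..t} - B" using * h(2) by auto
        moreover have "{s..t} - B \<in> lmeasurable"
          using B by (intro fmeasurable_Diff) auto
        ultimately have "measure lebesgue ?J \<le> g"
          unfolding g_def by (intro measure_mono_fmeasurable) auto
        moreover have "measure lebesgue ?J = h" using h by (simp add: algebra_simps)
        ultimately show False using False by simp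
      qed
      then obtain u where u: "\<And>k. k < N \<Longrightarrow> u k \<in> B"
        "\<And>k. k < N \<Longrightarrow> s + real k * h \<le> u k" "\<And>k. k < N \<Longrightarrow> u k \<le> s + real (Suc k) * h"
        by metis
      \<comment> \<open>With this shift of the indices \<open>y k\<close> lies in the interval ending at \<open>s + k * h\<close> for every \<open>k\<close>, the ends included.\<close>
      define y where "y k = (if k = 0 then s else if k \<le> N then u (k - 1) else t)" for k
      have yB: "y k \<in> B" for k using u st by (auto simp: y_def)
      have y_near: "s + (real k - 1) * h \<le> y k \<and> y k \<le> s + real k * h" if k: "k \<le> Suc N" for k
      proof -
        consider "k = 0" | "k \<noteq> 0" "k \<le> N" | "k = Suc N" using k by linarith
        then show ?thesis
        proof cases
          case 2
          then show ?thesis using u(2)[of "k - 1"] u(3)[of "k - 1"] by (auto simp: y_def of_nat_diff)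
        next
          case 3
          then show ?thesis using h by (simp add: y_def algebra_simps)
        qed (use h in \<open>auto simp: y_def\<close>)
      qed
      have "c * mdist Z (f (y 0)) (f (y (Suc N))) powr p \<le> chain_cost Z p (\<lambda>k. f (y k)) (Suc N)"
        by (rule Z[unfolded chain_ineq_def, rule_format, of "\<lambda>k. f (y k)" "Suc N"]) (rule f[OF yB])
      also have "\<dots> \<le> (\<Sum>k<Suc N. (L * (2 * h)) powr p)"
        unfolding chain_cost_def
      proof (rule sum_mono)
        fix k assume "k \<in> {..<Suc N}"
        then have "\<bar>y k - y (Suc k)\<bar> \<le> 2 * h"
          using y_near[of k] y_near[of "Suc k"] by (auto simp: abs_le_iff algebra_simps)
        then have "L * \<bar>y k - y (Suc k)\<bar> \<le> L * (2 * h)" using L by (intro mult_left_mono) auto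
        then show "mdist Z (f (y k)) (f (y (Suc k))) powr p \<le> (L * (2 * h)) powr p"
          using lip[OF yB yB, of k "Suc k"] p by (intro powr_mono2) auto
      qed
      also have "\<dots> = (1 + real N) * ((2 * L) powr p * h powr p)"
        by (simp add: powr_mult[symmetric] mult_ac)
      also have "\<dots> \<le> (2 * real N) * ((2 * L) powr p * h powr p)"
        using N by (intro mult_right_mono) auto
      also have "\<dots> = real N * h powr p * (2 * (2 * L) powr p)" by simp
      also have "\<dots> \<le> real N * h powr p * (real N powr (p - 1) * (c * \<epsilon> powr p))"
        by (intro mult_left_mono NM) auto
      also have "\<dots> = c * (\<epsilon> * (real N * h)) powr p"
      proof -
        have "real N powr p = real N * real N powr (p - 1)"
          using powr_add[of "real N" 1 "p - 1"] by simp
        then show ?thesis by (simp add: powr_mult)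
      qed
      finally have "mdist Z (f s) (f t) powr p \<le> (\<epsilon> * (real N * h)) powr p"
        using c N by (simp add: y_def)
      then have "mdist Z (f s) (f t) \<le> \<epsilon> * (real N * h)"
        using powr_less_mono2[of p "\<epsilon> * (real N * h)" "mdist Z (f s) (f t)"] p \<epsilon> h by force
      also have "real N * h = t - s" using h by linarith
      finally show ?thesis using L g by (smt (verit) mult_nonneg_nonneg of_nat_0_le_iff)
    qed
    then show "mdist Z (f s) (f t) \<le> \<epsilon> * (t - s) + L * real N * measure lebesgue ({s..t} - B)"
      by (simp add: g_def)
  qed
qed

text \<open>Cover \<open>B\<close> by an open set \<open>U\<close> that is larger by less than \<open>e\<close>, and let \<open>A\<^sub>i\<close> be its intervals. The gap estimate
  bounds the diameter of the image of \<open>B \<inter> A\<^sub>i\<close> by \<open>\<epsilon> * \<bar>A\<^sub>i\<bar> + C * \<bar>A\<^sub>i - B\<bar>\<close>, and the sum of these bounds is at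
  most \<open>\<epsilon> * \<bar>U\<bar> + C * e\<close>. Here \<open>e\<close> is chosen after \<open>C\<close>, which depends on \<open>\<epsilon>\<close>.\<close>

lemma chain_ineq_Lipschitz_image_null_bounded:
  fixes f :: "real \<Rightarrow> 'a"
  assumes p: "1 < p" and c: "0 < c" and Z: "chain_ineq Z p c"
    and B: "B \<in> lmeasurable" and f: "\<And>s. s \<in> B \<Longrightarrow> f s \<in> mspace Z" and L: "0 < L"
    and lip: "\<And>s t. s \<in> B \<Longrightarrow> t \<in> B \<Longrightarrow> mdist Z (f s) (f t) \<le> L * \<bar>s - t\<bar>"
  shows "hausdorff1 Z (f ` B) = 0"
  unfolding hausdorff1_null_iff
proof (intro allI impI)
  fix \<eta> :: real assume \<eta>: "0 < \<eta>"
  define b where "b = measure lebesgue B"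
  have b: "0 \<le> b" "emeasure lebesgue B = ennreal b"
    using B by (simp_all add: b_def emeasure_eq_measure2)
  define \<epsilon> where "\<epsilon> = \<eta> / (2 * (b + 1))"
  have \<epsilon>: "0 < \<epsilon>" using \<eta> b by (simp add: \<epsilon>_def)
  have Bs: "B \<in> sets lebesgue" using B by simp
  obtain C where C: "0 < C" and gap: "\<And>s t. s \<in> B \<Longrightarrow> t \<in> B \<Longrightarrow> s \<le> t \<Longrightarrow>
      mdist Z (f s) (f t) \<le> \<epsilon> * (t - s) + C * measure lebesgue ({s..t} - B)"
    using chain_ineq_gap_estimate[OF p c Z Bs f L lip \<epsilon>] by blast
  define e where "e = min 1 (\<eta> / (2 * C))"
  have e: "0 < e" "e \<le> 1" "C * e \<le> \<eta> / 2"
    using \<eta> C by (auto simp: e_def min_def field_simps)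
  obtain U where U: "open U" "B \<subseteq> U" "U - B \<in> lmeasurable" "emeasure lebesgue (U - B) < ennreal e"
    using sets_lebesgue_outer_open[OF Bs e(1)] .
  obtain A :: "nat \<Rightarrow> real set" where A: "disjoint_family A" "(\<Union>i. A i) = U"
    "\<And>i. open (A i)" "\<And>i. connected (A i)"
    using open_real_disjoint_intervals[OF U(1)] by metis
  have As: "A i \<in> sets lebesgue" for i using A(3) by simp
  have UB: "U = B \<union> (U - B)" using U(2) by blast
  then have "emeasure lebesgue U \<le> emeasure lebesgue B + emeasure lebesgue (U - B)"
    using emeasure_subadditive[OF Bs, of "U - B"] U(3) by auto
  also have "\<dots> \<le> ennreal b + ennreal 1"
    using U(4) e(2) b(2) by (intro add_mono) (auto intro: order.trans[OF less_imp_le])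
  finally have Ub: "emeasure lebesgue U \<le> ennreal (b + 1)" using b by simp
  have Ufin: "U \<in> lmeasurable" using U UB B by (metis fmeasurable.Un)
  have diam: "mdiam Z (f ` (B \<inter> A i)) \<le>
      ennreal \<epsilon> * emeasure lebesgue (A i) + ennreal C * emeasure lebesgue (A i - B)" for i
    unfolding mdiam_def
  proof (intro SUP_least)
    have Af: "A i \<in> lmeasurable" using Ufin As A(2) by (intro fmeasurableI2[OF Ufin]) auto
    have ABf: "A i - B \<in> lmeasurable" using Af Bs by (intro fmeasurable_Diff) auto
    have *: "mdist Z (f s) (f t) \<le> \<epsilon> * measure lebesgue (A i) + C * measure lebesgue (A i - B)"
      if st: "s \<in> B \<inter> A i" "t \<in> B \<inter> A i" "s \<le> t" for s t
    proof -
      have sub: "{s..t} \<subseteq> A i" using connected_contains_Icc[OF A(4)] st by blast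
      have "t - s = measure lebesgue {s..t}" using st by simp
      also have "\<dots> \<le> measure lebesgue (A i)" using sub Af by (intro measure_mono_fmeasurable) auto
      finally have 1: "t - s \<le> measure lebesgue (A i)" .
      have 2: "measure lebesgue ({s..t} - B) \<le> measure lebesgue (A i - B)"
        using sub Bs ABf by (intro measure_mono_fmeasurable) auto
      have "\<epsilon> * (t - s) + C * measure lebesgue ({s..t} - B)
          \<le> \<epsilon> * measure lebesgue (A i) + C * measure lebesgue (A i - B)"
        using 1 2 \<epsilon> C by (intro add_mono mult_left_mono) auto
      with gap[of s t] st show ?thesis by simp
    qed
    fix x y assume "x \<in> f ` (B \<inter> A i)" "y \<in> f ` (B \<inter> A i)"
    then obtain s t where st: "s \<in> B \<inter> A i" "t \<in> B \<inter> A i" "x = f s" "y = f t" by blast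
    have "mdist Z x y \<le> \<epsilon> * measure lebesgue (A i) + C * measure lebesgue (A i - B)"
    proof (cases "s \<le> t")
      case True
      then show ?thesis using *[of s t] st by simp
    next
      case False
      then show ?thesis using *[of t s] st by (simp add: mdist_commute)
    qed
    then have "ennreal (mdist Z x y) \<le> ennreal (\<epsilon> * measure lebesgue (A i) + C * measure lebesgue (A i - B))"
      by (rule ennreal_leI)
    also have "\<dots> = ennreal \<epsilon> * emeasure lebesgue (A i) + ennreal C * emeasure lebesgue (A i - B)"
      using \<epsilon> C Af ABf by (simp add: emeasure_eq_measure2 ennreal_mult)
    finally show "ennreal (mdist Z x y) \<le>
        ennreal \<epsilon> * emeasure lebesgue (A i) + ennreal C * emeasure lebesgue (A i - B)" .
  qed
  have sumA: "(\<Sum>i. emeasure lebesgue (A i)) = emeasure lebesgue U"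
    unfolding A(2)[symmetric] by (rule suminf_emeasure) (use A(1) As in auto)
  have sumAB: "(\<Sum>i. emeasure lebesgue (A i - B)) = emeasure lebesgue (U - B)"
  proof -
    have "disjoint_family (\<lambda>i. A i - B)" using A(1) by (auto simp: disjoint_family_on_def)
    moreover have "(\<Union>i. A i - B) = U - B" using A(2) by blast
    moreover have "range (\<lambda>i. A i - B) \<subseteq> sets lebesgue" using As Bs by auto
    ultimately show ?thesis using suminf_emeasure[of "\<lambda>i. A i - B" lebesgue] by metis
  qed
  have "(\<Sum>i. mdiam Z (f ` (B \<inter> A i))) \<le>
      (\<Sum>i. ennreal \<epsilon> * emeasure lebesgue (A i) + ennreal C * emeasure lebesgue (A i - B))"
    by (intro suminf_le diam summableI)
  also have "\<dots> = ennreal \<epsilon> * emeasure lebesgue U + ennreal C * emeasure lebesgue (U - B)"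
    by (simp add: suminf_add[symmetric] sumA sumAB)
  also have "\<dots> \<le> ennreal \<epsilon> * ennreal (b + 1) + ennreal C * ennreal e"
    using Ub U(4) by (intro add_mono mult_left_mono) auto
  also have "\<dots> = ennreal (\<epsilon> * (b + 1) + C * e)"
    using \<epsilon> b C e by (simp add: ennreal_mult)
  also have "\<dots> \<le> ennreal \<eta>"
  proof (rule ennreal_leI)
    have "\<epsilon> * (b + 1) = \<eta> / 2" using b by (simp add: \<epsilon>_def field_simps)
    then show "\<epsilon> * (b + 1) + C * e \<le> \<eta>" using e(3) by simp
  qed
  finally have "(\<Sum>i. mdiam Z (f ` (B \<inter> A i))) \<le> ennreal \<eta>" .
  moreover have "f ` B \<subseteq> (\<Union>i. f ` (B \<inter> A i))" using U(2) A(2) by blast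
  moreover have "\<forall>i. f ` (B \<inter> A i) \<subseteq> mspace Z" using f by blast
  ultimately show "\<exists>D::nat \<Rightarrow> 'a set. (\<forall>i. D i \<subseteq> mspace Z) \<and> f ` B \<subseteq> (\<Union>i. D i) \<and>
      (\<Sum>i. mdiam Z (D i)) \<le> ennreal \<eta>"
    by (intro exI[of _ "\<lambda>i. f ` (B \<inter> A i)"] conjI)
qed

lemma chain_ineq_Lipschitz_image_null:
  fixes f :: "real \<Rightarrow> 'a"
  assumes p: "1 < p" and c: "0 < c" and Z: "chain_ineq Z p c" and B: "B \<in> sets borel"
    and f: "Lipschitz_continuous_map (submetric euclidean_metric B) Z f"
  shows "hausdorff1 Z (f ` B) = 0"
proof -
  obtain L where L: "0 < L"
    and lip': "\<forall>s\<in>mspace (submetric euclidean_metric B). \<forall>t\<in>mspace (submetric euclidean_metric B).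
      mdist Z (f s) (f t) \<le> L * mdist (submetric euclidean_metric B) s t"
    using f unfolding Lipschitz_continuous_map_pos by (elim conjE exE) (rule that)
  have lip: "mdist Z (f s) (f t) \<le> L * \<bar>s - t\<bar>" if "s \<in> B" "t \<in> B" for s t
    using lip' that by (simp add: dist_real_def)
  have fZ: "f s \<in> mspace Z" if "s \<in> B" for s
    using Lipschitz_continuous_map_image[OF f] that by auto
  have "hausdorff1 Z (f ` (B \<inter> {-real n..real n})) = 0" for n
  proof (rule chain_ineq_Lipschitz_image_null_bounded[OF p c Z _ _ L])
    have "B \<inter> {-real n..real n} \<in> sets lebesgue"
      using B by (intro sets_completionI_sets) simp
    moreover have "bounded (B \<inter> {-real n..real n})"
      by (rule bounded_subset[OF bounded_closed_interval]) blast
    ultimately show "B \<inter> {-real n..real n} \<in> lmeasurable"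
      by (intro bounded_set_imp_lmeasurable)
  qed (use fZ lip in auto)
  then have "hausdorff1 Z (\<Union>n. f ` (B \<inter> {-real n..real n})) = 0"
    by (rule hausdorff1_null_UN)
  moreover have "f ` B \<subseteq> (\<Union>n. f ` (B \<inter> {-real n..real n}))"
  proof (rule image_subsetI)
    fix s assume "s \<in> B"
    obtain n :: nat where "\<bar>s\<bar> \<le> real n" using real_arch_simple by blast
    then have "s \<in> B \<inter> {-real n..real n}" using \<open>s \<in> B\<close> by (simp add: abs_le_iff)
    then show "f s \<in> (\<Union>n. f ` (B \<inter> {-real n..real n}))" by blast
  qed
  ultimately show ?thesis by (rule hausdorff1_null_mono)
qed

lemma chain_ineq_imp_purely_unrectifiable:
  assumes p: "1 < p" and c: "0 < c" and Z: "chain_ineq Z p c"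
  shows "purely_unrectifiable1 Z"
  unfolding purely_unrectifiable1_def
proof clarify
  fix E assume E: "E \<subseteq> mspace Z" "rectifiable1 (submetric Z E)" "0 < hausdorff1 Z E"
  obtain B :: "nat \<Rightarrow> real set" and f where "(\<forall>i. B i \<in> sets borel \<and>
        Lipschitz_continuous_map (submetric euclidean_metric (B i)) (submetric Z E) (f i)) \<and>
      hausdorff1 (submetric Z E) (mspace (submetric Z E) - (\<Union>i. f i ` B i)) = 0"
    using E(2) unfolding rectifiable1_def by (elim exE) (rule that, assumption)
  then have Bf: "\<And>i. B i \<in> sets borel"
      "\<And>i. Lipschitz_continuous_map (submetric euclidean_metric (B i)) (submetric Z E) (f i)"
    and rest: "hausdorff1 (submetric Z E) (mspace (submetric Z E) - (\<Union>i. f i ` B i)) = 0"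
    by simp_all
  define S where "S n = (case n of 0 \<Rightarrow> E - (\<Union>i. f i ` B i) | Suc i \<Rightarrow> f i ` B i)" for n
  have "hausdorff1 Z (S n) = 0" for n
  proof (cases n)
    case 0
    have "mspace (submetric Z E) = E" using E(1) by auto
    then show ?thesis using hausdorff1_null_submetric[OF rest] by (simp add: S_def 0)
  next
    case (Suc i)
    have "Lipschitz_continuous_map (submetric euclidean_metric (B i)) Z (f i)"
      using Bf(2)[of i] by (simp add: Lipschitz_continuous_map_into_submetric)
    from chain_ineq_Lipschitz_image_null[OF p c Z Bf(1) this] show ?thesis by (simp add: S_def Suc)
  qed
  then have "hausdorff1 Z (\<Union>n. S n) = 0" by (rule hausdorff1_null_UN)
  moreover have "E \<subseteq> (\<Union>n. S n)"
  proof
    fix x assume "x \<in> E"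
    show "x \<in> (\<Union>n. S n)"
    proof (cases "x \<in> (\<Union>i. f i ` B i)")
      case True
      then obtain i where "x \<in> S (Suc i)" by (auto simp: S_def)
      then show ?thesis by blast
    next
      case False
      then have "x \<in> S 0" using \<open>x \<in> E\<close> by (simp add: S_def)
      then show ?thesis by blast
    qed
  qed
  ultimately have "hausdorff1 Z E = 0" by (rule hausdorff1_null_mono)
  then show False using E(3) by simp
qed

context isometric_segment
begin

text \<open>The part of \<open>[0,1]\<close> mapped into a covering set lies in an interval whose length is at most the diameter of
  that set, so the diameters of a cover add up to at least \<open>1\<close>.\<close>

lemma segment_hausdorff1_pos:
  shows "0 < hausdorff1 Z (\<gamma> ` {0..1})"
proof (rule ccontr)
  assume "\<not> 0 < hausdorff1 Z (\<gamma> ` {0..1})"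
  then have null: "hausdorff1 Z (\<gamma> ` {0..1}) = 0" by simp
  obtain A where "(\<forall>i::nat. A i \<subseteq> mspace Z) \<and> \<gamma> ` {0..1} \<subseteq> (\<Union>i. A i) \<and>
      (\<Sum>i. mdiam Z (A i)) \<le> ennreal (1/2)"
    using null[unfolded hausdorff1_null_iff, THEN spec, of "1/2"] by (elim impE exE) simp
  then have A: "\<gamma> ` {0..1} \<subseteq> (\<Union>i. A i)" "(\<Sum>i. mdiam Z (A i)) \<le> ennreal (1/2)"
    by simp_all
  define P where "P i = {t \<in> {0..1}. \<gamma> t \<in> A i}" for i
  have "\<exists>J. P i \<subseteq> J \<and> J \<in> sets lborel \<and> emeasure lborel J \<le> mdiam Z (A i)" for i
  proof (cases "P i = {}")
    case True
    then show ?thesis by (intro exI[of _ "{}"]) auto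
  next
    case False
    have bdd: "bdd_below (P i)" "bdd_above (P i)"
      by (auto simp: P_def intro!: bdd_belowI[of _ 0] bdd_aboveI[of _ 1])
    have PJ: "P i \<subseteq> {Inf (P i)..Sup (P i)}" using bdd by (auto intro: cInf_lower cSup_upper)
    have le: "Inf (P i) \<le> Sup (P i)" by (rule cInf_le_cSup[OF False bdd(2,1)])
    have "ennreal (Sup (P i) - Inf (P i)) \<le> mdiam Z (A i)"
    proof (rule ennreal_le_epsilon)
      fix e :: real assume e: "0 < e" 
      obtain s where s: "s \<in> P i" "s < Inf (P i) + e / 2"
        using cInf_less_iff[OF False bdd(1), of "Inf (P i) + e / 2"] e by auto
      obtain t where t: "t \<in> P i" "Sup (P i) - e / 2 < t"
        using less_cSup_iff[OF False bdd(2), of "Sup (P i) - e / 2"] e by auto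
      have "ennreal (mdist Z (\<gamma> s) (\<gamma> t)) \<le> mdiam Z (A i)"
        unfolding mdiam_def using s t by (intro SUP_upper2[of "\<gamma> s"] SUP_upper2[of "\<gamma> t"]) (auto simp: P_def)
      moreover have "Sup (P i) - Inf (P i) \<le> mdist Z (\<gamma> s) (\<gamma> t) + e"
        using s t iso[of s t] by (auto simp: P_def)
      then have "ennreal (Sup (P i) - Inf (P i)) \<le> ennreal (mdist Z (\<gamma> s) (\<gamma> t)) + ennreal e"
        using e by (metis ennreal_leI ennreal_plus less_imp_le mdist_nonneg)
      ultimately show "ennreal (Sup (P i) - Inf (P i)) \<le> mdiam Z (A i) + ennreal e"
        by (meson add_right_mono order.trans)
    qed
    then show ?thesis using PJ le by (intro exI[of _ "{Inf (P i)..Sup (P i)}"]) simp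
  qed
  then obtain J where J: "\<And>i. P i \<subseteq> J i" "\<And>i. J i \<in> sets lborel" "\<And>i. emeasure lborel (J i) \<le> mdiam Z (A i)"
    by metis
  have "{0..1} \<subseteq> (\<Union>i. P i)" using A(1) by (fastforce simp: P_def)
  also have "\<dots> \<subseteq> (\<Union>i. J i)" using J(1) by blast
  finally have "emeasure lborel {0..1::real} \<le> emeasure lborel (\<Union>i. J i)"
    by (intro emeasure_mono sets.countable_UN) (use J(2) in auto)
  also have "\<dots> \<le> (\<Sum>i. emeasure lborel (J i))"
    by (rule emeasure_subadditive_countably) (use J(2) in auto)
  also have "\<dots> \<le> (\<Sum>i. mdiam Z (A i))" by (intro suminf_le J summableI)
  also have "\<dots> \<le> ennreal (1/2)" by (rule A(2))
  finally have "ennreal 1 \<le> ennreal (1/2)" by simp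
  then have "1 \<le> (1 / 2 :: real)" by (subst (asm) ennreal_le_iff) simp_all
  then show False by simp
qed

lemma segment_not_purely_unrectifiable:
  shows "\<not> purely_unrectifiable1 Z"
proof -
  let ?E = "\<gamma> ` {0..1}"
  have lip: "Lipschitz_continuous_map (submetric euclidean_metric {0..1}) (submetric Z ?E) \<gamma>"
    unfolding Lipschitz_continuous_map_def
    by (intro conjI exI[of _ 1]) (auto simp: dist_real_def iso in_space)
  have null: "hausdorff1 (submetric Z ?E) {} = 0"
    unfolding hausdorff1_null_iff by (intro allI impI exI[of _ "\<lambda>_. {}"]) (auto simp: mdiam_def bot_ennreal)
  have rest: "mspace (submetric Z ?E) - (\<Union>i::nat. ?E) = {}" by auto
  have "rectifiable1 (submetric Z ?E)"
    unfolding rectifiable1_def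
  proof (intro exI conjI allI)
    show "hausdorff1 (submetric Z ?E) (mspace (submetric Z ?E) - (\<Union>i::nat. ?E)) = 0"
      by (simp only: rest null)
  qed (rule lip | simp)+
  moreover have "?E \<subseteq> mspace Z" using in_space by blast
  moreover have "0 < hausdorff1 Z ?E" by (rule segment_hausdorff1_pos)
  ultimately have "\<exists>E\<subseteq>mspace Z. rectifiable1 (submetric Z E) \<and> 0 < hausdorff1 Z E"
    by (intro exI[of _ ?E] conjI)
  then show ?thesis unfolding purely_unrectifiable1_def by (simp only: not_not)
qed

end

section \<open>Metric currents under the chain inequality\<close>

lemma Lip_iff:
  "f \<in> Lip X \<longleftrightarrow> (\<exists>K\<ge>0. \<forall>x\<in>mspace X. \<forall>y\<in>mspace X. \<bar>f x - f y\<bar> \<le> K * mdist X x y)"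
proof
  assume "f \<in> Lip X"
  then obtain K where "K > 0" "\<forall>x\<in>mspace X. \<forall>y\<in>mspace X. mdist euclidean_metric (f x) (f y) \<le> K * mdist X x y"
    unfolding Lip_def Lipschitz_continuous_map_pos by auto
  then show "\<exists>K\<ge>0. \<forall>x\<in>mspace X. \<forall>y\<in>mspace X. \<bar>f x - f y\<bar> \<le> K * mdist X x y"
    by (intro exI[of _ K]) (simp add: dist_real_def)
next
  assume "\<exists>K\<ge>0. \<forall>x\<in>mspace X. \<forall>y\<in>mspace X. \<bar>f x - f y\<bar> \<le> K * mdist X x y"
  then obtain K where "\<forall>x\<in>mspace X. \<forall>y\<in>mspace X. \<bar>f x - f y\<bar> \<le> K * mdist X x y" by blast
  then show "f \<in> Lip X"
    unfolding Lip_def Lipschitz_continuous_map_def mem_Collect_eq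
    by (intro conjI exI[of _ K]) (simp_all add: dist_real_def)
qed

lemma LipI:
  "0 \<le> K \<Longrightarrow> (\<And>x y. x \<in> mspace X \<Longrightarrow> y \<in> mspace X \<Longrightarrow> \<bar>f x - f y\<bar> \<le> K * mdist X x y) \<Longrightarrow> f \<in> Lip X"
  unfolding Lip_iff by blast

lemma LipE:
  assumes "f \<in> Lip X"
  obtains K where "0 < K" "\<And>x y. x \<in> mspace X \<Longrightarrow> y \<in> mspace X \<Longrightarrow> \<bar>f x - f y\<bar> \<le> K * mdist X x y"
proof -
  obtain K where K: "0 \<le> K" "\<forall>x\<in>mspace X. \<forall>y\<in>mspace X. \<bar>f x - f y\<bar> \<le> K * mdist X x y"
    using assms unfolding Lip_iff by blast
  show thesis
  proof (rule that[of "K + 1"])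
    fix x y assume "x \<in> mspace X" "y \<in> mspace X"
    then have "\<bar>f x - f y\<bar> \<le> K * mdist X x y" using K(2) by blast
    also have "\<dots> \<le> (K + 1) * mdist X x y" by (intro mult_right_mono) auto
    finally show "\<bar>f x - f y\<bar> \<le> (K + 1) * mdist X x y" .
  qed (use K(1) in simp)
qed

lemma LIP_nonneg: "f \<in> Lip X \<Longrightarrow> 0 \<le> LIP X f"
  unfolding LIP_def Lip_iff by (intro cInf_greatest) auto

lemma LIP_le:
  "0 \<le> K \<Longrightarrow> (\<And>x y. x \<in> mspace X \<Longrightarrow> y \<in> mspace X \<Longrightarrow> \<bar>f x - f y\<bar> \<le> K * mdist X x y) \<Longrightarrow> LIP X f \<le> K"
  unfolding LIP_def by (rule cInf_lower) (auto intro!: bdd_belowI[of _ 0])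

text \<open>The infimum defining \<open>LIP\<close> is attained: for a fixed pair of points the inequality can be divided by their distance.\<close>

lemma Lip_bound:
  assumes f: "f \<in> Lip X" and x: "x \<in> mspace X" and y: "y \<in> mspace X"
  shows "\<bar>f x - f y\<bar> \<le> LIP X f * mdist X x y"
proof (cases "x = y")
  case False
  then have d: "0 < mdist X x y" using x y by (simp add: order_less_le)
  have "\<bar>f x - f y\<bar> / mdist X x y \<le> LIP X f"
    unfolding LIP_def
  proof (rule cInf_greatest)
    show "{L. 0 \<le> L \<and> (\<forall>x\<in>mspace X. \<forall>y\<in>mspace X. \<bar>f x - f y\<bar> \<le> L * mdist X x y)} \<noteq> {}"
      using f unfolding Lip_iff by blast
    fix L assume "L \<in> {L. 0 \<le> L \<and> (\<forall>x\<in>mspace X. \<forall>y\<in>mspace X. \<bar>f x - f y\<bar> \<le> L * mdist X x y)}"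
    then have "\<bar>f x - f y\<bar> \<le> L * mdist X x y" using x y by blast
    then show "\<bar>f x - f y\<bar> / mdist X x y \<le> L" using d by (simp add: pos_divide_le_eq)
  qed
  then show ?thesis using d by (simp add: pos_divide_le_eq)
qed (use x in simp)

lemma Lip_bD:
  assumes "f \<in> Lip_b X"
  obtains S where "0 \<le> S" "\<And>x. x \<in> mspace X \<Longrightarrow> \<bar>f x\<bar> \<le> S"
proof -
  obtain S where S: "\<forall>x\<in>f ` mspace X. norm x \<le> S"
    using assms unfolding Lip_b_def bounded_iff by blast
  show thesis
  proof (rule that[of "max 0 S"])
    fix x assume "x \<in> mspace X"
    then show "\<bar>f x\<bar> \<le> max 0 S" using S by fastforce
  qed simp
qed

lemma Lip_bI:
  assumes "f \<in> Lip X" "\<And>x. x \<in> mspace X \<Longrightarrow> \<bar>f x\<bar> \<le> S"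
  shows "f \<in> Lip_b X"
  using assms unfolding Lip_b_def bounded_iff by auto

lemma Lip_lincomb:
  assumes "f \<in> Lip X" "g \<in> Lip X"
  shows "(\<lambda>x. a * f x + b * g x) \<in> Lip X"
proof -
  obtain K where K: "0 < K" "\<And>x y. x \<in> mspace X \<Longrightarrow> y \<in> mspace X \<Longrightarrow> \<bar>f x - f y\<bar> \<le> K * mdist X x y"
    using LipE[OF assms(1)] by metis
  obtain M where M: "0 < M" "\<And>x y. x \<in> mspace X \<Longrightarrow> y \<in> mspace X \<Longrightarrow> \<bar>g x - g y\<bar> \<le> M * mdist X x y"
    using LipE[OF assms(2)] by metis
  show ?thesis
  proof (rule LipI[of "\<bar>a\<bar> * K + \<bar>b\<bar> * M"])
    fix x y assume xy: "x \<in> mspace X" "y \<in> mspace X"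
    have "\<bar>(a * f x + b * g x) - (a * f y + b * g y)\<bar> = \<bar>a * (f x - f y) + b * (g x - g y)\<bar>"
      by (simp add: algebra_simps)
    also have "\<dots> \<le> \<bar>a\<bar> * \<bar>f x - f y\<bar> + \<bar>b\<bar> * \<bar>g x - g y\<bar>"
      by (rule order.trans[OF abs_triangle_ineq]) (simp add: abs_mult)
    also have "\<dots> \<le> \<bar>a\<bar> * (K * mdist X x y) + \<bar>b\<bar> * (M * mdist X x y)"
      by (intro add_mono mult_left_mono K(2) M(2) xy) auto
    finally show "\<bar>(a * f x + b * g x) - (a * f y + b * g y)\<bar> \<le> (\<bar>a\<bar> * K + \<bar>b\<bar> * M) * mdist X x y"
      by (simp add: algebra_simps)
  qed (use K M in simp)
qed

lemma Lip_abs: "f \<in> Lip X \<Longrightarrow> (\<lambda>x. \<bar>f x\<bar>) \<in> Lip X"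
  unfolding Lip_iff by (meson abs_triangle_ineq3 order.trans)

lemma Lip_b_mult:
  assumes f: "f \<in> Lip_b X" and g: "g \<in> Lip_b X"
  shows "(\<lambda>x. f x * g x) \<in> Lip_b X"
proof -
  obtain K where K: "0 < K" "\<And>x y. x \<in> mspace X \<Longrightarrow> y \<in> mspace X \<Longrightarrow> \<bar>f x - f y\<bar> \<le> K * mdist X x y"
    using LipE[of f X] f unfolding Lip_b_def by blast
  obtain M where M: "0 < M" "\<And>x y. x \<in> mspace X \<Longrightarrow> y \<in> mspace X \<Longrightarrow> \<bar>g x - g y\<bar> \<le> M * mdist X x y"
    using LipE[of g X] g unfolding Lip_b_def by blast
  obtain S where S: "0 \<le> S" "\<And>x. x \<in> mspace X \<Longrightarrow> \<bar>f x\<bar> \<le> S" using Lip_bD[OF f] by metis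
  obtain R where R: "0 \<le> R" "\<And>x. x \<in> mspace X \<Longrightarrow> \<bar>g x\<bar> \<le> R" using Lip_bD[OF g] by metis
  show ?thesis
  proof (rule Lip_bI[where S = "S * R"])
    show "(\<lambda>x. f x * g x) \<in> Lip X"
    proof (rule LipI[of "K * R + S * M"])
      fix x y assume xy: "x \<in> mspace X" "y \<in> mspace X"
      have "\<bar>f x * g x - f y * g y\<bar> = \<bar>(f x - f y) * g x + f y * (g x - g y)\<bar>"
        by (simp add: algebra_simps)
      also have "\<dots> \<le> \<bar>f x - f y\<bar> * \<bar>g x\<bar> + \<bar>f y\<bar> * \<bar>g x - g y\<bar>"
        by (rule order.trans[OF abs_triangle_ineq]) (simp add: abs_mult)
      also have "\<dots> \<le> (K * mdist X x y) * R + S * (M * mdist X x y)"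
        using K M S R xy by (intro add_mono mult_mono) auto
      finally show "\<bar>f x * g x - f y * g y\<bar> \<le> (K * R + S * M) * mdist X x y"
        by (simp add: algebra_simps)
    qed (use K M S R in simp)
    show "\<bar>f x * g x\<bar> \<le> S * R" if "x \<in> mspace X" for x
      unfolding abs_mult using S R that by (intro mult_mono) auto
  qed
qed

text \<open>Both the McShane extension and the flat approximation of Lipschitz functions are infimal convolutions
  \<open>x \<mapsto> inf\<^sub>u (h u + q x u)\<close>; they inherit the modulus of continuity of the cost \<open>q\<close>.\<close>

lemma inf_convolution_le:
  fixes h :: "'b \<Rightarrow> real"
  assumes "A \<noteq> {}" "bdd_below ((\<lambda>u. h u + q x u) ` A)" "\<And>u. u \<in> A \<Longrightarrow> q x u \<le> e + q y u"
  shows "(INF u\<in>A. h u + q x u) \<le> e + (INF u\<in>A. h u + q y u)"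
proof -
  have "(INF u\<in>A. h u + q x u) - e \<le> (INF u\<in>A. h u + q y u)"
  proof (rule cINF_greatest[OF assms(1)])
    fix u assume u: "u \<in> A"
    have "(INF u\<in>A. h u + q x u) \<le> h u + q x u" by (rule cINF_lower[OF assms(2) u])
    then show "(INF u\<in>A. h u + q x u) - e \<le> h u + q y u" using assms(3)[OF u] by linarith
  qed
  then show ?thesis by linarith
qed

text \<open>Extend by \<open>h x = inf\<^sub>u (g u + K * d x u)\<close>, with \<open>u\<close> ranging over \<open>A\<close>.\<close>

lemma McShane_extension:
  assumes A: "A \<subseteq> mspace X" and K: "0 \<le> K"
    and g: "\<And>x y. x \<in> A \<Longrightarrow> y \<in> A \<Longrightarrow> \<bar>g x - g y\<bar> \<le> K * mdist X x y"
  obtains h :: "'a \<Rightarrow> real" where "\<And>x. x \<in> A \<Longrightarrow> h x = g x"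
    "\<And>x y. x \<in> mspace X \<Longrightarrow> y \<in> mspace X \<Longrightarrow> \<bar>h x - h y\<bar> \<le> K * mdist X x y"
proof (cases "A = {}")
  case True
  show thesis by (rule that[of "\<lambda>_. 0"]) (use K True in auto)
next
  case False
  then obtain a where a: "a \<in> A" by blast
  define h where "h x = (INF u\<in>A. g u + K * mdist X x u)" for x
  have tri: "K * mdist X x u \<le> K * mdist X x y + K * mdist X y u"
    if "x \<in> mspace X" "y \<in> mspace X" "u \<in> A" for x y u
    unfolding distrib_left[symmetric] using that A K by (intro mult_left_mono mdist_triangle) auto
  have bdd: "bdd_below ((\<lambda>u. g u + K * mdist X x u) ` A)" if x: "x \<in> mspace X" for x
  proof (rule bdd_belowI2)
    fix u assume u: "u \<in> A"
    then show "g a - K * mdist X a x \<le> g u + K * mdist X x u"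
      using g[OF a u] tri[of a x u] x a A by (auto simp: abs_le_iff)
  qed
  show thesis
  proof (rule that)
    fix x assume x: "x \<in> A"
    then have xX: "x \<in> mspace X" using A by blast
    show "h x = g x"
    proof (rule antisym)
      show "h x \<le> g x"
        unfolding h_def using cINF_lower[OF bdd[OF xX] x] xX by simp
      show "g x \<le> h x"
        unfolding h_def
      proof (rule cINF_greatest[OF False])
        fix u assume "u \<in> A"
        then show "g x \<le> g u + K * mdist X x u" using g[OF x] by (fastforce simp: abs_le_iff)
      qed
    qed
  next
    have *: "h x \<le> K * mdist X x y + h y" if "x \<in> mspace X" "y \<in> mspace X" for x y
      unfolding h_def
      by (rule inf_convolution_le[where q = "\<lambda>x u. K * mdist X x u" and h = g, OF False])
         (use that bdd tri in auto)
    fix x y assume "x \<in> mspace X" "y \<in> mspace X"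
    then show "\<bar>h x - h y\<bar> \<le> K * mdist X x y"
      using *[of x y] *[of y x] mdist_commute[of X x y] by (simp add: abs_le_iff)
  qed
qed

text \<open>Infimal convolution of \<open>\<pi>\<close> with a large multiple \<open>w\<close> of the chain metric \<open>\<rho>\<close>. Since \<open>w * \<rho> \<ge> w * c * d\<^sup>p\<close>
  dominates \<open>L * d\<close> beyond distance \<open>r\<close>, for the value of \<open>w\<close> used here, points farther than \<open>r\<close> cannot lower the infimum; hence it
  stays within \<open>L * r\<close> of \<open>\<pi>\<close>. It oscillates at most like \<open>w * \<rho> \<le> w * d\<^sup>p\<close>. Up to distance \<open>r\<close> this is at most
  \<open>L/c * d\<close>, and beyond it the closeness to \<open>\<pi>\<close> gives \<open>2 * L * d\<close>, so the Lipschitz constant is bounded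
  independently of \<open>r\<close>.\<close>

lemma chain_ineq_flat_approximation:
  fixes Z :: "'a metric"
  assumes p: "1 < p" and c: "0 < c" and Z: "chain_ineq Z p c" and L: "0 < L" and r: "0 < r"
    and \<pi>: "\<And>x y. x \<in> mspace Z \<Longrightarrow> y \<in> mspace Z \<Longrightarrow> \<bar>\<pi> x - \<pi> y\<bar> \<le> L * mdist Z x y"
  obtains g :: "'a \<Rightarrow> real" and w where "0 \<le> w" "\<And>x. x \<in> mspace Z \<Longrightarrow> \<bar>g x - \<pi> x\<bar> \<le> L * r"
    "\<And>x y. x \<in> mspace Z \<Longrightarrow> y \<in> mspace Z \<Longrightarrow> \<bar>g x - g y\<bar> \<le> w * mdist Z x y powr p"
    "\<And>x y. x \<in> mspace Z \<Longrightarrow> y \<in> mspace Z \<Longrightarrow> \<bar>g x - g y\<bar> \<le> (2 * L + L / c) * mdist Z x y"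
proof -
  define w where "w = L / (c * r powr (p - 1))"
  have w: "0 < w" using L c r by (simp add: w_def)
  have wr: "w * r powr (p - 1) = L / c" using r by (simp add: w_def)
  let ?M = "mspace Z"
  let ?\<rho> = "chain_dist Z p"
  define g where "g x = (INF u\<in>?M. \<pi> u + w * ?\<rho> x u)" for x
  have pow: "d powr p = d powr (p - 1) * d" if "0 \<le> d" for d :: real
    using powr_add[of d "p - 1" 1] that by simp
  have lower: "\<pi> x - L * r \<le> \<pi> u + w * ?\<rho> x u" if xu: "x \<in> ?M" "u \<in> ?M" for x u
  proof -
    let ?d = "mdist Z x u"
    have \<rho>: "0 \<le> w * ?\<rho> x u" using w chain_dist_nonneg[OF xu, of p] by simp
    show ?thesis
    proof (cases "?d \<le> r")
      case True
      then have "L * ?d \<le> L * r" using L by simp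
      then show ?thesis using \<pi>[OF xu] \<rho> by linarith
    next
      case False
      then have "r powr (p - 1) * ?d \<le> ?d powr p"
        using p r by (subst pow) (auto intro!: mult_right_mono powr_mono2)
      then have "w * (c * (r powr (p - 1) * ?d)) \<le> w * (c * ?d powr p)"
        using w c by simp
      also have "\<dots> \<le> w * ?\<rho> x u"
        using w chain_ineq_imp_chain_dist_ge[OF Z xu] by (intro mult_left_mono) auto
      finally have "c * (w * r powr (p - 1)) * ?d \<le> w * ?\<rho> x u" by (simp add: mult_ac)
      then have "L * ?d \<le> w * ?\<rho> x u" using c by (simp add: wr)
      moreover have "0 \<le> L * r" using L r by simp
      ultimately show ?thesis using \<pi>[OF xu] by linarith
    qed
  qed
  have bdd: "bdd_below ((\<lambda>u. \<pi> u + w * ?\<rho> x u) ` ?M)" if "x \<in> ?M" for x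
    by (rule bdd_belowI2) (rule lower[OF that])
  have g_lower: "\<pi> x - L * r \<le> g x" if x: "x \<in> ?M" for x
    unfolding g_def by (rule cINF_greatest) (use x lower[OF x] in auto)
  have g_upper: "g x \<le> \<pi> x" if x: "x \<in> ?M" for x
  proof -
    have "?\<rho> x x \<le> 0" using chain_dist_le_powr[OF x x, of p] x p by simp
    then have "w * ?\<rho> x x \<le> 0" using w by (simp add: mult_nonneg_nonpos)
    moreover have "g x \<le> \<pi> x + w * ?\<rho> x x"
      unfolding g_def by (rule cINF_lower[OF bdd[OF x] x])
    ultimately show ?thesis by linarith
  qed
  have g_diff: "g x \<le> w * mdist Z x y powr p + g y" if xy: "x \<in> ?M" "y \<in> ?M" for x y
    unfolding g_def
  proof (rule inf_convolution_le[where q = "\<lambda>x u. w * ?\<rho> x u" and h = \<pi>, OF _ bdd[OF xy(1)]])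
    fix u assume u: "u \<in> ?M"
    have "?\<rho> x u \<le> mdist Z x y powr p + ?\<rho> y u"
      using chain_dist_triangle[OF xy u, of p] chain_dist_le_powr[OF xy, of p] by linarith
    then have "w * ?\<rho> x u \<le> w * (mdist Z x y powr p + ?\<rho> y u)" using w by simp
    then show "w * ?\<rho> x u \<le> w * mdist Z x y powr p + w * ?\<rho> y u" by (simp add: distrib_left)
  qed (use xy in blast)
  have flat: "\<bar>g x - g y\<bar> \<le> w * mdist Z x y powr p" if "x \<in> ?M" "y \<in> ?M" for x y
    using g_diff[OF that] g_diff[OF that(2,1)] by (simp add: mdist_commute abs_le_iff)
  have lip: "\<bar>g x - g y\<bar> \<le> (2 * L + L / c) * mdist Z x y" if xy: "x \<in> ?M" "y \<in> ?M" for x y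
  proof -
    let ?d = "mdist Z x y"
    have split: "(2 * L + L / c) * ?d = L * ?d + L * ?d + L / c * ?d" by (simp add: algebra_simps)
    have nonneg: "0 \<le> L * ?d" "0 \<le> L / c * ?d" using L c by simp_all
    show ?thesis
    proof (cases "?d \<le> r")
      case True
      have "w * ?d powr p = w * ?d powr (p - 1) * ?d" by (simp add: pow)
      also have "\<dots> \<le> w * r powr (p - 1) * ?d"
        using True w p by (intro mult_right_mono mult_left_mono powr_mono2) auto
      finally show ?thesis using flat[OF xy] nonneg unfolding split wr by linarith
    next
      case False
      then have "L * r \<le> L * ?d" using L by simp
      then show ?thesis
        using \<pi>[OF xy] g_lower[OF xy(1)] g_lower[OF xy(2)] g_upper[OF xy(1)] g_upper[OF xy(2)] nonneg
        unfolding split abs_le_iff by linarith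
    qed
  qed
  have near: "\<bar>g x - \<pi> x\<bar> \<le> L * r" if "x \<in> ?M" for x
    using g_lower[OF that] g_upper[OF that] L r by (simp add: abs_le_iff)
  show thesis by (rule that[of w g]) (use w near flat lip in auto)
qed

lemma current_lincomb_left:
  assumes "T \<in> metric_currents1 X" "f \<in> Lip_b X" "g \<in> Lip_b X" "\<pi> \<in> Lip X"
  shows "T (\<lambda>x. a * f x + b * g x) \<pi> = a * T f \<pi> + b * T g \<pi>"
  using assms(1)[unfolded metric_currents1_def mem_Collect_eq, THEN conjunct1, rule_format, OF assms(2-4)] .

lemma current_lincomb_right:
  assumes "T \<in> metric_currents1 X" "f \<in> Lip_b X" "\<pi> \<in> Lip X" "\<rho> \<in> Lip X"
  shows "T f (\<lambda>x. a * \<pi> x + b * \<rho> x) = a * T f \<pi> + b * T f \<rho>"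
  using assms(1)[unfolded metric_currents1_def mem_Collect_eq, THEN conjunct2, THEN conjunct1, rule_format, OF assms(2-4)] .

lemma current_local:
  assumes "T \<in> metric_currents1 X" "f \<in> Lip_b X" "\<pi> \<in> Lip X" "openin (mtopology_of X) U"
    "{x \<in> mspace X. f x \<noteq> 0} \<subseteq> U" "\<And>x. x \<in> U \<Longrightarrow> \<pi> x = c"
  shows "T f \<pi> = 0"
  by (rule assms(1)[unfolded metric_currents1_def mem_Collect_eq, THEN conjunct2, THEN conjunct2,
        THEN conjunct1, rule_format, OF assms(2,3)])
     (intro exI[of _ U] exI[of _ c] conjI ballI assms(4-6))

lemma current_continuous:
  fixes \<pi>n :: "nat \<Rightarrow> 'a \<Rightarrow> real"
  assumes T: "T \<in> metric_currents1 X" and f: "f \<in> Lip_b X" and \<pi>: "\<pi> \<in> Lip X" and K: "0 \<le> K"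
    and \<pi>n: "\<And>n x y. x \<in> mspace X \<Longrightarrow> y \<in> mspace X \<Longrightarrow> \<bar>\<pi>n n x - \<pi>n n y\<bar> \<le> K * mdist X x y"
    and lim: "\<And>x. x \<in> mspace X \<Longrightarrow> (\<lambda>n. \<pi>n n x) \<longlonglongrightarrow> \<pi> x"
  shows "(\<lambda>n. T f (\<pi>n n)) \<longlonglongrightarrow> T f \<pi>"
proof (rule T[unfolded metric_currents1_def mem_Collect_eq, THEN conjunct2, THEN conjunct2,
      THEN conjunct2, THEN conjunct1, rule_format, OF f \<pi>], intro conjI allI ballI)
  show "\<pi>n n \<in> Lip X" for n by (rule LipI[OF K]) (rule \<pi>n)
  have "LIP X (\<pi>n n) \<le> K" for n by (rule LIP_le[OF K]) (rule \<pi>n)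
  then show "bdd_above (range (\<lambda>n. LIP X (\<pi>n n)))" by (intro bdd_aboveI2)
qed (rule lim)

lemma Lip_borel_measurable:
  assumes f: "f \<in> Lip X" and \<mu>: "borel_measure_on X \<mu>"
  shows "f \<in> borel_measurable \<mu>"
proof (rule borel_measurableI)
  fix S :: "real set" assume "open S"
  have sp: "space \<mu> = mspace X" and se: "sets \<mu> = sigma_sets (mspace X) {U. openin (mtopology_of X) U}"
    using \<mu> unfolding borel_measure_on_def by blast+
  have "continuous_map (mtopology_of X) euclidean f"
    using f Lipschitz_continuous_imp_continuous_map[of X euclidean_metric f] by (simp add: Lip_def)
  then have "openin (mtopology_of X) {x \<in> topspace (mtopology_of X). f x \<in> S}"
    by (rule openin_continuous_map_preimage) (simp add: \<open>open S\<close>)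
  moreover have "f -` S \<inter> space \<mu> = {x \<in> topspace (mtopology_of X). f x \<in> S}" by (auto simp: sp)
  ultimately have "f -` S \<inter> space \<mu> \<in> {U. openin (mtopology_of X) U}" by simp
  then show "f -` S \<inter> space \<mu> \<in> sets \<mu>"
    unfolding se by (rule sigma_sets.Basic)
qed

lemma Lip_b_integrable:
  assumes f: "f \<in> Lip_b X" and \<mu>: "borel_measure_on X \<mu>" and fin: "finite_measure \<mu>"
  shows "integrable \<mu> (\<lambda>x. \<bar>f x\<bar>)"
proof -
  obtain S where S: "0 \<le> S" "\<And>x. x \<in> mspace X \<Longrightarrow> \<bar>f x\<bar> \<le> S" using Lip_bD[OF f] by metis
  have sp: "space \<mu> = mspace X" using \<mu> unfolding borel_measure_on_def by blast
  have "f \<in> borel_measurable \<mu>" using f \<mu> by (intro Lip_borel_measurable) (auto simp: Lip_b_def)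
  then show ?thesis
    by (intro finite_measure.integrable_const_bound[OF fin, where B = S]) (use S sp in auto)
qed

text \<open>By locality \<open>T f \<pi>\<close> depends only on \<open>\<pi>\<close> near the set where \<open>f \<noteq> 0\<close>, so \<open>\<pi>\<close> may be replaced by the McShane
  extension of its restriction to \<open>U\<close>, which has a better Lipschitz constant.\<close>

lemma current_bound_of_local_Lipschitz:
  assumes T: "T \<in> metric_currents1 X" and \<mu>: "mass_bound X T \<mu>" and f: "f \<in> Lip_b X" and \<pi>: "\<pi> \<in> Lip X"
    and U: "openin (mtopology_of X) U" "{x \<in> mspace X. f x \<noteq> 0} \<subseteq> U" and K: "0 \<le> K"
    and \<pi>K: "\<And>x y. x \<in> U \<Longrightarrow> y \<in> U \<Longrightarrow> \<bar>\<pi> x - \<pi> y\<bar> \<le> K * mdist X x y"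
  shows "\<bar>T f \<pi>\<bar> \<le> K * (\<integral>x. \<bar>f x\<bar> \<partial>\<mu>)"
proof -
  have "U \<subseteq> mspace X" using openin_subset[OF U(1)] by simp
  then obtain h :: "_ \<Rightarrow> real" where h: "\<And>x. x \<in> U \<Longrightarrow> h x = \<pi> x"
    "\<And>x y. x \<in> mspace X \<Longrightarrow> y \<in> mspace X \<Longrightarrow> \<bar>h x - h y\<bar> \<le> K * mdist X x y"
    using McShane_extension[of U X K \<pi>] K \<pi>K by metis
  have hL: "h \<in> Lip X" by (rule LipI[OF K h(2)])
  have "T f (\<lambda>x. 1 * \<pi> x + (- 1) * h x) = 0"
    by (rule current_local[OF T f Lip_lincomb[OF \<pi> hL] U, of 1 "-1" 0]) (simp add: h(1))
  then have "T f \<pi> = T f h"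
    using current_lincomb_right[OF T f \<pi> hL, of 1 "-1"] by simp
  also have "\<bar>T f h\<bar> \<le> LIP X h * (\<integral>x. \<bar>f x\<bar> \<partial>\<mu>)"
    using \<mu> f hL unfolding mass_bound_def by blast
  also have "\<dots> \<le> K * (\<integral>x. \<bar>f x\<bar> \<partial>\<mu>)"
    by (intro mult_right_mono LIP_le K h(2)) auto
  finally show ?thesis .
qed

text \<open>For each centre \<open>z\<close> in turn, split off \<open>f * \<psi>\<close> with a bump \<open>\<psi>\<close> that is \<open>1\<close> within \<open>\<delta>\<close> of \<open>z\<close> and \<open>0\<close> beyond
  \<open>2 * \<delta>\<close>. The part split off is controlled by the small Lipschitz constant \<open>K\<close> of \<open>g\<close> on the ball, and it
  uses up exactly its share of \<open>\<integral>\<bar>f\<bar> d\<mu>\<close>, so the number of balls does not enter the estimate.\<close>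

lemma current_peel_balls:
  assumes T: "T \<in> metric_currents1 X" and \<mu>: "mass_bound X T \<mu>" and g: "g \<in> Lip X"
    and \<delta>: "0 < \<delta>" and K: "0 \<le> K"
    and gK: "\<And>x y. x \<in> mspace X \<Longrightarrow> y \<in> mspace X \<Longrightarrow> mdist X x y < 4 * \<delta> \<Longrightarrow> \<bar>g x - g y\<bar> \<le> K * mdist X x y"
    and F: "finite F" "F \<subseteq> mspace X" and f: "f \<in> Lip_b X"
  shows "\<exists>f'\<in>Lip_b X. \<bar>T f g\<bar> \<le> K * ((\<integral>x. \<bar>f x\<bar> \<partial>\<mu>) - (\<integral>x. \<bar>f' x\<bar> \<partial>\<mu>)) + \<bar>T f' g\<bar> \<and>
    (\<forall>x\<in>mspace X. \<bar>f' x\<bar> \<le> \<bar>f x\<bar>) \<and> (\<forall>z\<in>F. \<forall>x\<in>mspace X. mdist X z x < \<delta> \<longrightarrow> f' x = 0)"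
  using F f
proof (induction F arbitrary: f rule: finite_induct)
  case empty
  then show ?case by (intro bexI[of _ f]) simp_all
next
  case (insert z F)
  have z: "z \<in> mspace X" and f: "f \<in> Lip_b X" using insert.prems by auto
  have \<mu>': "borel_measure_on X \<mu>" "finite_measure \<mu>" using \<mu> unfolding mass_bound_def by blast+
  have sp: "space \<mu> = mspace X" using \<mu>'(1) unfolding borel_measure_on_def by blast
  define \<psi> where "\<psi> x = max 0 (min 1 (2 - mdist X z x / \<delta>))" for x
  have \<psi>01: "0 \<le> \<psi> x" "\<psi> x \<le> 1" for x by (auto simp: \<psi>_def)
  have \<psi>L: "\<bar>\<psi> x - \<psi> y\<bar> \<le> 1 / \<delta> * mdist X x y" if "x \<in> mspace X" "y \<in> mspace X" for x y
  proof -
    have "\<bar>mdist X z x - mdist X z y\<bar> \<le> mdist X x y"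
      using mdist_triangle[OF z that] mdist_triangle[OF z that(2,1)] by (simp add: mdist_commute abs_le_iff)
    then have "\<bar>mdist X z x / \<delta> - mdist X z y / \<delta>\<bar> \<le> mdist X x y / \<delta>"
      unfolding diff_divide_distrib[symmetric] abs_divide using \<delta> by (simp add: divide_right_mono)
    moreover have "\<bar>\<psi> x - \<psi> y\<bar> \<le> \<bar>mdist X z x / \<delta> - mdist X z y / \<delta>\<bar>"
      unfolding \<psi>_def by linarith
    ultimately show ?thesis by simp
  qed
  have \<psi>b: "\<psi> \<in> Lip_b X"
    by (rule Lip_bI[where S = 1], rule LipI[of "1 / \<delta>"]) (use \<delta> \<psi>L \<psi>01 in auto)
  have one: "(\<lambda>_. 1) \<in> Lip_b X"
    by (rule Lip_bI[where S = 1], rule LipI[of 0]) auto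
  have \<psi>c: "(\<lambda>x. 1 - \<psi> x) \<in> Lip_b X"
  proof (rule Lip_bI[where S = 1])
    show "(\<lambda>x. 1 - \<psi> x) \<in> Lip X"
      using Lip_lincomb[of "\<lambda>_. 1" X \<psi> 1 "-1"] one \<psi>b unfolding Lip_b_def by simp
  qed (use \<psi>01 in simp)
  define f1 where "f1 x = f x * \<psi> x" for x
  define f2 where "f2 x = f x * (1 - \<psi> x)" for x
  have f1: "f1 \<in> Lip_b X" unfolding f1_def[abs_def] by (rule Lip_b_mult[OF f \<psi>b])
  have f2: "f2 \<in> Lip_b X" unfolding f2_def[abs_def] by (rule Lip_b_mult[OF f \<psi>c])
  have "(\<lambda>x. 1 * f1 x + 1 * f2 x) = f" by (rule ext) (simp add: f1_def f2_def algebra_simps)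
  then have Tf: "T f g = T f1 g + T f2 g"
    using current_lincomb_left[OF T f1 f2 g, of 1 1] by simp
  have abs2: "\<bar>f2 x\<bar> \<le> \<bar>f x\<bar>" for x
    using \<psi>01[of x] by (simp add: f2_def abs_mult mult_left_le)
  have "\<bar>f x\<bar> = \<bar>f1 x\<bar> + \<bar>f2 x\<bar>" for x
  proof -
    have "\<bar>f1 x\<bar> = \<bar>f x\<bar> * \<psi> x" "\<bar>f2 x\<bar> = \<bar>f x\<bar> * (1 - \<psi> x)"
      using \<psi>01[of x] by (simp_all add: f1_def f2_def abs_mult)
    then show ?thesis by (simp add: algebra_simps)
  qed
  then have int: "(\<integral>x. \<bar>f x\<bar> \<partial>\<mu>) = (\<integral>x. \<bar>f1 x\<bar> \<partial>\<mu>) + (\<integral>x. \<bar>f2 x\<bar> \<partial>\<mu>)"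
    using Lip_b_integrable[OF f1 \<mu>'] Lip_b_integrable[OF f2 \<mu>'] by simp
  have T1: "\<bar>T f1 g\<bar> \<le> K * (\<integral>x. \<bar>f1 x\<bar> \<partial>\<mu>)"
  proof (rule current_bound_of_local_Lipschitz[OF T \<mu> f1 g _ _ K])
    show "openin (mtopology_of X) (mball_of X z (2 * \<delta>))"
      by (simp add: mball_of_def mtopology_of_def Metric_space.openin_mball[OF Metric_space_mspace_mdist])
    show "{x \<in> mspace X. f1 x \<noteq> 0} \<subseteq> mball_of X z (2 * \<delta>)"
    proof
      fix x assume x: "x \<in> {x \<in> mspace X. f1 x \<noteq> 0}"
      then have "\<psi> x \<noteq> 0" by (auto simp: f1_def)
      then have "mdist X z x / \<delta> < 2" unfolding \<psi>_def by linarith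
      then show "x \<in> mball_of X z (2 * \<delta>)" using x z \<delta> by (simp add: pos_divide_less_eq)
    qed
    fix x y assume "x \<in> mball_of X z (2 * \<delta>)" "y \<in> mball_of X z (2 * \<delta>)"
    then have xy: "x \<in> mspace X" "y \<in> mspace X" "mdist X z x < 2 * \<delta>" "mdist X z y < 2 * \<delta>" by auto
    then have "mdist X x y < 4 * \<delta>"
      using mdist_triangle[OF xy(1) z xy(2)] mdist_commute[of X x z] by linarith
    then show "\<bar>g x - g y\<bar> \<le> K * mdist X x y" using gK xy by blast
  qed
  have "\<exists>f'\<in>Lip_b X. \<bar>T f2 g\<bar> \<le> K * ((\<integral>x. \<bar>f2 x\<bar> \<partial>\<mu>) - (\<integral>x. \<bar>f' x\<bar> \<partial>\<mu>)) + \<bar>T f' g\<bar> \<and>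
    (\<forall>x\<in>mspace X. \<bar>f' x\<bar> \<le> \<bar>f2 x\<bar>) \<and> (\<forall>z\<in>F. \<forall>x\<in>mspace X. mdist X z x < \<delta> \<longrightarrow> f' x = 0)"
    by (rule insert.IH) (use insert.prems f2 in auto)
  then obtain f' where f': "f' \<in> Lip_b X"
      "\<bar>T f2 g\<bar> \<le> K * ((\<integral>x. \<bar>f2 x\<bar> \<partial>\<mu>) - (\<integral>x. \<bar>f' x\<bar> \<partial>\<mu>)) + \<bar>T f' g\<bar>"
    and f'2: "\<And>x. x \<in> mspace X \<Longrightarrow> \<bar>f' x\<bar> \<le> \<bar>f2 x\<bar>"
    and f'0: "\<And>z x. z \<in> F \<Longrightarrow> x \<in> mspace X \<Longrightarrow> mdist X z x < \<delta> \<Longrightarrow> f' x = 0" by blast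
  show ?case
  proof (intro bexI[of _ f'] conjI ballI impI f'(1))
    have "\<bar>T f g\<bar> \<le> \<bar>T f1 g\<bar> + \<bar>T f2 g\<bar>" unfolding Tf by (rule abs_triangle_ineq)
    then show "\<bar>T f g\<bar> \<le> K * ((\<integral>x. \<bar>f x\<bar> \<partial>\<mu>) - (\<integral>x. \<bar>f' x\<bar> \<partial>\<mu>)) + \<bar>T f' g\<bar>"
      using T1 f'(2) unfolding int by (simp add: algebra_simps)
    show "\<bar>f' x\<bar> \<le> \<bar>f x\<bar>" if "x \<in> mspace X" for x using f'2[OF that] abs2[of x] by linarith
    fix w x assume w: "w \<in> insert z F" and x: "x \<in> mspace X" "mdist X w x < \<delta>"
    show "f' x = 0"
    proof (cases "w = z")
      case True
      then have "mdist X z x / \<delta> < 1" using x \<delta> by (simp add: pos_divide_less_eq)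
      then have "\<psi> x = 1" unfolding \<psi>_def by linarith
      then show ?thesis using f'2[OF x(1)] by (simp add: f2_def)
    next
      case False
      then show ?thesis using f'0[of w x] w x by blast
    qed
  qed
qed

lemma borel_measure_on_closedin:
  assumes \<mu>: "borel_measure_on X \<mu>" and K: "closedin (mtopology_of X) K"
  shows "K \<in> sets \<mu>"
proof -
  have se: "sets \<mu> = sigma_sets (mspace X) {U. openin (mtopology_of X) U}" and sp: "space \<mu> = mspace X"
    using \<mu> unfolding borel_measure_on_def by blast+
  have "mspace X - K \<in> sets \<mu>"
    unfolding se using K by (intro sigma_sets.Basic) (simp add: closedin_def)
  then have "space \<mu> - (mspace X - K) \<in> sets \<mu>" by (rule sets.compl_sets)
  moreover have "space \<mu> - (mspace X - K) = K" using closedin_subset[OF K] sp by auto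
  ultimately show ?thesis by simp
qed

lemma compactin_imp_closedin_mtopology_of:
  "compactin (mtopology_of X) K \<Longrightarrow> closedin (mtopology_of X) K"
  by (rule compactin_imp_closedin)
     (simp_all add: mtopology_of_def Metric_space.Hausdorff_space_mtopology[OF Metric_space_mspace_mdist])

lemma compactin_finite_net:
  assumes K: "compactin (mtopology_of X) K" and \<delta>: "0 < \<delta>"
  obtains F where "finite F" "F \<subseteq> mspace X" "\<And>x. x \<in> K \<Longrightarrow> \<exists>z\<in>F. mdist X z x < \<delta>"
proof -
  have KX: "K \<subseteq> mspace X" using compactin_subset_topspace[OF K] by simp
  have "openin (mtopology_of X) (mball_of X z \<delta>)" for z
    by (simp add: mball_of_def mtopology_of_def Metric_space.openin_mball[OF Metric_space_mspace_mdist])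
  moreover have "K \<subseteq> \<Union>((\<lambda>z. mball_of X z \<delta>) ` K)"
  proof
    fix x assume "x \<in> K"
    then have "x \<in> mball_of X x \<delta>" using KX \<delta> by auto
    then show "x \<in> \<Union>((\<lambda>z. mball_of X z \<delta>) ` K)" using \<open>x \<in> K\<close> by blast
  qed
  ultimately obtain \<F> where \<F>: "finite \<F>" "\<F> \<subseteq> (\<lambda>z. mball_of X z \<delta>) ` K" "K \<subseteq> \<Union>\<F>"
    using compactinD[OF K, of "(\<lambda>z. mball_of X z \<delta>) ` K"] by (metis (no_types, lifting) imageE)
  obtain F where F: "F \<subseteq> K" "finite F" "\<F> = (\<lambda>z. mball_of X z \<delta>) ` F"
    using finite_subset_image[OF \<F>(1,2)] by metis
  show thesis
  proof (rule that[OF F(2)])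
    show "F \<subseteq> mspace X" using F KX by blast
    fix x assume "x \<in> K"
    then obtain z where "z \<in> F" "x \<in> mball_of X z \<delta>" using \<F>(3) F(3) by blast
    then show "\<exists>z\<in>F. mdist X z x < \<delta>" unfolding in_mball_of by blast
  qed
qed

text \<open>At scale \<open>\<delta>\<close> the function \<open>g\<close> has Lipschitz constant at most \<open>w * (4 * \<delta>)\<^sup>p\<^sup>-\<^sup>1\<close>. Peeling off finitely many balls that
  cover a compact set \<open>K\<close> and letting \<open>\<delta>\<close> tend to \<open>0\<close> leaves only the contribution of the complement of
  \<open>K\<close>, and inner regularity makes its mass arbitrarily small.\<close>

lemma current_flat_zero:
  assumes T: "T \<in> metric_currents1 X" and \<mu>: "mass_bound X T \<mu>" and reg: "inner_regular_compact X \<mu>"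
    and f: "f \<in> Lip_b X" and g: "g \<in> Lip X" and p: "1 < p" and w: "0 \<le> w"
    and flat: "\<And>x y. x \<in> mspace X \<Longrightarrow> y \<in> mspace X \<Longrightarrow> \<bar>g x - g y\<bar> \<le> w * mdist X x y powr p"
  shows "T f g = 0"
proof -
  have \<mu>': "borel_measure_on X \<mu>" "finite_measure \<mu>" using \<mu> unfolding mass_bound_def by blast+
  interpret finite_measure \<mu> by (rule \<mu>')
  have sp: "space \<mu> = mspace X" using \<mu>'(1) unfolding borel_measure_on_def by blast
  obtain S where S: "0 \<le> S" "\<And>x. x \<in> mspace X \<Longrightarrow> \<bar>f x\<bar> \<le> S" using Lip_bD[OF f] by metis
  define I where "I = (\<integral>x. \<bar>f x\<bar> \<partial>\<mu>)"
  have I: "0 \<le> I" by (simp add: I_def)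
  have outside: "\<bar>T f g\<bar> \<le> LIP X g * (S * measure \<mu> (space \<mu> - K))"
    if K: "compactin (mtopology_of X) K" for K
  proof (rule field_le_epsilon)
    fix e :: real assume e: "0 < e"
    \<comment> \<open>Chosen so that \<open>w * \<eta>\<^sup>p\<^sup>-\<^sup>1 * I \<le> e\<close>.\<close>
    define \<eta> where "\<eta> = (e / (w * I + 1)) powr (1 / (p - 1))"
    have wI: "0 \<le> w * I" using w I by simp
    have \<eta>: "0 < \<eta>" using e wI by (simp add: \<eta>_def)
    have "\<eta> powr (p - 1) = e / (w * I + 1)" using p e wI by (simp add: \<eta>_def powr_powr)
    then have "(w * I + 1) * \<eta> powr (p - 1) = e" using wI by simp
    moreover have "w * \<eta> powr (p - 1) * I \<le> (w * I + 1) * \<eta> powr (p - 1)"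
      by (simp add: algebra_simps)
    ultimately have small: "w * \<eta> powr (p - 1) * I \<le> e" by linarith
    define \<delta> where "\<delta> = \<eta> / 4"
    have \<delta>: "0 < \<delta>" "4 * \<delta> = \<eta>" using \<eta> by (simp_all add: \<delta>_def)
    have K\<mu>: "K \<in> sets \<mu>"
      by (rule borel_measure_on_closedin[OF \<mu>'(1) compactin_imp_closedin_mtopology_of[OF K]])
    obtain F where F: "finite F" "F \<subseteq> mspace X" "\<And>x. x \<in> K \<Longrightarrow> \<exists>z\<in>F. mdist X z x < \<delta>"
      using compactin_finite_net[OF K \<delta>(1)] by metis
    have wp: "0 \<le> w * \<eta> powr (p - 1)" using w by simp
    have gK: "\<bar>g x - g y\<bar> \<le> w * \<eta> powr (p - 1) * mdist X x y"
      if "x \<in> mspace X" "y \<in> mspace X" "mdist X x y < 4 * \<delta>" for x y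
    proof -
      let ?d = "mdist X x y"
      have "?d powr p = ?d powr (p - 1) * ?d" using powr_add[of ?d "p - 1" 1] by simp
      also have "\<dots> \<le> \<eta> powr (p - 1) * ?d"
        using that p \<delta> by (intro mult_right_mono powr_mono2) auto
      finally have "w * ?d powr p \<le> w * (\<eta> powr (p - 1) * ?d)" using w by (rule mult_left_mono)
      then show ?thesis using flat[OF that(1,2)] by (simp add: mult.assoc)
    qed
    obtain f' where f': "f' \<in> Lip_b X"
      and le: "\<bar>T f g\<bar> \<le> w * \<eta> powr (p - 1) * (I - (\<integral>x. \<bar>f' x\<bar> \<partial>\<mu>)) + \<bar>T f' g\<bar>"
      and f'f: "\<And>x. x \<in> mspace X \<Longrightarrow> \<bar>f' x\<bar> \<le> \<bar>f x\<bar>"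
      and f'0: "\<And>z x. z \<in> F \<Longrightarrow> x \<in> mspace X \<Longrightarrow> mdist X z x < \<delta> \<Longrightarrow> f' x = 0"
      using current_peel_balls[OF T \<mu> g \<delta>(1) wp gK F(1,2) f] unfolding I_def by blast
    have "0 \<le> (\<integral>x. \<bar>f' x\<bar> \<partial>\<mu>)" by simp
    then have "w * \<eta> powr (p - 1) * (I - (\<integral>x. \<bar>f' x\<bar> \<partial>\<mu>)) \<le> w * \<eta> powr (p - 1) * I"
      using wp by (intro mult_left_mono) auto
    then have 1: "w * \<eta> powr (p - 1) * (I - (\<integral>x. \<bar>f' x\<bar> \<partial>\<mu>)) \<le> e" using small by linarith
    have "(\<integral>x. \<bar>f' x\<bar> \<partial>\<mu>) \<le> (\<integral>x. S * indicat_real (space \<mu> - K) x \<partial>\<mu>)"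
    proof (rule integral_mono)
      show "integrable \<mu> (\<lambda>x. \<bar>f' x\<bar>)" by (rule Lip_b_integrable[OF f' \<mu>'])
      show "integrable \<mu> (\<lambda>x. S * indicat_real (space \<mu> - K) x)"
        using K\<mu> by (intro integrable_mult_right integrable_real_indicator) (auto simp: emeasure_eq_measure)
      fix x assume "x \<in> space \<mu>"
      then have x: "x \<in> mspace X" by (simp add: sp)
      show "\<bar>f' x\<bar> \<le> S * indicat_real (space \<mu> - K) x"
      proof (cases "x \<in> K")
        case True
        then have "f' x = 0" using F(3) f'0 x by blast
        then show ?thesis using S(1) by simp
      next
        case False
        then show ?thesis using f'f[OF x] S(2)[OF x] x by (simp add: sp)
      qed
    qed
    also have "\<dots> = S * measure \<mu> (space \<mu> - K)" using K\<mu> by simp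
    finally have "LIP X g * (\<integral>x. \<bar>f' x\<bar> \<partial>\<mu>) \<le> LIP X g * (S * measure \<mu> (space \<mu> - K))"
      using LIP_nonneg[OF g] by (rule mult_left_mono)
    moreover have "\<bar>T f' g\<bar> \<le> LIP X g * (\<integral>x. \<bar>f' x\<bar> \<partial>\<mu>)"
      using \<mu> f' g unfolding mass_bound_def by blast
    ultimately show "\<bar>T f g\<bar> \<le> LIP X g * (S * measure \<mu> (space \<mu> - K)) + e"
      using le 1 by linarith
  qed
  have "\<bar>T f g\<bar> \<le> 0 + e" if e: "0 < e" for e
  proof -
    define C where "C = LIP X g * S + 1"
    have C: "0 < C" using LIP_nonneg[OF g] S(1) by (simp add: C_def add_nonneg_pos)
    have "\<exists>K. compactin (mtopology_of X) K \<and> measure \<mu> (space \<mu> - K) \<le> e / C"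
    proof (cases "measure \<mu> (space \<mu>) < e / C")
      case True
      then show ?thesis by (intro exI[of _ "{}"]) simp
    next
      case False
      have "emeasure \<mu> (space \<mu>) = (SUP K\<in>{K. compactin (mtopology_of X) K \<and> K \<subseteq> space \<mu>}. emeasure \<mu> K)"
        using reg unfolding inner_regular_compact_def by blast
      moreover have "ennreal (measure \<mu> (space \<mu>) - e / C) < emeasure \<mu> (space \<mu>)"
        using False e C by (simp add: emeasure_eq_measure ennreal_less_iff)
      ultimately obtain K where K: "compactin (mtopology_of X) K" "K \<subseteq> space \<mu>"
        "ennreal (measure \<mu> (space \<mu>) - e / C) < emeasure \<mu> K"
        by (auto simp: less_SUP_iff)
      have K\<mu>: "K \<in> sets \<mu>"
        by (rule borel_measure_on_closedin[OF \<mu>'(1) compactin_imp_closedin_mtopology_of[OF K(1)]])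
      have "measure \<mu> (space \<mu>) - e / C < measure \<mu> K"
        using K(3) False by (simp add: emeasure_eq_measure ennreal_less_iff)
      then have "measure \<mu> (space \<mu> - K) \<le> e / C" using finite_measure_compl[OF K\<mu>] by simp
      then show ?thesis using K(1) by blast
    qed
    then obtain K where K: "compactin (mtopology_of X) K" "measure \<mu> (space \<mu> - K) \<le> e / C" by blast
    have "LIP X g * (S * measure \<mu> (space \<mu> - K)) \<le> C * measure \<mu> (space \<mu> - K)"
      by (simp add: C_def algebra_simps)
    also have "\<dots> \<le> C * (e / C)" using K(2) C by (intro mult_left_mono) auto
    also have "\<dots> = e" using C by simp
    finally show ?thesis using outside[OF K(1)] by simp
  qed
  then have "\<bar>T f g\<bar> \<le> 0" by (rule field_le_epsilon)
  then show ?thesis by simp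
qed

lemma chain_ineq_imp_currents_zero:
  assumes p: "1 < p" and c: "0 < c" and Z: "chain_ineq Z p c" and T: "T \<in> metric_currents1_reg Z"
  shows "zero_current Z T"
  unfolding zero_current_def
proof (intro ballI)
  fix f \<pi> assume f: "f \<in> Lip_b Z" and \<pi>: "\<pi> \<in> Lip Z"
  obtain \<mu> where T1: "T \<in> metric_currents1 Z" and \<mu>: "mass_bound Z T \<mu>" "inner_regular_compact Z \<mu>"
    using T unfolding metric_currents1_reg_def is_mass_measure_def by blast
  obtain L where L: "0 < L" "\<And>x y. x \<in> mspace Z \<Longrightarrow> y \<in> mspace Z \<Longrightarrow> \<bar>\<pi> x - \<pi> y\<bar> \<le> L * mdist Z x y"
    using LipE[OF \<pi>] by metis
  define K where "K = 2 * L + L / c"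
  have K: "0 \<le> K" using L c by (simp add: K_def)
  have "\<exists>g. T f g = 0 \<and> (\<forall>x\<in>mspace Z. \<bar>g x - \<pi> x\<bar> \<le> L * inverse (real (Suc n))) \<and>
      (\<forall>x\<in>mspace Z. \<forall>y\<in>mspace Z. \<bar>g x - g y\<bar> \<le> K * mdist Z x y)" for n
  proof -
    have r: "0 < inverse (real (Suc n))" by simp
    obtain g :: "_ \<Rightarrow> real" and w where g: "0 \<le> w" "\<And>x. x \<in> mspace Z \<Longrightarrow> \<bar>g x - \<pi> x\<bar> \<le> L * inverse (real (Suc n))"
      "\<And>x y. x \<in> mspace Z \<Longrightarrow> y \<in> mspace Z \<Longrightarrow> \<bar>g x - g y\<bar> \<le> w * mdist Z x y powr p"
      "\<And>x y. x \<in> mspace Z \<Longrightarrow> y \<in> mspace Z \<Longrightarrow> \<bar>g x - g y\<bar> \<le> (2 * L + L / c) * mdist Z x y"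
      by (rule chain_ineq_flat_approximation[OF p c Z L(1) r, of \<pi>]) (rule L(2) that; assumption)+
    note lip = g(4)[folded K_def]
    have "g \<in> Lip Z" by (rule LipI[OF K lip])
    then have "T f g = 0" by (rule current_flat_zero[OF T1 \<mu> f _ p g(1,3)])
    then show ?thesis using g(2) lip by blast
  qed
  then have "\<forall>n. \<exists>g. T f g = 0 \<and> (\<forall>x\<in>mspace Z. \<bar>g x - \<pi> x\<bar> \<le> L * inverse (real (Suc n))) \<and>
      (\<forall>x\<in>mspace Z. \<forall>y\<in>mspace Z. \<bar>g x - g y\<bar> \<le> K * mdist Z x y)" by blast
  from choice[OF this] obtain G where G: "\<And>n. T f (G n) = 0"
    "\<And>n x. x \<in> mspace Z \<Longrightarrow> \<bar>G n x - \<pi> x\<bar> \<le> L * inverse (real (Suc n))"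
    "\<And>n x y. x \<in> mspace Z \<Longrightarrow> y \<in> mspace Z \<Longrightarrow> \<bar>G n x - G n y\<bar> \<le> K * mdist Z x y" by blast
  have "(\<lambda>n. T f (G n)) \<longlonglongrightarrow> T f \<pi>"
  proof (rule current_continuous[OF T1 f \<pi> K G(3)])
    fix x assume x: "x \<in> mspace Z"
    show "(\<lambda>n. G n x) \<longlonglongrightarrow> \<pi> x"
    proof (rule LIM_zero_cancel, rule Lim_null_comparison)
      show "\<forall>\<^sub>F n in sequentially. norm (G n x - \<pi> x) \<le> L * inverse (real (Suc n))"
        using G(2)[OF x] by simp
      show "(\<lambda>n. L * inverse (real (Suc n))) \<longlonglongrightarrow> 0"
        using tendsto_mult_left[OF LIMSEQ_inverse_real_of_nat, of L] by simp
    qed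
  qed
  then show "T f \<pi> = 0" by (simp add: G(1) LIMSEQ_const_iff)
qed

section \<open>Riemann-Stieltjes integrals of Lipschitz functions\<close>

definition stieltjes_sum :: "(real \<Rightarrow> real) \<Rightarrow> (real \<Rightarrow> real) \<Rightarrow> nat \<Rightarrow> real"
  where "stieltjes_sum F P k = (\<Sum>i<2 ^ k. F (real i / 2 ^ k) * (P (real (Suc i) / 2 ^ k) - P (real i / 2 ^ k)))"

definition stieltjes :: "(real \<Rightarrow> real) \<Rightarrow> (real \<Rightarrow> real) \<Rightarrow> real"
  where "stieltjes F P = lim (stieltjes_sum F P)"

definition unit_lipschitz :: "real \<Rightarrow> (real \<Rightarrow> real) \<Rightarrow> bool"
  where "unit_lipschitz A F \<longleftrightarrow> 0 \<le> A \<and> (\<forall>s\<in>{0..1}. \<forall>t\<in>{0..1}. \<bar>F s - F t\<bar> \<le> A * \<bar>s - t\<bar>)"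

lemma unit_lipschitzD:
  "unit_lipschitz A F \<Longrightarrow> s \<in> {0..1} \<Longrightarrow> t \<in> {0..1} \<Longrightarrow> \<bar>F s - F t\<bar> \<le> A * \<bar>s - t\<bar>"
  unfolding unit_lipschitz_def by blast

lemma dyadic_unit: "i \<le> 2 ^ k \<Longrightarrow> real i / 2 ^ k \<in> {0..1}"
proof -
  assume "i \<le> 2 ^ k"
  then have "real i \<le> 2 ^ k" by (metis of_nat_le_iff of_nat_numeral of_nat_power)
  then show ?thesis by simp
qed

lemma dyadic_step:
  assumes F: "unit_lipschitz A F" and i: "i < 2 ^ k"
  shows "\<bar>F (real (Suc i) / 2 ^ k) - F (real i / 2 ^ k)\<bar> \<le> A / 2 ^ k"
proof -
  have "\<bar>real (Suc i) / 2 ^ k - real i / 2 ^ k\<bar> = 1 / 2 ^ k"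
    unfolding diff_divide_distrib[symmetric] by simp
  then show ?thesis
    using unit_lipschitzD[OF F dyadic_unit[OF Suc_leI[OF i]] dyadic_unit[OF less_imp_le[OF i]]] by simp
qed

lemma sum_even_odd: "(\<Sum>i<2 * n. g i) = (\<Sum>i<n. g (2 * i) + g (Suc (2 * i)))" for g :: "nat \<Rightarrow> real"
  by (induction n) auto

text \<open>Halving the intervals changes each summand by a product of an increment of \<open>F\<close> and an increment of \<open>P\<close> over
  half an interval. The bound is written as a difference so that it telescopes.\<close>

lemma stieltjes_sum_refine:
  assumes F: "unit_lipschitz A F" and P: "unit_lipschitz B P"
  shows "\<bar>stieltjes_sum F P k - stieltjes_sum F P (Suc k)\<bar> \<le> A * B / 2 ^ k - A * B / 2 ^ Suc k"
proof -
  have AB: "0 \<le> A" "0 \<le> B" using F P by (simp_all add: unit_lipschitz_def)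
  let ?t = "\<lambda>i. real i / 2 ^ k" and ?u = "\<lambda>i. real i / 2 ^ Suc k"
  have u: "?u (2 * i) = ?t i" "?u (Suc (Suc (2 * i))) = ?t (Suc i)" for i
    by (simp_all add: field_simps)
  have "stieltjes_sum F P (Suc k) = (\<Sum>i<2 ^ k. F (?u (2 * i)) * (P (?u (Suc (2 * i))) - P (?u (2 * i))) +
      F (?u (Suc (2 * i))) * (P (?u (Suc (Suc (2 * i)))) - P (?u (Suc (2 * i)))))"
    unfolding stieltjes_sum_def power_Suc[of 2 k] by (rule sum_even_odd)
  moreover have alg: "p * (w - v) - (p * (m - v) + q * (w - m)) = (p - q) * (w - m)" for p q v m w :: real
    by (simp add: algebra_simps)
  moreover have "stieltjes_sum F P k = (\<Sum>i<2 ^ k. F (?u (2 * i)) * (P (?u (Suc (Suc (2 * i)))) - P (?u (2 * i))))"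
    by (simp only: stieltjes_sum_def u)
  ultimately have "stieltjes_sum F P k - stieltjes_sum F P (Suc k) =
      (\<Sum>i<2 ^ k. (F (?u (2 * i)) - F (?u (Suc (2 * i)))) * (P (?u (Suc (Suc (2 * i)))) - P (?u (Suc (2 * i)))))"
    by (simp only: sum_subtractf[symmetric] alg)
  also have "\<bar>\<dots>\<bar> \<le> (\<Sum>i<(2::nat) ^ k. (A / 2 ^ Suc k) * (B / 2 ^ Suc k))"
  proof (rule order.trans[OF sum_abs], rule sum_mono)
    fix i :: nat assume "i \<in> {..<2 ^ k}"
    then have i: "2 * i < 2 ^ Suc k" "Suc (2 * i) < 2 ^ Suc k" by auto
    show "\<bar>(F (?u (2 * i)) - F (?u (Suc (2 * i)))) * (P (?u (Suc (Suc (2 * i)))) - P (?u (Suc (2 * i))))\<bar>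
        \<le> (A / 2 ^ Suc k) * (B / 2 ^ Suc k)"
      unfolding abs_mult
      using dyadic_step[OF F i(1)] dyadic_step[OF P i(2)] AB
      by (intro mult_mono) (simp_all add: abs_minus_commute)
  qed
  also have "\<dots> = A * B / 2 ^ k / 4" by (simp add: field_simps)
  also have "\<dots> \<le> A * B / 2 ^ k / 2" using AB by (intro divide_left_mono) auto
  also have "\<dots> = A * B / 2 ^ k - A * B / 2 ^ Suc k" by (simp add: field_simps)
  finally show ?thesis .
qed

lemma stieltjes_sum_tail:
  assumes F: "unit_lipschitz A F" and P: "unit_lipschitz B P"
  shows "\<bar>stieltjes_sum F P k - stieltjes_sum F P (k + j)\<bar> \<le> A * B / 2 ^ k - A * B / 2 ^ (k + j)"
proof (induction j)
  case (Suc j)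
  then show ?case using stieltjes_sum_refine[OF F P, of "k + j"] unfolding add_Suc_right by linarith
qed simp

lemma
  assumes F: "unit_lipschitz A F" and P: "unit_lipschitz B P"
  shows stieltjes_sum_LIMSEQ: "stieltjes_sum F P \<longlonglongrightarrow> stieltjes F P"
    and stieltjes_sum_error: "\<bar>stieltjes_sum F P k - stieltjes F P\<bar> \<le> A * B / 2 ^ k"
proof -
  have AB: "0 \<le> A * B" using F P by (simp add: unit_lipschitz_def)
  have tail: "\<bar>stieltjes_sum F P k - stieltjes_sum F P n\<bar> \<le> A * B / 2 ^ k" if "k \<le> n" for k n
  proof -
    have "0 \<le> A * B / 2 ^ n" using AB by simp
    then show ?thesis using stieltjes_sum_tail[OF F P, of k "n - k"] that by simp
  qed
  have "(\<lambda>k. A * B / 2 ^ k) \<longlonglongrightarrow> 0"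
    by (rule LIMSEQ_divide_realpow_zero) simp
  have "Cauchy (stieltjes_sum F P)"
  proof (rule CauchyI)
    fix e :: real assume "0 < e"
    then have "\<forall>\<^sub>F k in sequentially. A * B / 2 ^ k < e / 2"
      using \<open>(\<lambda>k. A * B / 2 ^ k) \<longlonglongrightarrow> 0\<close> by (intro order_tendstoD) auto
    then obtain M where M: "A * B / 2 ^ M < e / 2" by (auto simp: eventually_sequentially)
    have "norm (stieltjes_sum F P m - stieltjes_sum F P n) < e" if "M \<le> m" "M \<le> n" for m n
      using tail[OF that(1)] tail[OF that(2)] M unfolding real_norm_def by linarith
    then show "\<exists>M. \<forall>m\<ge>M. \<forall>n\<ge>M. norm (stieltjes_sum F P m - stieltjes_sum F P n) < e" by blast
  qed
  then show lim: "stieltjes_sum F P \<longlonglongrightarrow> stieltjes F P"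
    unfolding stieltjes_def by (simp add: Cauchy_convergent_iff convergent_LIMSEQ_iff)
  have "(\<lambda>n. \<bar>stieltjes_sum F P k - stieltjes_sum F P n\<bar>) \<longlonglongrightarrow> \<bar>stieltjes_sum F P k - stieltjes F P\<bar>"
    by (intro tendsto_intros lim)
  then show "\<bar>stieltjes_sum F P k - stieltjes F P\<bar> \<le> A * B / 2 ^ k"
    by (rule Lim_bounded) (use tail in auto)
qed

lemma
  assumes G: "unit_lipschitz A G"
  shows riemann_sum_LIMSEQ: "(\<lambda>k. \<Sum>i<2 ^ k. G (real i / 2 ^ k) / 2 ^ k) \<longlonglongrightarrow> integral {0..1} G"
    and unit_lipschitz_continuous_on: "continuous_on {0..1} G"
proof -
  have A: "0 \<le> A" and GA: "\<And>s t. s \<in> {0..1} \<Longrightarrow> t \<in> {0..1} \<Longrightarrow> \<bar>G s - G t\<bar> \<le> A * \<bar>s - t\<bar>"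
    using G by (auto simp: unit_lipschitz_def)
  have "A-lipschitz_on {0..1} G"
    by (rule lipschitz_onI) (use A GA in \<open>auto simp: dist_real_def\<close>)
  then show cont: "continuous_on {0..1} G" by (rule lipschitz_on_continuous_on)
  define H where "H x = integral {0..x} G" for x
  have int: "G integrable_on {x..y}" if "0 \<le> x" "y \<le> 1" for x y
    using that by (intro integrable_continuous_real continuous_on_subset[OF cont]) auto
  have H: "\<bar>(H y - H x) - G x * (y - x)\<bar> \<le> A * (y - x) * (y - x)" if "0 \<le> x" "x \<le> y" "y \<le> 1" for x y
  proof -
    have "H x + integral {x..y} G = H y"
      unfolding H_def by (rule Henstock_Kurzweil_Integration.integral_combine) (use that int in auto)
    then have "(H y - H x) - G x * (y - x) = integral {x..y} G - integral {x..y} (\<lambda>_. G x)"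
      using that by simp
    also have "\<dots> = integral {x..y} (\<lambda>t. G t - G x)"
      using that int by (intro Henstock_Kurzweil_Integration.integral_diff[symmetric]) auto
    also have "norm \<dots> \<le> A * (y - x) * (y - x)"
    proof (rule integral_bound)
      show "continuous_on {x..y} (\<lambda>t. G t - G x)"
        using that by (intro continuous_intros continuous_on_subset[OF cont]) auto
      fix t assume t: "t \<in> {x..y}"
      then have "\<bar>G t - G x\<bar> \<le> A * \<bar>t - x\<bar>" using that by (intro GA) auto
      also have "\<dots> \<le> A * (y - x)" using t A by (intro mult_left_mono) auto
      finally show "norm (G t - G x) \<le> A * (y - x)" by simp
    qed (use that in simp)
    finally show ?thesis by simp
  qed
  have err: "norm ((\<Sum>i<2 ^ k. G (real i / 2 ^ k) / 2 ^ k) - integral {0..1} G) \<le> A / 2 ^ k" for k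
  proof -
    let ?t = "\<lambda>i. real i / 2 ^ k"
    have d: "?t (Suc i) - ?t i = 1 / 2 ^ k" for i unfolding diff_divide_distrib[symmetric] by simp
    have "integral {0..1} G = H (?t (2 ^ k)) - H (?t 0)" by (simp add: H_def)
    also have "\<dots> = (\<Sum>i<2 ^ k. H (?t (Suc i)) - H (?t i))"
      by (rule sum_lessThan_telescope[symmetric])
    finally have "\<bar>integral {0..1} G - (\<Sum>i<2 ^ k. G (?t i) / 2 ^ k)\<bar>
        = \<bar>\<Sum>i<2 ^ k. (H (?t (Suc i)) - H (?t i)) - G (?t i) / 2 ^ k\<bar>"
      by (simp add: sum_subtractf)
    also have "\<dots> \<le> (\<Sum>i<(2::nat) ^ k. A * (1 / 2 ^ k) * (1 / 2 ^ k))"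
    proof (rule order.trans[OF sum_abs], rule sum_mono)
      fix i :: nat assume "i \<in> {..<2 ^ k}"
      then have "?t i \<in> {0..1}" "?t (Suc i) \<in> {0..1}" using dyadic_unit[of i k] dyadic_unit[of "Suc i" k] by auto
      then show "\<bar>(H (?t (Suc i)) - H (?t i)) - G (?t i) / 2 ^ k\<bar> \<le> A * (1 / 2 ^ k) * (1 / 2 ^ k)"
        using H[of "?t i" "?t (Suc i)"] unfolding d by (simp add: divide_right_mono)
    qed
    also have "\<dots> = A / 2 ^ k" by simp
    finally show ?thesis by (simp add: abs_minus_commute)
  qed
  show "(\<lambda>k. \<Sum>i<2 ^ k. G (real i / 2 ^ k) / 2 ^ k) \<longlonglongrightarrow> integral {0..1} G"
  proof (rule LIM_zero_cancel, rule Lim_null_comparison)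
    show "\<forall>\<^sub>F k in sequentially. norm ((\<Sum>i<2 ^ k. G (real i / 2 ^ k) / 2 ^ k) - integral {0..1} G) \<le> A / 2 ^ k"
      using err by simp
    show "(\<lambda>k. A / 2 ^ k) \<longlonglongrightarrow> 0"
      by (rule LIMSEQ_divide_realpow_zero) simp
  qed
qed

lemma stieltjes_lincomb_left:
  assumes F: "unit_lipschitz A F" and F': "unit_lipschitz A' F'" and P: "unit_lipschitz B P"
  shows "stieltjes (\<lambda>t. a * F t + b * F' t) P = a * stieltjes F P + b * stieltjes F' P"
proof -
  have "stieltjes_sum (\<lambda>t. a * F t + b * F' t) P = (\<lambda>k. a * stieltjes_sum F P k + b * stieltjes_sum F' P k)"
    unfolding stieltjes_sum_def[abs_def] sum_distrib_left sum.distrib[symmetric]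
    by (intro ext sum.cong refl) algebra
  moreover have "(\<lambda>k. a * stieltjes_sum F P k + b * stieltjes_sum F' P k) \<longlonglongrightarrow> a * stieltjes F P + b * stieltjes F' P"
    by (intro tendsto_intros stieltjes_sum_LIMSEQ[OF F P] stieltjes_sum_LIMSEQ[OF F' P])
  ultimately show ?thesis unfolding stieltjes_def[of "\<lambda>t. a * F t + b * F' t"] by (simp add: limI)
qed

lemma stieltjes_lincomb_right:
  assumes F: "unit_lipschitz A F" and P: "unit_lipschitz B P" and P': "unit_lipschitz B' P'"
  shows "stieltjes F (\<lambda>t. a * P t + b * P' t) = a * stieltjes F P + b * stieltjes F P'"
proof -
  have "stieltjes_sum F (\<lambda>t. a * P t + b * P' t) = (\<lambda>k. a * stieltjes_sum F P k + b * stieltjes_sum F P' k)"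
    unfolding stieltjes_sum_def[abs_def] sum_distrib_left sum.distrib[symmetric]
    by (intro ext sum.cong refl) algebra
  moreover have "(\<lambda>k. a * stieltjes_sum F P k + b * stieltjes_sum F P' k) \<longlonglongrightarrow> a * stieltjes F P + b * stieltjes F P'"
    by (intro tendsto_intros stieltjes_sum_LIMSEQ[OF F P] stieltjes_sum_LIMSEQ[OF F P'])
  ultimately show ?thesis unfolding stieltjes_def[of F "\<lambda>t. a * P t + b * P' t"] by (simp add: limI)
qed

text \<open>A summand can be non-zero only if \<open>F\<close> vanishes at the right end of its interval; there \<open>F\<close> and the increment
  of \<open>P\<close> are both of the order of the mesh, and the sum over all intervals tends to \<open>0\<close>.\<close>

lemma stieltjes_local:
  assumes F: "unit_lipschitz A F" and P: "unit_lipschitz B P"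
    and local: "\<And>s t. s \<in> {0..1} \<Longrightarrow> t \<in> {0..1} \<Longrightarrow> F s \<noteq> 0 \<Longrightarrow> F t \<noteq> 0 \<Longrightarrow> P s = P t"
  shows "stieltjes F P = 0"
proof (rule LIMSEQ_unique[OF stieltjes_sum_LIMSEQ[OF F P]], rule Lim_null_comparison)
  have AB: "0 \<le> A" "0 \<le> B" using F P by (simp_all add: unit_lipschitz_def)
  have "norm (stieltjes_sum F P k) \<le> A * B / 2 ^ k" for k
  proof -
    let ?t = "\<lambda>i. real i / 2 ^ k"
    have "norm (stieltjes_sum F P k) \<le> (\<Sum>i<(2::nat) ^ k. (A / 2 ^ k) * (B / 2 ^ k))"
      unfolding stieltjes_sum_def real_norm_def
    proof (rule order.trans[OF sum_abs], rule sum_mono)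
      fix i :: nat assume "i \<in> {..<2 ^ k}"
      then have i: "i < 2 ^ k" "Suc i \<le> 2 ^ k" "i \<le> 2 ^ k" by auto
      have nonneg: "0 \<le> (A / 2 ^ k) * (B / 2 ^ k)" using AB by simp
      show "\<bar>F (?t i) * (P (?t (Suc i)) - P (?t i))\<bar> \<le> (A / 2 ^ k) * (B / 2 ^ k)"
      proof (cases "F (?t i) = 0 \<or> P (?t (Suc i)) = P (?t i)")
        case True
        then show ?thesis using nonneg by auto
      next
        case False
        then have "F (?t (Suc i)) = 0"
          using local[OF dyadic_unit[OF i(2)] dyadic_unit[OF i(3)]] by blast
        then have "\<bar>F (?t i)\<bar> \<le> A / 2 ^ k" using dyadic_step[OF F i(1)] by simp
        then show ?thesis unfolding abs_mult
          using dyadic_step[OF P i(1)] AB by (intro mult_mono) auto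
      qed
    qed
    also have "\<dots> = A * B / 2 ^ k" by simp
    finally show ?thesis .
  qed
  then show "\<forall>\<^sub>F k in sequentially. norm (stieltjes_sum F P k) \<le> A * B / 2 ^ k" by simp
  show "(\<lambda>k. A * B / 2 ^ k) \<longlonglongrightarrow> 0"
    by (rule LIMSEQ_divide_realpow_zero) simp
qed

text \<open>The error of the dyadic sums is uniform over integrators with a common Lipschitz constant, and each
  dyadic sum involves finitely many values of the integrator.\<close>

lemma stieltjes_continuous:
  assumes F: "unit_lipschitz A F" and Pn: "\<And>n. unit_lipschitz B (Pn n)" and P: "unit_lipschitz B P"
    and lim: "\<And>t. t \<in> {0..1} \<Longrightarrow> (\<lambda>n. Pn n t) \<longlonglongrightarrow> P t"
  shows "(\<lambda>n. stieltjes F (Pn n)) \<longlonglongrightarrow> stieltjes F P"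
proof (rule LIMSEQ_I)
  fix e :: real assume e: "0 < e"
  have "(\<lambda>k. A * B / 2 ^ k) \<longlonglongrightarrow> 0"
    by (rule LIMSEQ_divide_realpow_zero) simp
  then have "\<forall>\<^sub>F k in sequentially. A * B / 2 ^ k < e / 3"
    using e by (intro order_tendstoD) auto
  then obtain k where k: "A * B / 2 ^ k < e / 3" by (auto simp: eventually_sequentially)
  have "(\<lambda>n. stieltjes_sum F (Pn n) k) \<longlonglongrightarrow> stieltjes_sum F P k"
    unfolding stieltjes_sum_def
    by (intro tendsto_intros lim dyadic_unit) auto
  then obtain N where N: "\<And>n. N \<le> n \<Longrightarrow> norm (stieltjes_sum F (Pn n) k - stieltjes_sum F P k) < e / 3"
    using LIMSEQ_D[of _ _ "e / 3"] e by (metis divide_pos_pos zero_less_numeral)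
  have "norm (stieltjes F (Pn n) - stieltjes F P) < e" if "N \<le> n" for n
    using N[OF that] stieltjes_sum_error[OF F Pn, of n k] stieltjes_sum_error[OF F P, of k] k
    unfolding real_norm_def by linarith
  then show "\<exists>N. \<forall>n\<ge>N. norm (stieltjes F (Pn n) - stieltjes F P) < e" by blast
qed

lemma stieltjes_bound:
  assumes F: "unit_lipschitz A F" and P: "unit_lipschitz B P"
  shows "\<bar>stieltjes F P\<bar> \<le> B * integral {0..1} (\<lambda>t. \<bar>F t\<bar>)"
proof -
  have absF: "unit_lipschitz A (\<lambda>t. \<bar>F t\<bar>)"
    using F abs_triangle_ineq3 unfolding unit_lipschitz_def by (meson order.trans)
  show ?thesis
  proof (rule LIMSEQ_le)
    show "(\<lambda>k. \<bar>stieltjes_sum F P k\<bar>) \<longlonglongrightarrow> \<bar>stieltjes F P\<bar>"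
      by (intro tendsto_rabs stieltjes_sum_LIMSEQ[OF F P])
    show "(\<lambda>k. B * (\<Sum>i<2 ^ k. \<bar>F (real i / 2 ^ k)\<bar> / 2 ^ k)) \<longlonglongrightarrow> B * integral {0..1} (\<lambda>t. \<bar>F t\<bar>)"
      by (intro tendsto_mult_left riemann_sum_LIMSEQ[OF absF])
    have "\<bar>stieltjes_sum F P k\<bar> \<le> B * (\<Sum>i<2 ^ k. \<bar>F (real i / 2 ^ k)\<bar> / 2 ^ k)" for k
      unfolding stieltjes_sum_def sum_distrib_left
    proof (rule order.trans[OF sum_abs], rule sum_mono)
      fix i :: nat assume "i \<in> {..<2 ^ k}"
      then have i: "i < 2 ^ k" by simp
      have "\<bar>F (real i / 2 ^ k)\<bar> * \<bar>P (real (Suc i) / 2 ^ k) - P (real i / 2 ^ k)\<bar> \<le> \<bar>F (real i / 2 ^ k)\<bar> * (B / 2 ^ k)"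
        by (intro mult_left_mono dyadic_step[OF P i]) simp
      then show "\<bar>F (real i / 2 ^ k) * (P (real (Suc i) / 2 ^ k) - P (real i / 2 ^ k))\<bar> \<le> B * (\<bar>F (real i / 2 ^ k)\<bar> / 2 ^ k)"
        by (simp add: abs_mult mult_ac)
    qed
    then show "\<exists>N. \<forall>k\<ge>N. \<bar>stieltjes_sum F P k\<bar> \<le> B * (\<Sum>i<2 ^ k. \<bar>F (real i / 2 ^ k)\<bar> / 2 ^ k)" by blast
  qed
qed

lemma stieltjes_id:
  assumes F: "unit_lipschitz A F" and P: "\<And>t. t \<in> {0..1} \<Longrightarrow> P t = t"
  shows "stieltjes F P = integral {0..1} F"
proof -
  have "stieltjes_sum F P k = (\<Sum>i<2 ^ k. F (real i / 2 ^ k) / 2 ^ k)" for k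
    unfolding stieltjes_sum_def
  proof (rule sum.cong[OF refl])
    fix i :: nat assume "i \<in> {..<2 ^ k}"
    then have "P (real (Suc i) / 2 ^ k) - P (real i / 2 ^ k) = real (Suc i) / 2 ^ k - real i / 2 ^ k"
      using P[OF dyadic_unit[of i k]] P[OF dyadic_unit[of "Suc i" k]] by simp
    also have "\<dots> = 1 / 2 ^ k" unfolding diff_divide_distrib[symmetric] by simp
    finally show "F (real i / 2 ^ k) * (P (real (Suc i) / 2 ^ k) - P (real i / 2 ^ k)) = F (real i / 2 ^ k) / 2 ^ k"
      by simp
  qed
  then have "stieltjes_sum F P \<longlonglongrightarrow> integral {0..1} F" using riemann_sum_LIMSEQ[OF F] by presburger
  then show ?thesis unfolding stieltjes_def by (rule limI)
qed

section \<open>The current of a segment\<close>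

context isometric_segment
begin

definition segment_measure :: "'b measure"
  where "segment_measure = distr (restrict_space lborel {0..1})
    (sigma (mspace Z) {U. openin (mtopology_of Z) U}) \<gamma>"

definition segment_current :: "('b \<Rightarrow> real) \<Rightarrow> ('b \<Rightarrow> real) \<Rightarrow> real"
  where "segment_current f \<pi> = stieltjes (\<lambda>t. f (\<gamma> t)) (\<lambda>t. \<pi> (\<gamma> t))"

lemma sigma_opens:
  "space (sigma (mspace Z) {U. openin (mtopology_of Z) U}) = mspace Z"
  "sets (sigma (mspace Z) {U. openin (mtopology_of Z) U}) = sigma_sets (mspace Z) {U. openin (mtopology_of Z) U}"
proof -
  have "{U. openin (mtopology_of Z) U} \<subseteq> Pow (mspace Z)" using openin_subset by fastforce
  then show "space (sigma (mspace Z) {U. openin (mtopology_of Z) U}) = mspace Z"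
    "sets (sigma (mspace Z) {U. openin (mtopology_of Z) U}) = sigma_sets (mspace Z) {U. openin (mtopology_of Z) U}"
    by (auto simp: space_measure_of)
qed

lemma borel_measure_on_segment: "borel_measure_on Z segment_measure"
  unfolding borel_measure_on_def segment_measure_def by (simp add: sigma_opens)

lemma measurable_segment:
  "\<gamma> \<in> measurable (restrict_space lborel {0..1}) (sigma (mspace Z) {U. openin (mtopology_of Z) U})"
proof (rule measurable_measure_of)
  show "{U. openin (mtopology_of Z) U} \<subseteq> Pow (mspace Z)" using openin_subset by fastforce
  show "\<gamma> \<in> space (restrict_space lborel {0..1}) \<rightarrow> mspace Z" using in_space by (simp add: space_restrict_space)
  fix U assume "U \<in> {U. openin (mtopology_of Z) U}"
  then have "openin (top_of_set {0..1}) {t \<in> topspace (top_of_set {0..1}). \<gamma> t \<in> U}"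
    using openin_continuous_map_preimage[OF continuous_map_segment] by blast
  then obtain T where T: "open T" "{t \<in> topspace (top_of_set {0..1}). \<gamma> t \<in> U} = {0..1} \<inter> T"
    unfolding openin_open by blast
  have "\<gamma> -` U \<inter> space (restrict_space lborel {0..1}) = {t \<in> topspace (top_of_set {0..1}). \<gamma> t \<in> U}"
    by (auto simp: space_restrict_space)
  also note T(2)
  also have "{0..1} \<inter> T \<in> sets (restrict_space lborel {0..1})"
    by (subst sets_restrict_space_iff) (use T(1) in simp_all)
  finally show "\<gamma> -` U \<inter> space (restrict_space lborel {0..1}) \<in> sets (restrict_space lborel {0..1})" .
qed

lemma segment_preimage_borel:
  assumes "A \<in> sets segment_measure"
  shows "{t \<in> {0..1}. \<gamma> t \<in> A} \<in> sets borel"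
proof -
  have "A \<in> sets (sigma (mspace Z) {U. openin (mtopology_of Z) U})"
    using assms by (simp add: segment_measure_def)
  from measurable_sets[OF measurable_segment this]
  have "\<gamma> -` A \<inter> {0..1} \<in> sets (restrict_space lborel {0..1})" by (simp add: space_restrict_space)
  then have "\<gamma> -` A \<inter> {0..1} \<in> sets lborel" 
    by (subst (asm) sets_restrict_space_iff) simp_all
  moreover have "\<gamma> -` A \<inter> {0..1} = {t \<in> {0..1}. \<gamma> t \<in> A}" by auto
  ultimately show ?thesis by simp
qed

lemma emeasure_segment:
  assumes "A \<in> sets segment_measure"
  shows "emeasure segment_measure A = emeasure lborel {t \<in> {0..1}. \<gamma> t \<in> A}"
proof -
  have A: "A \<in> sets (sigma (mspace Z) {U. openin (mtopology_of Z) U})"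
    using assms by (simp add: segment_measure_def)
  have eq: "\<gamma> -` A \<inter> space (restrict_space lborel {0..1}) = {t \<in> {0..1}. \<gamma> t \<in> A}"
    by (auto simp: space_restrict_space)
  have "emeasure segment_measure A = emeasure (restrict_space lborel {0..1}) {t \<in> {0..1}. \<gamma> t \<in> A}"
    unfolding segment_measure_def emeasure_distr[OF measurable_segment A] eq ..
  also have "\<dots> = emeasure lborel {t \<in> {0..1}. \<gamma> t \<in> A}"
    by (rule emeasure_restrict_space) auto
  finally show ?thesis .
qed

lemma finite_segment_measure: "finite_measure segment_measure"
proof (rule finite_measureI)
  have "space segment_measure \<in> sets segment_measure" by simp
  then have "emeasure segment_measure (space segment_measure) = emeasure lborel {t \<in> {0..1}. \<gamma> t \<in> space segment_measure}"
    by (rule emeasure_segment)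
  also have "\<dots> \<le> emeasure lborel {0..1::real}" by (rule emeasure_mono) auto
  also have "\<dots> = 1" by simp
  finally show "emeasure segment_measure (space segment_measure) \<noteq> \<infinity>"
    by (metis ennreal_one_less_top infinity_ennreal_def leD)
qed

lemma Lip_unit_lipschitz:
  assumes "f \<in> Lip Z" "LIP Z f \<le> K"
  shows "unit_lipschitz K (\<lambda>t. f (\<gamma> t))"
  unfolding unit_lipschitz_def
proof (intro conjI ballI)
  show "0 \<le> K" using LIP_nonneg[OF assms(1)] assms(2) by linarith
  fix s t :: real assume st: "s \<in> {0..1}" "t \<in> {0..1}"
  have "\<bar>f (\<gamma> s) - f (\<gamma> t)\<bar> \<le> LIP Z f * \<bar>s - t\<bar>"
    using Lip_bound[OF assms(1) in_space[OF st(1)] in_space[OF st(2)]] iso[OF st] by simp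
  also have "\<dots> \<le> K * \<bar>s - t\<bar>" using assms(2) by (intro mult_right_mono) auto
  finally show "\<bar>f (\<gamma> s) - f (\<gamma> t)\<bar> \<le> K * \<bar>s - t\<bar>" .
qed

text \<open>The Lebesgue integral is expressed by the gauge integral because the Riemann sums above converge to the
  latter.\<close>

lemma integral_segment_measure:
  assumes f: "f \<in> Lip Z"
  shows "(\<integral>x. f x \<partial>segment_measure) = integral {0..1} (\<lambda>t. f (\<gamma> t))"
proof -
  have "f \<in> borel_measurable segment_measure" by (rule Lip_borel_measurable[OF f borel_measure_on_segment])
  then have fm: "f \<in> borel_measurable (sigma (mspace Z) {U. openin (mtopology_of Z) U})"
    by (simp add: segment_measure_def)
  have cont: "continuous_on {0..1} (\<lambda>t. f (\<gamma> t))"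
    by (rule unit_lipschitz_continuous_on[OF Lip_unit_lipschitz[OF f order_refl]])
  have "(\<integral>x. f x \<partial>segment_measure) = (\<integral>t. f (\<gamma> t) \<partial>restrict_space lborel {0..1})"
    unfolding segment_measure_def by (rule integral_distr[OF measurable_segment fm])
  also have "\<dots> = (\<integral>t. indicator {0..1} t *\<^sub>R f (\<gamma> t) \<partial>lborel)"
    by (rule integral_restrict_space) simp
  also have "\<dots> = integral {0..1} (\<lambda>t. f (\<gamma> t))"
    using set_borel_integral_eq_integral(2)[OF borel_integrable_atLeastAtMost'[OF cont]]
    by (simp add: set_lebesgue_integral_def)
  finally show ?thesis .
qed

lemma mass_bound_segment: "mass_bound Z segment_current segment_measure"
  unfolding mass_bound_def
proof (intro conjI ballI borel_measure_on_segment finite_segment_measure)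
  fix f \<pi> assume f: "f \<in> Lip_b Z" and \<pi>: "\<pi> \<in> Lip Z"
  then have fL: "f \<in> Lip Z" by (simp add: Lip_b_def)
  show "\<bar>segment_current f \<pi>\<bar> \<le> LIP Z \<pi> * (\<integral>x. \<bar>f x\<bar> \<partial>segment_measure)"
    unfolding integral_segment_measure[OF Lip_abs[OF fL]] segment_current_def
    by (rule stieltjes_bound[OF Lip_unit_lipschitz[OF fL order_refl] Lip_unit_lipschitz[OF \<pi> order_refl]])
qed

lemma segment_current_in: "segment_current \<in> metric_currents1 Z"
  unfolding metric_currents1_def mem_Collect_eq
proof (intro conjI ballI allI impI)
  fix f g \<pi> and a b :: real assume "f \<in> Lip_b Z" "g \<in> Lip_b Z" "\<pi> \<in> Lip Z"
  then have "f \<in> Lip Z" "g \<in> Lip Z" "\<pi> \<in> Lip Z" by (simp_all add: Lip_b_def)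
  note [THEN Lip_unit_lipschitz[OF _ order_refl]] = this
  then show "segment_current (\<lambda>x. a * f x + b * g x) \<pi> = a * segment_current f \<pi> + b * segment_current g \<pi>"
    unfolding segment_current_def by (rule stieltjes_lincomb_left)
next
  fix f \<pi> \<rho> and a b :: real assume "f \<in> Lip_b Z" "\<pi> \<in> Lip Z" "\<rho> \<in> Lip Z"
  then have "f \<in> Lip Z" "\<pi> \<in> Lip Z" "\<rho> \<in> Lip Z" by (simp_all add: Lip_b_def)
  note [THEN Lip_unit_lipschitz[OF _ order_refl]] = this
  then show "segment_current f (\<lambda>x. a * \<pi> x + b * \<rho> x) = a * segment_current f \<pi> + b * segment_current f \<rho>"
    unfolding segment_current_def by (rule stieltjes_lincomb_right)
next
  fix f \<pi> assume f: "f \<in> Lip_b Z" and \<pi>: "\<pi> \<in> Lip Z"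
    and "\<exists>U c. openin (mtopology_of Z) U \<and> {x \<in> mspace Z. f x \<noteq> 0} \<subseteq> U \<and> (\<forall>x\<in>U. \<pi> x = c)"
  then obtain U c where U: "{x \<in> mspace Z. f x \<noteq> 0} \<subseteq> U" "\<forall>x\<in>U. \<pi> x = c" by blast
  have fL: "f \<in> Lip Z" using f by (simp add: Lip_b_def)
  show "segment_current f \<pi> = 0"
    unfolding segment_current_def
  proof (rule stieltjes_local[OF Lip_unit_lipschitz[OF fL order_refl] Lip_unit_lipschitz[OF \<pi> order_refl]])
    fix s t :: real assume "s \<in> {0..1}" "t \<in> {0..1}" "f (\<gamma> s) \<noteq> 0" "f (\<gamma> t) \<noteq> 0"
    then have "\<gamma> s \<in> U" "\<gamma> t \<in> U" using U(1) in_space by blast+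
    then show "\<pi> (\<gamma> s) = \<pi> (\<gamma> t)" using U(2) by simp
  qed
next
  fix f \<pi> and \<pi>n :: "nat \<Rightarrow> 'b \<Rightarrow> real"
  assume f: "f \<in> Lip_b Z" and \<pi>: "\<pi> \<in> Lip Z"
    and \<pi>n: "(\<forall>n. \<pi>n n \<in> Lip Z) \<and> bdd_above (range (\<lambda>n. LIP Z (\<pi>n n))) \<and>
      (\<forall>x\<in>mspace Z. (\<lambda>n. \<pi>n n x) \<longlonglongrightarrow> \<pi> x)"
  have fL: "f \<in> Lip Z" using f by (simp add: Lip_b_def)
  obtain M where M: "\<And>n. LIP Z (\<pi>n n) \<le> M" using \<pi>n by (auto simp: bdd_above_def)
  define B where "B = max M (LIP Z \<pi>)"
  show "(\<lambda>n. segment_current f (\<pi>n n)) \<longlonglongrightarrow> segment_current f \<pi>"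
    unfolding segment_current_def
  proof (rule stieltjes_continuous[OF Lip_unit_lipschitz[OF fL order_refl]])
    show "unit_lipschitz B (\<lambda>t. \<pi>n n (\<gamma> t))" for n
      using \<pi>n M[of n] by (intro Lip_unit_lipschitz) (auto simp: B_def)
    show "unit_lipschitz B (\<lambda>t. \<pi> (\<gamma> t))"
      using \<pi> by (intro Lip_unit_lipschitz) (auto simp: B_def)
    show "(\<lambda>n. \<pi>n n (\<gamma> t)) \<longlonglongrightarrow> \<pi> (\<gamma> t)" if "t \<in> {0..1}" for t
      using \<pi>n in_space[OF that] by blast
  qed
next
  show "\<exists>\<mu>. mass_bound Z segment_current \<mu>" using mass_bound_segment by blast
qed

text \<open>Since \<open>\<gamma>\<close> is injective and continuous, inner regularity of Lebesgue measure carries over to its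
  push-forward.\<close>

lemma segment_inner_compact:
  assumes A: "A \<in> sets segment_measure" and e: "0 < e"
  obtains K where "compactin (mtopology_of Z) K" "K \<subseteq> A"
    "emeasure segment_measure A \<le> emeasure segment_measure K + ennreal e"
proof -
  define A0 where "A0 = {t \<in> {0..1}. \<gamma> t \<in> A}"
  have A0: "A0 \<in> sets borel" unfolding A0_def by (rule segment_preimage_borel[OF A])
  then have "A0 \<in> sets lebesgue" by (intro sets_completionI_sets) simp
  then obtain T where T: "closed T" "T \<subseteq> A0" "emeasure lebesgue (A0 - T) < ennreal e"
    using sets_lebesgue_inner_closed[OF _ e] by metis
  have T01: "T \<subseteq> {0..1}" using T(2) by (auto simp: A0_def)
  then have "compact T" using T(1) compact_Icc[of 0 "1::real"] by (metis closed_Int_compact inf.absorb1)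
  then have "compactin (top_of_set {0..1}) T" using T01 by (simp add: compactin_subtopology)
  then have K: "compactin (mtopology_of Z) (\<gamma> ` T)" using continuous_map_segment by (rule image_compactin)
  have inj: "\<gamma> s = \<gamma> t \<longleftrightarrow> s = t" if "s \<in> {0..1}" "t \<in> {0..1}" for s t
    using iso[OF that] in_space[OF that(1)] by auto
  have KT: "{t \<in> {0..1}. \<gamma> t \<in> \<gamma> ` T} = T" using T01 inj by blast
  have K\<mu>: "\<gamma> ` T \<in> sets segment_measure"
    by (rule borel_measure_on_closedin[OF borel_measure_on_segment compactin_imp_closedin_mtopology_of[OF K]])
  have Tb: "T \<in> sets borel" using T(1) by simp
  have "emeasure lborel A0 \<le> emeasure lborel T + emeasure lborel (A0 - T)"
    using emeasure_subadditive[of T lborel "A0 - T"] A0 Tb T(2) by (simp add: Un_absorb1)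
  also have "\<dots> \<le> emeasure lborel T + ennreal e"
    using T(3) A0 Tb by (intro add_left_mono) simp
  finally have "emeasure segment_measure A \<le> emeasure segment_measure (\<gamma> ` T) + ennreal e"
    unfolding emeasure_segment[OF A] emeasure_segment[OF K\<mu>] KT A0_def .
  moreover have "\<gamma> ` T \<subseteq> A" using T(2) by (auto simp: A0_def)
  ultimately show thesis using K by (intro that)
qed

lemma inner_regular_segment: "inner_regular_compact Z segment_measure"
  unfolding inner_regular_compact_def
proof (intro ballI antisym)
  fix A assume A: "A \<in> sets segment_measure"
  let ?S = "SUP K\<in>{K. compactin (mtopology_of Z) K \<and> K \<subseteq> A}. emeasure segment_measure K"
  show "emeasure segment_measure A \<le> ?S"
  proof (rule ennreal_le_epsilon)
    fix e :: real assume "0 < e"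
    then obtain K where K: "compactin (mtopology_of Z) K" "K \<subseteq> A"
      "emeasure segment_measure A \<le> emeasure segment_measure K + ennreal e"
      using segment_inner_compact[OF A] by metis
    have "emeasure segment_measure K \<le> ?S" by (rule SUP_upper) (use K in simp)
    then show "emeasure segment_measure A \<le> ?S + ennreal e"
      using K(3) by (meson add_right_mono order.trans)
  qed
  show "?S \<le> emeasure segment_measure A"
    by (rule SUP_least) (use A in \<open>auto intro: emeasure_mono\<close>)
qed

lemma start_Lip: "mdist Z (\<gamma> 0) \<in> Lip Z" "LIP Z (mdist Z (\<gamma> 0)) \<le> 1"
proof -
  have *: "\<bar>mdist Z (\<gamma> 0) x - mdist Z (\<gamma> 0) y\<bar> \<le> 1 * mdist Z x y" if "x \<in> mspace Z" "y \<in> mspace Z" for x y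
    using mdist_triangle[OF in_space that, of 0] mdist_triangle[OF in_space that(2,1), of 0]
    by (simp add: mdist_commute abs_le_iff)
  show "mdist Z (\<gamma> 0) \<in> Lip Z" by (rule LipI[of 1]) (use * in auto)
  show "LIP Z (mdist Z (\<gamma> 0)) \<le> 1" by (rule LIP_le) (use * in auto)
qed

text \<open>The distance from the endpoint \<open>\<gamma> 0\<close> is \<open>1\<close>-Lipschitz and restricts to the parameter \<open>t\<close> on the segment, so it
  turns \<open>\<integral> f d\<pi>\<close> into \<open>\<integral> f dt\<close>.\<close>

lemma segment_current_start:
  assumes f: "f \<in> Lip Z"
  shows "segment_current f (mdist Z (\<gamma> 0)) = (\<integral>x. f x \<partial>segment_measure)"
  unfolding segment_current_def integral_segment_measure[OF f]
  by (rule stieltjes_id[OF Lip_unit_lipschitz[OF f order_refl]]) (use iso[of 0] in simp)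

text \<open>Test the mass bound of \<open>\<nu>\<close> with \<open>\<pi>\<close> the distance from \<open>\<gamma> 0\<close> and with Lipschitz functions decreasing to
  the indicator function of \<open>K\<close>; the bound becomes an inequality between the two measures of \<open>K\<close>.\<close>

lemma segment_measure_least_compact:
  assumes \<nu>: "mass_bound Z segment_current \<nu>" and K: "compactin (mtopology_of Z) K"
  shows "emeasure segment_measure K \<le> emeasure \<nu> K"
proof (cases "K = {}")
  case False
  have \<nu>': "borel_measure_on Z \<nu>" "finite_measure \<nu>" using \<nu> unfolding mass_bound_def by blast+
  have sp: "space \<nu> = mspace Z" using \<nu>'(1) unfolding borel_measure_on_def by blast
  have KZ: "K \<subseteq> mspace Z" using compactin_subset_topspace[OF K] by simp
  have Kc: "closedin (mtopology_of Z) K" by (rule compactin_imp_closedin_mtopology_of[OF K])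
  \<comment> \<open>The distance from \<open>K\<close>, written as the infimal convolution of the zero function.\<close>
  define d where "d x = (INF u\<in>K. 0 + mdist Z x u)" for x
  have bdd: "bdd_below ((\<lambda>u. 0 + mdist Z x u) ` K)" for x by (rule bdd_belowI2[of _ 0]) simp
  have d_lip': "d x \<le> mdist Z x y + d y" if "x \<in> mspace Z" "y \<in> mspace Z" for x y
    unfolding d_def
    by (rule inf_convolution_le[where q = "mdist Z" and h = "\<lambda>_. 0", OF False bdd])
       (use that KZ in \<open>auto intro: mdist_triangle\<close>)
  have d_lip: "\<bar>d x - d y\<bar> \<le> mdist Z x y" if "x \<in> mspace Z" "y \<in> mspace Z" for x y
    using d_lip'[OF that] d_lip'[OF that(2,1)] by (simp add: mdist_commute abs_le_iff)
  have d_nonneg: "0 \<le> d x" for x unfolding d_def by (rule cINF_greatest[OF False]) simp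
  have d_zero: "d x = 0" if "x \<in> K" for x
    using cINF_lower[OF bdd[of x] that] d_nonneg[of x] that KZ unfolding d_def by auto
  have d_pos: "0 < d x" if x: "x \<in> mspace Z" "x \<notin> K" for x
  proof -
    have "openin (mtopology_of Z) (mspace Z - K)" using Kc by (simp add: closedin_def)
    then have "\<forall>y. y \<in> mspace Z - K \<longrightarrow> (\<exists>r>0. mball_of Z y r \<subseteq> mspace Z - K)"
      using Metric_space.openin_mtopology[OF Metric_space_mspace_mdist, of Z "mspace Z - K"]
      unfolding mtopology_of_def mball_of_def by (elim iffD1[THEN conjunct2])
    moreover have "x \<in> mspace Z - K" using x by simp
    ultimately obtain r where r: "0 < r" "mball_of Z x r \<subseteq> mspace Z - K" by metis
    have "r \<le> d x" unfolding d_def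
    proof (rule cINF_greatest[OF False])
      fix u assume "u \<in> K"
      then have "u \<notin> mball_of Z x r" "u \<in> mspace Z" using r(2) KZ by auto
      then show "r \<le> 0 + mdist Z x u" using x by auto
    qed
    then show ?thesis using r(1) by simp
  qed
  define f where "f n x = max 0 (1 - real n * d x)" for n x
  have f01: "0 \<le> f n x" "f n x \<le> 1" for n x using d_nonneg[of x] by (auto simp: f_def)
  have fL: "f n \<in> Lip Z" for n
  proof (rule LipI[of "real n"])
    fix x y assume xy: "x \<in> mspace Z" "y \<in> mspace Z"
    have "\<bar>f n x - f n y\<bar> \<le> \<bar>real n * d x - real n * d y\<bar>" unfolding f_def by linarith
    also have "\<dots> = real n * \<bar>d x - d y\<bar>" by (simp add: right_diff_distrib[symmetric] abs_mult)
    also have "\<dots> \<le> real n * mdist Z x y" by (intro mult_left_mono d_lip xy) simp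
    finally show "\<bar>f n x - f n y\<bar> \<le> real n * mdist Z x y" .
  qed simp
  have fb: "f n \<in> Lip_b Z" for n by (rule Lip_bI[OF fL, where S = 1]) (use f01 in simp)
  have lim: "(\<lambda>n. f n x) \<longlonglongrightarrow> indicat_real K x" if x: "x \<in> mspace Z" for x
  proof (cases "x \<in> K")
    case True
    then have "f n x = 1" for n by (simp add: f_def d_zero)
    then show ?thesis using True by simp
  next
    case False
    obtain N :: nat where N: "1 < real N * d x"
      using reals_Archimedean3[OF d_pos[OF x False]] by blast
    have "f n x = 0" if "N \<le> n" for n
    proof -
      have "real N * d x \<le> real n * d x" using that d_nonneg[of x] by (intro mult_right_mono) auto
      then show ?thesis using N by (simp add: f_def)
    qed
    then have "\<forall>\<^sub>F n in sequentially. f n x = 0" by (auto simp: eventually_sequentially)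
    then show ?thesis using False by (simp add: tendsto_eventually)
  qed
  have conv: "(\<lambda>n. \<integral>x. f n x \<partial>\<mu>) \<longlonglongrightarrow> measure \<mu> K"
    if \<mu>: "borel_measure_on Z \<mu>" "finite_measure \<mu>" for \<mu>
  proof -
    interpret finite_measure \<mu> by (rule \<mu>)
    have K\<mu>: "K \<in> sets \<mu>" by (rule borel_measure_on_closedin[OF \<mu>(1) Kc])
    have sp: "space \<mu> = mspace Z" using \<mu>(1) unfolding borel_measure_on_def by blast
    have "(\<lambda>n. \<integral>x. f n x \<partial>\<mu>) \<longlonglongrightarrow> (\<integral>x. indicat_real K x \<partial>\<mu>)"
    proof (rule integral_dominated_convergence[where w = "\<lambda>_. 1"])
      show "f n \<in> borel_measurable \<mu>" for n by (rule Lip_borel_measurable[OF fL \<mu>(1)])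
      show "indicat_real K \<in> borel_measurable \<mu>" using K\<mu> by (rule borel_measurable_indicator)
      show "AE x in \<mu>. (\<lambda>n. f n x) \<longlonglongrightarrow> indicat_real K x" by (rule AE_I2) (use lim sp in simp)
      show "AE x in \<mu>. norm (f n x) \<le> 1" for n by (rule AE_I2) (use f01 in simp)
    qed simp
    then show ?thesis using K\<mu> by simp
  qed
  have le: "(\<integral>x. f n x \<partial>segment_measure) \<le> (\<integral>x. f n x \<partial>\<nu>)" for n
  proof -
    have "(\<integral>x. f n x \<partial>segment_measure) \<le> \<bar>segment_current (f n) (mdist Z (\<gamma> 0))\<bar>"
      using segment_current_start[OF fL, of n] by simp
    also have "\<dots> \<le> LIP Z (mdist Z (\<gamma> 0)) * (\<integral>x. \<bar>f n x\<bar> \<partial>\<nu>)"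
      using \<nu> fb start_Lip(1) unfolding mass_bound_def by blast
    also have "\<dots> \<le> 1 * (\<integral>x. \<bar>f n x\<bar> \<partial>\<nu>)"
      by (intro mult_right_mono start_Lip(2)) simp
    also have "\<dots> = (\<integral>x. f n x \<partial>\<nu>)" using f01 by simp
    finally show ?thesis .
  qed
  have "measure segment_measure K \<le> measure \<nu> K"
    using LIMSEQ_le[OF conv[OF borel_measure_on_segment finite_segment_measure] conv[OF \<nu>']] le by blast
  then show ?thesis
    using finite_measure.emeasure_eq_measure[OF \<nu>'(2)] finite_measure.emeasure_eq_measure[OF finite_segment_measure]
    by (simp add: ennreal_leI)
qed simp

lemma segment_is_mass_measure: "is_mass_measure Z segment_current segment_measure"
  unfolding is_mass_measure_def
proof (intro conjI allI impI ballI mass_bound_segment)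
  fix \<nu> A assume \<nu>: "mass_bound Z segment_current \<nu>" and A: "A \<in> sets segment_measure"
  have "sets \<nu> = sets segment_measure"
    using \<nu> borel_measure_on_segment unfolding mass_bound_def borel_measure_on_def by simp
  then have A\<nu>: "A \<in> sets \<nu>" using A by simp
  show "emeasure segment_measure A \<le> emeasure \<nu> A"
  proof (rule ennreal_le_epsilon)
    fix e :: real assume "0 < e"
    then obtain K where K: "compactin (mtopology_of Z) K" "K \<subseteq> A"
      "emeasure segment_measure A \<le> emeasure segment_measure K + ennreal e"
      using segment_inner_compact[OF A] by metis
    note K(3)
    also have "emeasure segment_measure K \<le> emeasure \<nu> K" by (rule segment_measure_least_compact[OF \<nu> K(1)])
    also have "emeasure \<nu> K \<le> emeasure \<nu> A" by (rule emeasure_mono[OF K(2) A\<nu>])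
    finally show "emeasure segment_measure A \<le> emeasure \<nu> A + ennreal e" by (simp add: add_right_mono)
  qed
qed

lemma nonzero_regular_current: "\<exists>T\<in>metric_currents1_reg Z. \<not> zero_current Z T"
proof
  show "segment_current \<in> metric_currents1_reg Z"
    unfolding metric_currents1_reg_def
    using segment_current_in segment_is_mass_measure inner_regular_segment by blast
  have one: "(\<lambda>_. 1) \<in> Lip Z" by (rule LipI[of 0]) auto
  then have "(\<lambda>_. 1) \<in> Lip_b Z" by (rule Lip_bI[where S = 1]) simp
  moreover have "segment_current (\<lambda>_. 1) (mdist Z (\<gamma> 0)) = 1"
    unfolding segment_current_start[OF one] integral_segment_measure[OF one] by simp
  ultimately show "\<not> zero_current Z segment_current"
    unfolding zero_current_def using start_Lip(1) by (intro notI) (drule bspec, assumption, drule bspec, assumption, simp)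
qed

end

section \<open>The equivalence\<close>

text \<open>If for one \<open>\<delta>\<close> all short-stepped chains are stretched, the chain inequality holds; otherwise there are
  nearly straight chains for every \<open>\<delta>\<close>.\<close>

lemma chain_ineq_or_segment:
  fixes X :: "'a metric"
  obtains (chain) p c where "1 < p" "0 < c" "chain_ineq X p c"
  | (segment) Z z \<gamma> where "is_ultralimit X Z z" "isometric_segment Z \<gamma>"
proof (cases "\<exists>p c. 1 < p \<and> 0 < c \<and> chain_ineq X p c")
  case True
  then show thesis using chain by blast
next
  case False
  have straight: "\<exists>x N. (\<forall>i. x i \<in> mspace X) \<and>
      (\<forall>i<N. mdist X (x i) (x (Suc i)) \<le> \<delta> * mdist X (x 0) (x N)) \<and>
      (\<Sum>i<N. mdist X (x i) (x (Suc i))) < (1 + \<delta>) * mdist X (x 0) (x N)"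
    if \<delta>: "0 < \<delta>" "\<delta> \<le> 1" for \<delta>
  proof (rule ccontr)
    assume "\<not> ?thesis"
    then have neg: "\<forall>x N. \<not> ((\<forall>i. x i \<in> mspace X) \<and>
        (\<forall>i<N. mdist X (x i) (x (Suc i)) \<le> \<delta> * mdist X (x 0) (x N)) \<and>
        (\<Sum>i<N. mdist X (x i) (x (Suc i))) < (1 + \<delta>) * mdist X (x 0) (x N))"
      by (unfold not_ex)
    obtain p c where "1 < p" "0 < c" "chain_ineq X p c"
    proof (rule stretched_imp_chain_ineq[OF \<delta>, of X])
      fix x :: "nat \<Rightarrow> 'a" and N
      assume "\<And>i. x i \<in> mspace X"
        "\<And>i. i < N \<Longrightarrow> mdist X (x i) (x (Suc i)) \<le> \<delta> * mdist X (x 0) (x N)"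
      then show "(1 + \<delta>) * mdist X (x 0) (x N) \<le> (\<Sum>i<N. mdist X (x i) (x (Suc i)))"
        using neg[rule_format, of x N] by (simp add: not_less)
    qed
    with False show False by blast
  qed
  show thesis
    by (rule straight_chains_imp_segment[OF straight]) (assumption | rule segment)+
qed

theorem theorem1p1:
  fixes X :: "'a metric"
  shows
    "((\<exists>S :: 'a metric. snowflake S \<and> biLipschitz_equivalent X S)
       \<longleftrightarrow> (\<forall>Z z. is_ultralimit X Z z \<longrightarrow> \<not> (\<exists>\<gamma>. rectifiable_curve Z \<gamma> \<and> nonconstant_curve \<gamma>)))
   \<and> ((\<forall>Z z. is_ultralimit X Z z \<longrightarrow> \<not> (\<exists>\<gamma>. rectifiable_curve Z \<gamma> \<and> nonconstant_curve \<gamma>))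
       \<longleftrightarrow> (\<forall>Z z. is_ultralimit X Z z \<longrightarrow> purely_unrectifiable1 Z))
   \<and> ((\<forall>Z z. is_ultralimit X Z z \<longrightarrow> purely_unrectifiable1 Z)
       \<longleftrightarrow> (\<forall>Z z. is_ultralimit X Z z \<longrightarrow> (\<forall>T \<in> metric_currents1_reg Z. zero_current Z T)))"
proof (cases rule: chain_ineq_or_segment[of X])
  case (chain p c)
  have Z: "chain_ineq Z p c" if "is_ultralimit X Z z" for Z z
    using chain_ineq_ultralimit[OF chain(3) _ that] chain(1) by simp
  have i: "\<exists>S :: 'a metric. snowflake S \<and> biLipschitz_equivalent X S"
    by (rule chain_ineq_imp_snowflake[OF chain])
  have ii: "\<forall>Z z. is_ultralimit X Z z \<longrightarrow> \<not> (\<exists>\<gamma>. rectifiable_curve Z \<gamma> \<and> nonconstant_curve \<gamma>)"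
    using chain_ineq_imp_rectifiable_curve_constant[OF chain(1,2) Z] by blast
  have iii: "\<forall>Z z. is_ultralimit X Z z \<longrightarrow> purely_unrectifiable1 Z"
    using chain_ineq_imp_purely_unrectifiable[OF chain(1,2) Z] by blast
  have iv: "\<forall>Z z. is_ultralimit X Z z \<longrightarrow> (\<forall>T \<in> metric_currents1_reg Z. zero_current Z T)"
    using chain_ineq_imp_currents_zero[OF chain(1,2) Z] by blast
  show ?thesis
    by (intro conjI) (rule iffI[OF ii i] iffI[OF iii ii] iffI[OF iv iii])+
next
  case (segment Z z \<gamma>)
  interpret isometric_segment Z \<gamma> by (rule segment(2))
  have ii: "\<not> (\<forall>Z z. is_ultralimit X Z z \<longrightarrow> \<not> (\<exists>\<gamma>. rectifiable_curve Z \<gamma> \<and> nonconstant_curve \<gamma>))"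
    using segment(1) segment_imp_curve by blast
  have iii: "\<not> (\<forall>Z z. is_ultralimit X Z z \<longrightarrow> purely_unrectifiable1 Z)"
    using segment(1) segment_not_purely_unrectifiable by blast
  have iv: "\<not> (\<forall>Z z. is_ultralimit X Z z \<longrightarrow> (\<forall>T \<in> metric_currents1_reg Z. zero_current Z T))"
    using segment(1) nonzero_regular_current by blast
  have i: "\<not> (\<exists>S :: 'a metric. snowflake S \<and> biLipschitz_equivalent X S)"
  proof
    assume "\<exists>S :: 'a metric. snowflake S \<and> biLipschitz_equivalent X S"
    then obtain p c where pc: "1 < p" "0 < c" "chain_ineq X p c"
      using snowflake_imp_chain_ineq by metis
    then have "chain_ineq Z p c" using chain_ineq_ultralimit[OF pc(3) _ segment(1)] by simp
    then show False
      using chain_ineq_imp_rectifiable_curve_constant[OF pc(1,2)] segment_imp_curve by blast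
  qed
  show ?thesis by (simp only: i ii iii iv simp_thms)
qed

end
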